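(* Let $\Sigma\le S_n$ be a Young subgroup and $G\le\Sigma$ a subgroup of index $\ell=[\Sigma:G]$. Let $\omega\in\mathbb{Z}[V]^\Sigma$ be a non-zero element of degree 1 and let $z\in\mathbb{Z}^n$ have trivial stabilizer in $\Sigma$ and satisfy $\omega(z)\ne0$. Consider the algorithm which, for each $d=0,1,\dots,t$ with $\tau(d)\neq0$, computes a lattice basis $\bar f_1,\dots,\bar f_{\tau(d)}$ of the lattice $\varepsilon_d(M_d)$, lifts each $\bar f_i$ to an element $f_i\in\mathbb{Z}[V]^G_d$ with $\varepsilon_d(\mathrm{res}_X(f_i))=\bar f_i$, and adds $f_1,\dots,f_{\tau(d)}$ to the output list $\theta_*$ (initially empty). Then the output $\theta_*$ of this algorithm is a set of universal secondaries.
   Context: $\Sigma=S_{k_1}\times\cdots\times S_{k_r}$ with $k_1+\dots+k_r=n$. For a commutative ring $R$, $R[V]=R[x_1,\dots,x_n]$, with $S_n$ permuting the variables, and $(g\cdot f)(v)=f(g^{-1}v)$. $R[V]^G_d$ is the degree-$d$ part of the invariant ring. $R[V]^\Sigma$ is a polynomial ring over $R$; $R[V]^G$ is called Cohen-Macaulay if it is free as an $R[V]^\Sigma$-module. A set of secondaries for $\mathbb{Q}[V]^G$ is a minimal set of homogeneous generators of $\mathbb{Q}[V]^G$ as a $\mathbb{Q}[V]^\Sigma$-module; it has exactly $\ell$ elements and is a module basis, and the multiset of their degrees does not depend on the choice. $\tau(d)$ is the number of secondaries of degree $d$ and $t$ is the largest degree of a secondary. A set of universal secondaries is a set of secondaries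 $\theta_1,\dots,\theta_\ell\in\mathbb{Z}[V]^G$ for $\mathbb{Q}[V]^G$ such that $\mathbb{F}_p[V]^G=\bigoplus_{i}\mathbb{F}_p[V]^\Sigma\,\overline{\theta}_i$ for every prime $p$ for which $\mathbb{F}_p[V]^G$ is Cohen-Macaulay ($\overline\theta_i$ is the reduction mod $p$). Let $\gamma_1,\dots,\gamma_\ell$ be left coset representatives of $G$ in $\Sigma$, $w_i=\gamma_i^{-1}z$, $X=\{w_1,\dots,w_\ell\}$, and $\mathrm{res}_X(f)=(f(w_1),\dots,f(w_\ell))$. Put $\mathbb{Q}L_d=\mathrm{res}_X(\mathbb{Q}[V]^G_d)\subseteq\mathbb{Q}^\ell$, $\mathbb{R}L_d=\mathrm{res}_X(\mathbb{R}[V]^G_d)\subseteq\mathbb{R}^\ell$, with $\mathbb{Q}L_{-1}=\mathbb{R}L_{-1}=0$; one has $\mathbb{Q}L_{d-1}\subseteq\mathbb{Q}L_d$. Let $M_d=\mathrm{res}_X(\mathbb{Z}[V]^G_d)$, and let $\varepsilon_d$ be the orthogonal projection (standard inner product on $\mathbb{R}^\ell$) of $\mathbb{R}L_d$ onto the orthogonal complement of $\mathbb{R}L_{d-1}$ in $\mathbb{R}L_d$, identified with the quotient map $\mathbb{Q}L_d\to\mathbb{Q}L_d/\mathbb{Q}L_{d-1}$ on rational points. The lattice $\varepsilon_d(M_d)$ has rank $\tau(d)$. *)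

theory Defs
  imports
    "HOL-Analysis.Analysis"
    "HOL-Library.Poly_Mapping"
    "HOL-Algebra.Left_Coset"
    "HOL-Algebra.Algebraic_Closure_Type"
    "HOL-Computational_Algebra.Primes"
begin

section \<open>Young subgroups\<close>

text \<open>
  The finite type \<open>'n\<close> plays the role of $\{1,\dots,n\}$.  A Young subgroup is given by a
  colouring \<open>c\<close> whose fibres are the blocks, of sizes $k_1,\dots,k_r$: it consists of the
  permutations preserving every block, i.e. it is the product of the symmetric groups of the blocks.
\<close>

definition young :: "('n \<Rightarrow> nat) \<Rightarrow> ('n \<Rightarrow> 'n) monoid" where
  "young c = \<lparr>carrier = {\<sigma>. bij \<sigma> \<and> (\<forall>i. c (\<sigma> i) = c i)}, mult = (\<circ>), one = id\<rparr>"

text \<open>The bijection with the cosets forces \<open>CARD('l)\<close> to be the index of \<open>G\<close>.\<close>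

definition left_coset_reps :: "('n \<Rightarrow> nat) \<Rightarrow> ('n \<Rightarrow> 'n) set \<Rightarrow> ('l::finite \<Rightarrow> 'n \<Rightarrow> 'n) \<Rightarrow> bool" where
  "left_coset_reps c G \<gamma> \<longleftrightarrow>
     range \<gamma> \<subseteq> carrier (young c) \<and>
     bij_betw (\<lambda>i. \<gamma> i <#\<^bsub>young c\<^esub> G) UNIV (lcosets\<^bsub>young c\<^esub> G)"


section \<open>Polynomials\<close>

type_synonym ('n, 'a) mpoly = "('n \<Rightarrow>\<^sub>0 nat) \<Rightarrow>\<^sub>0 'a"

definition mono_degree :: "('n::finite \<Rightarrow>\<^sub>0 nat) \<Rightarrow> nat" where
  "mono_degree m = (\<Sum>i\<in>UNIV. Poly_Mapping.lookup m i)"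

definition homogeneous :: "nat \<Rightarrow> ('n::finite, 'a::zero) mpoly \<Rightarrow> bool" where
  "homogeneous d f \<longleftrightarrow> (\<forall>m\<in>Poly_Mapping.keys f. mono_degree m = d)"

definition eval :: "('n::finite, 'a::comm_ring_1) mpoly \<Rightarrow> ('n \<Rightarrow> 'a) \<Rightarrow> 'a" where
  "eval f v = (\<Sum>m\<in>Poly_Mapping.keys f.
     Poly_Mapping.lookup f m * (\<Prod>i\<in>UNIV. v i ^ Poly_Mapping.lookup m i))"

text \<open>
  A permutation sends the \<open>i\<close>-th basis vector of $V$ to the \<open>g i\<close>-th one, and the variable
  $x_i$ to $x_{g(i)}$; so the coefficient of \<open>m\<close> in \<open>g\<cdot>f\<close> is that of \<open>m \<circ> g\<close> in \<open>f\<close>.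
  Lemma \<open>eval_act\<close> below is the rule $(g\cdot f)(v)=f(g^{-1}v)$.
\<close>

definition point_act :: "('n \<Rightarrow> 'n) \<Rightarrow> ('n \<Rightarrow> 'a) \<Rightarrow> 'n \<Rightarrow> 'a" where
  "point_act g v = v \<circ> inv_into UNIV g"

definition act :: "('n \<Rightarrow> 'n) \<Rightarrow> ('n, 'a::zero) mpoly \<Rightarrow> ('n, 'a) mpoly" where
  "act g f = Poly_Mapping.map_key (Poly_Mapping.map_key g) f"

definition coeff_of_int :: "('n, int) mpoly \<Rightarrow> ('n, 'a::ring_1) mpoly" where
  "coeff_of_int f = Poly_Mapping.map of_int f"

abbreviation ZV :: "('n, int) mpoly ring" where "ZV \<equiv> ring_of_type_algebra"
abbreviation QV :: "('n, rat) mpoly ring" where "QV \<equiv> ring_of_type_algebra"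
abbreviation RV :: "('n, real) mpoly ring" where "RV \<equiv> ring_of_type_algebra"

text \<open>
  The elements of $\mathbb{F}_p[V]$ are represented by the integer polynomials with coefficients
  in $\{0,\dots,p-1\}$, so that \<open>act\<close> and \<open>homogeneous\<close> apply to them verbatim.
\<close>

definition red :: "nat \<Rightarrow> ('n, int) mpoly \<Rightarrow> ('n, int) mpoly" where
  "red p f = Poly_Mapping.map (\<lambda>a. a mod int p) f"

definition FV :: "nat \<Rightarrow> ('n, int) mpoly ring" where
  "FV p = \<lparr>carrier = {f. \<forall>m. Poly_Mapping.lookup f m \<in> {0..<int p}},
     mult = (\<lambda>f g. red p (f * g)), one = red p 1,
     zero = 0, add = (\<lambda>f g. red p (f + g))\<rparr>"

text \<open>Below, \<open>A\<close> is one of the polynomial rings \<open>ZV\<close>, \<open>QV\<close>, \<open>RV\<close>, \<open>FV p\<close>.\<close>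

definition invariants :: "('n, 'a::zero) mpoly ring \<Rightarrow> ('n \<Rightarrow> 'n) set \<Rightarrow> ('n, 'a) mpoly set" where
  "invariants A G = {f \<in> carrier A. \<forall>g\<in>G. act g f = f}"

definition invariants_deg ::
    "('n::finite, 'a::zero) mpoly ring \<Rightarrow> ('n \<Rightarrow> 'n) set \<Rightarrow> nat \<Rightarrow> ('n, 'a) mpoly set" where
  "invariants_deg A G d = {f \<in> invariants A G. homogeneous d f}"


section \<open>Modules over a subring\<close>

text \<open>\<open>S\<close> is a subring of the commutative ring \<open>A\<close>, and \<open>M\<close> is an \<open>S\<close>-submodule of \<open>A\<close>.\<close>

definition coeff_families :: "('a, 'b) ring_scheme \<Rightarrow> 'a set \<Rightarrow> 'i set \<Rightarrow> ('i \<Rightarrow> 'a) set" where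
  "coeff_families A S I =
     {k. k ` I \<subseteq> S \<and> (\<forall>i. i \<notin> I \<longrightarrow> k i = \<zero>\<^bsub>A\<^esub>) \<and> finite {i. k i \<noteq> \<zero>\<^bsub>A\<^esub>}}"

definition lin_comb :: "('a, 'b) ring_scheme \<Rightarrow> ('i \<Rightarrow> 'a) \<Rightarrow> ('i \<Rightarrow> 'a) \<Rightarrow> 'a" where
  "lin_comb A b k = (\<Oplus>\<^bsub>A\<^esub>i\<in>{i. k i \<noteq> \<zero>\<^bsub>A\<^esub>}. k i \<otimes>\<^bsub>A\<^esub> b i)"

definition module_generators :: "('a, 'b) ring_scheme \<Rightarrow> 'a set \<Rightarrow> 'a set \<Rightarrow> 'a set \<Rightarrow> bool" where
  "module_generators A S M B \<longleftrightarrow>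
     B \<subseteq> M \<and> (\<forall>x\<in>M. \<exists>k\<in>coeff_families A S B. x = lin_comb A (\<lambda>b. b) k)"

definition module_basis ::
    "('a, 'b) ring_scheme \<Rightarrow> 'a set \<Rightarrow> 'a set \<Rightarrow> 'i set \<Rightarrow> ('i \<Rightarrow> 'a) \<Rightarrow> bool" where
  "module_basis A S M I b \<longleftrightarrow>
     b ` I \<subseteq> M \<and> (\<forall>x\<in>M. \<exists>!k. k \<in> coeff_families A S I \<and> x = lin_comb A b k)"

definition free_module :: "('a, 'b) ring_scheme \<Rightarrow> 'a set \<Rightarrow> 'a set \<Rightarrow> bool" where
  "free_module A S M \<longleftrightarrow> (\<exists>B. module_basis A S M B (\<lambda>b. b))"


section \<open>Secondary invariants\<close>

definition cohen_macaulay ::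
    "('n, 'a::zero) mpoly ring \<Rightarrow> ('n \<Rightarrow> nat) \<Rightarrow> ('n \<Rightarrow> 'n) set \<Rightarrow> bool" where
  "cohen_macaulay A c G \<longleftrightarrow>
     free_module A (invariants A (carrier (young c))) (invariants A G)"

definition secondaries ::
    "('n::finite \<Rightarrow> nat) \<Rightarrow> ('n \<Rightarrow> 'n) set \<Rightarrow> ('n, rat) mpoly set \<Rightarrow> bool" where
  "secondaries c G \<Theta> \<longleftrightarrow>
     (let gen = module_generators QV (invariants QV (carrier (young c))) (invariants QV G)
      in (\<forall>\<theta>\<in>\<Theta>. \<exists>d. homogeneous d \<theta>) \<and> gen \<Theta> \<and> (\<forall>\<Theta>'. \<Theta>' \<subset> \<Theta> \<longrightarrow> \<not> gen \<Theta>'))"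

text \<open>The multiset of degrees of a set of secondaries does not depend on the choice.\<close>

definition tau :: "('n::finite \<Rightarrow> nat) \<Rightarrow> ('n \<Rightarrow> 'n) set \<Rightarrow> nat \<Rightarrow> nat" where
  "tau c G d = card {\<theta> \<in> (SOME \<Theta>. secondaries c G \<Theta>). homogeneous d \<theta>}"

definition top_degree :: "('n::finite \<Rightarrow> nat) \<Rightarrow> ('n \<Rightarrow> 'n) set \<Rightarrow> nat" where
  "top_degree c G = Max {d. tau c G d \<noteq> 0}"

definition universal_secondaries ::
    "('n::finite \<Rightarrow> nat) \<Rightarrow> ('n \<Rightarrow> 'n) set \<Rightarrow> ('n, int) mpoly list \<Rightarrow> bool" where
  "universal_secondaries c G \<theta>s \<longleftrightarrow>
     distinct \<theta>s \<and> set \<theta>s \<subseteq> invariants ZV G \<and>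
     secondaries c G (coeff_of_int ` set \<theta>s) \<and>
     (\<forall>p. Factorial_Ring.prime p \<longrightarrow> cohen_macaulay (FV p) c G \<longrightarrow>
        module_basis (FV p) (invariants (FV p) (carrier (young c))) (invariants (FV p) G)
          {..<length \<theta>s} (\<lambda>i. red p (\<theta>s ! i)))"


section \<open>The algorithm\<close>

text \<open>$\mathrm{res}_X(f) = (f(w_i))_i$ with $w_i = \gamma_i^{-1}z$.\<close>

definition resX ::
    "('l::finite \<Rightarrow> 'n \<Rightarrow> 'n) \<Rightarrow> ('n \<Rightarrow> int) \<Rightarrow> ('n::finite, real) mpoly \<Rightarrow> real ^ 'l" where
  "resX \<gamma> z f =
     (\<chi> i. eval f (\<lambda>j. real_of_int (point_act (inv_into UNIV (\<gamma> i)) z j)))"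

definition RL ::
    "('n \<Rightarrow> 'n) set \<Rightarrow> ('l::finite \<Rightarrow> 'n \<Rightarrow> 'n) \<Rightarrow> ('n::finite \<Rightarrow> int) \<Rightarrow> nat \<Rightarrow> (real ^ 'l) set" where
  "RL G \<gamma> z d = resX \<gamma> z ` invariants_deg RV G d"

definition RL_pred ::
    "('n \<Rightarrow> 'n) set \<Rightarrow> ('l::finite \<Rightarrow> 'n \<Rightarrow> 'n) \<Rightarrow> ('n::finite \<Rightarrow> int) \<Rightarrow> nat \<Rightarrow> (real ^ 'l) set" where
  "RL_pred G \<gamma> z d = (if d = 0 then {0} else RL G \<gamma> z (d - 1))"

definition Mlat ::
    "('n \<Rightarrow> 'n) set \<Rightarrow> ('l::finite \<Rightarrow> 'n \<Rightarrow> 'n) \<Rightarrow> ('n::finite \<Rightarrow> int) \<Rightarrow> nat \<Rightarrow> (real ^ 'l) set" where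
  "Mlat G \<gamma> z d = (\<lambda>f. resX \<gamma> z (coeff_of_int f)) ` invariants_deg ZV G d"

definition orth_proj :: "'v::euclidean_space set \<Rightarrow> 'v \<Rightarrow> 'v" where
  "orth_proj W v = (THE u. u \<in> W \<and> v - u \<in> W\<^sup>\<bottom>)"

definition eps :: "('n \<Rightarrow> 'n) set \<Rightarrow> ('l::finite \<Rightarrow> 'n \<Rightarrow> 'n) \<Rightarrow> ('n::finite \<Rightarrow> int) \<Rightarrow> nat \<Rightarrow>
    real ^ 'l \<Rightarrow> real ^ 'l" where
  "eps G \<gamma> z d = orth_proj (RL G \<gamma> z d \<inter> (RL_pred G \<gamma> z d)\<^sup>\<bottom>)"

definition lattice_basis :: "'v::real_vector set \<Rightarrow> 'v list \<Rightarrow> bool" where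
  "lattice_basis \<Lambda> bs \<longleftrightarrow>
     distinct bs \<and> independent (set bs) \<and>
     \<Lambda> = range (\<lambda>k :: nat \<Rightarrow> int. \<Sum>i<length bs. real_of_int (k i) *\<^sub>R bs ! i)"

text \<open>
  A lattice basis of $\varepsilon_d(M_d)$ and the chosen lifts are not determined, so the algorithm
  is the relation holding for all its possible outputs.  The length of \<open>bs d\<close> is not prescribed;
  it is the rank of the lattice.
\<close>

definition algorithm_output ::
    "('n::finite \<Rightarrow> nat) \<Rightarrow> ('n \<Rightarrow> 'n) set \<Rightarrow> ('l::finite \<Rightarrow> 'n \<Rightarrow> 'n) \<Rightarrow> ('n \<Rightarrow> int) \<Rightarrow>
      ('n, int) mpoly list \<Rightarrow> bool" where
  "algorithm_output c G \<gamma> z \<theta>s \<longleftrightarrow>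
     (let ds = filter (\<lambda>d. tau c G d \<noteq> 0) [0..<Suc (top_degree c G)]
      in \<exists>bs fs.
        (\<forall>d\<in>set ds.
           lattice_basis (eps G \<gamma> z d ` Mlat G \<gamma> z d) (bs d) \<and>
           set (fs d) \<subseteq> invariants_deg ZV G d \<and>
           map (\<lambda>f. eps G \<gamma> z d (resX \<gamma> z (coeff_of_int f))) (fs d) = bs d) \<and>
        \<theta>s = concat (map fs ds))"


section \<open>Consistency of the conventions\<close>

lemma inj_map_key:
  assumes "bij g"
  shows "inj (Poly_Mapping.map_key g :: ('n \<Rightarrow>\<^sub>0 nat) \<Rightarrow> _)"
proof (rule injI)
  fix m m' :: "'n \<Rightarrow>\<^sub>0 nat"
  assume eq: "Poly_Mapping.map_key g m = Poly_Mapping.map_key g m'"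
  have "Poly_Mapping.lookup m (g i) = Poly_Mapping.lookup m' (g i)" for i
    using arg_cong[OF eq, of "\<lambda>q. Poly_Mapping.lookup q i"] assms
    by (simp add: Poly_Mapping.map_key.rep_eq bij_is_inj)
  then show "m = m'"
    by (metis assms bij_is_surj poly_mapping_eqI surj_def)
qed

lemma lookup_act:
  "bij g \<Longrightarrow> Poly_Mapping.lookup (act g f) m = Poly_Mapping.lookup f (Poly_Mapping.map_key g m)"
  by (simp add: act_def Poly_Mapping.map_key.rep_eq inj_map_key)

lemma bij_map_key:
  fixes g :: "'n \<Rightarrow> 'n"
  assumes "bij g"
  shows "bij (Poly_Mapping.map_key g :: ('n \<Rightarrow>\<^sub>0 nat) \<Rightarrow> _)"
proof (rule bijI[OF inj_map_key[OF assms]])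
  have "Poly_Mapping.map_key g (Poly_Mapping.map_key (inv_into UNIV g) m) = m"
    for m :: "'n \<Rightarrow>\<^sub>0 nat"
    using assms
    by (intro poly_mapping_eqI)
      (simp add: Poly_Mapping.map_key.rep_eq bij_is_inj bij_imp_bij_inv)
  then show "surj (Poly_Mapping.map_key g :: ('n \<Rightarrow>\<^sub>0 nat) \<Rightarrow> _)"
    by (metis surj_def)
qed

lemma eval_act:
  fixes f :: "('n::finite, 'a::comm_ring_1) mpoly"
  assumes g: "bij g"
  shows "eval (act g f) v = eval f (point_act (inv_into UNIV g) v)"
proof -
  let ?h = "Poly_Mapping.map_key g :: ('n \<Rightarrow>\<^sub>0 nat) \<Rightarrow> _"
  have keys: "Poly_Mapping.keys (act g f) = ?h -` Poly_Mapping.keys f"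
    using g by (auto simp: in_keys_iff lookup_act)
  have bb: "bij_betw ?h (?h -` Poly_Mapping.keys f) (Poly_Mapping.keys f)"
    using bij_map_key[OF g]
    by (auto simp: bij_betw_def inj_on_def image_vimage_eq bij_is_surj)
  have inv2: "inv_into UNIV (inv_into UNIV g) = g"
    using g by (simp add: inv_inv_eq)
  have monom: "(\<Prod>i\<in>UNIV. v i ^ Poly_Mapping.lookup m i) =
      (\<Prod>i\<in>UNIV. point_act (inv_into UNIV g) v i ^ Poly_Mapping.lookup (?h m) i)" for m
    using prod.reindex_bij_betw[OF g, of "\<lambda>i. v i ^ Poly_Mapping.lookup m i"] g
    by (simp add: point_act_def inv2 Poly_Mapping.map_key.rep_eq bij_is_inj)
  have "eval (act g f) v = (\<Sum>m\<in>?h -` Poly_Mapping.keys f. Poly_Mapping.lookup f (?h m) *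
      (\<Prod>i\<in>UNIV. point_act (inv_into UNIV g) v i ^ Poly_Mapping.lookup (?h m) i))"
    unfolding eval_def keys using g by (simp add: lookup_act monom)
  also have "\<dots> = eval f (point_act (inv_into UNIV g) v)"
    unfolding eval_def by (rule sum.reindex_bij_betw[OF bb])
  finally show ?thesis .
qed

lemma lookup_red: "Poly_Mapping.lookup (red p f) m = Poly_Mapping.lookup f m mod int p"
  by (simp add: red_def Poly_Mapping.map.rep_eq when_def)

lemma
  assumes p: "Factorial_Ring.prime p"
  shows FV_cring: "cring (FV p :: ('n, int) mpoly ring)"
    and red_hom: "red p \<in> ring_hom ZV (FV p :: ('n, int) mpoly ring)"
proof -
  have p1: "int p > 1" using p prime_gt_1_nat by auto
  define E where "E f g \<longleftrightarrow> (\<forall>m. int p dvd Poly_Mapping.lookup (f - g) m)" for f g :: "('n, int) mpoly"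
  have red_eq: "red p f = red p g \<longleftrightarrow> E f g" for f g :: "('n, int) mpoly"
    unfolding E_def by (auto simp: poly_mapping_eq_iff fun_eq_iff lookup_red lookup_minus mod_eq_dvd_iff)
  have E_iff: "E f g \<longleftrightarrow> (\<exists>h. f = g + of_nat p * h)" for f g :: "('n, int) mpoly"
  proof
    assume e: "E f g"
    let ?h = "Poly_Mapping.map (\<lambda>a. a div int p) (f - g)"
    have "f = g + of_nat p * ?h"
    proof (rule poly_mapping_eqI)
      fix m
      have l: "Poly_Mapping.lookup (of_nat p * h) m = int p * Poly_Mapping.lookup h m" for h :: "('n, int) mpoly"
        by (induction p) (simp_all add: algebra_simps lookup_add)
      have "int p dvd Poly_Mapping.lookup f m - Poly_Mapping.lookup g m"
        using e by (simp add: E_def lookup_minus)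
      then show "Poly_Mapping.lookup f m = Poly_Mapping.lookup (g + of_nat p * ?h) m"
        by (simp add: lookup_add l Poly_Mapping.map.rep_eq when_def lookup_minus)
    qed
    then show "\<exists>h. f = g + of_nat p * h" by blast
  next
    assume "\<exists>h. f = g + of_nat p * h"
    then obtain h where h: "f = g + of_nat p * h" by blast
    have l: "Poly_Mapping.lookup (of_nat p * h) m = int p * Poly_Mapping.lookup h m" for m
      by (induction p) (simp_all add: algebra_simps lookup_add)
    show "E f g" unfolding E_def h by (simp add: l)
  qed
  have red_add: "red p (red p f + g) = red p (f + g)" "red p (f + red p g) = red p (f + g)"
    for f g :: "('n, int) mpoly"
    by (auto intro!: poly_mapping_eqI simp: lookup_red lookup_add mod_simps)
  have redE: "E (red p f) f" for f :: "('n, int) mpoly"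
    by (simp add: red_eq[symmetric] poly_mapping_eq_iff fun_eq_iff lookup_red)
  have red_mult: "red p (red p f * g) = red p (f * g)" "red p (g * red p f) = red p (g * f)"
    for f g :: "('n, int) mpoly"
  proof -
    obtain h where h: "red p f = f + of_nat p * h" using redE E_iff by blast
    have "red p f * g = f * g + of_nat p * (h * g)" by (simp add: h algebra_simps)
    then have "E (red p f * g) (f * g)" using E_iff by blast
    then show "red p (red p f * g) = red p (f * g)" using red_eq by blast
    then show "red p (g * red p f) = red p (g * f)" by (simp add: mult.commute)
  qed
  have carr: "red p f \<in> carrier (FV p)" for f :: "('n, int) mpoly"
    using p1 by (auto simp: FV_def lookup_red)
  have red_id: "red p f = f" if "f \<in> carrier (FV p)" for f :: "('n, int) mpoly"
    using that by (auto intro!: poly_mapping_eqI simp: FV_def lookup_red)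
  have z: "red p (0 :: ('n, int) mpoly) = 0"
    by (auto intro!: poly_mapping_eqI simp: lookup_red)
  have sel: "f \<otimes>\<^bsub>FV p\<^esub> g = red p (f * g)" "f \<oplus>\<^bsub>FV p\<^esub> g = red p (f + g)"
    "\<one>\<^bsub>FV p\<^esub> = red p 1" "\<zero>\<^bsub>FV p\<^esub> = 0" for f g :: "('n, int) mpoly"
    by (simp_all add: FV_def)
  show "cring (FV p :: ('n, int) mpoly ring)"
  proof (rule cringI)
    show "abelian_group (FV p :: ('n, int) mpoly ring)"
    proof (rule abelian_groupI)
      fix x :: "('n, int) mpoly" assume "x \<in> carrier (FV p)"
      have "red p (- x) \<oplus>\<^bsub>FV p\<^esub> x = \<zero>\<^bsub>FV p\<^esub>" by (simp add: sel red_add z)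
      then show "\<exists>y\<in>carrier (FV p). y \<oplus>\<^bsub>FV p\<^esub> x = \<zero>\<^bsub>FV p\<^esub>" using carr by blast
    qed (auto simp: sel carr red_add red_id add_ac carr[of 0, unfolded z])
    show "Group.comm_monoid (FV p :: ('n, int) mpoly ring)"
      by (rule comm_monoidI) (auto simp: sel carr red_mult red_id mult_ac)
  qed (auto simp: sel red_mult red_add algebra_simps)
  show "red p \<in> ring_hom ZV (FV p :: ('n, int) mpoly ring)"
    by (rule ring_hom_memI)
      (auto simp: carr sel red_mult red_add ring_of_type_algebra_def)
qed

end

theory Submission
  imports Defs "HOL-Real_Asymp.Real_Asymp"
begin

text \<open>
  Write $S=\mathbb{Z}[V]^\Sigma$ and $A=\mathbb{Z}[V]^G$, and let $S_+$ be the ideal of $S$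
  spanned by the elements of positive degree.  The algorithm chooses a basis of the lattice
  $\varepsilon_d(M_d)$; the point is that this lattice is the torsion-free quotient of
  $(A/S_+A)_d$.  In one direction, restriction to \<open>X\<close> sends $(S_+A)_d$ into
  $\mathbb{R}L_{d-1}$, because an element of $S$ is constant on \<open>X\<close> and because multiplication
  by $\omega$ makes the spaces $\mathbb{R}L_d$ increase (\<open>resZ_aug\<close>).  The converse
  is \<open>kernel_of_graded_restriction\<close>: if $f\in A_d$ restricts into $\mathbb{R}L_{d-1}$ then
  $|G|f\in S_+A$.

  For the converse, first let \<open>G\<close> be trivial.  Modulo $S_+\mathbb{Z}[V]$ every polynomial is a
  combination of at most $|\Sigma|$ monomials (Artin; \<open>artin_spanning\<close>).  Their restrictions
  to the orbit $\Sigma z$ span all functions on its $|\Sigma|$ points, hence are linearly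
  independent (\<open>artin_val_independent\<close>), and so no combination of those of degree \<open>d\<close>
  restricts into the span of those of smaller degree.  Averaging over \<open>G\<close> gives the general case.

  Over the rationals, subtracting from $f\in A_d$ a combination of the $\theta$ of degree \<open>d\<close> makes
  its image under $\varepsilon_d$ vanish, so what is left is, up to the factor $|G|$, in $S_+A$;
  induction on the degree shows that the output generates.  It is minimal since the
  $\varepsilon_d$-images of its elements of degree \<open>d\<close> are independent.  In the same way any set of
  secondaries spans the spaces $\mathbb{R}L_d$, whence $\tau(d)\neq 0$ in all degrees in which the
  filtration grows (\<open>tau_nonzero\<close>), and no degree is missed by the algorithm.  In particular the
  output has at least $\ell$ elements (\<open>card_\<Theta>_ge\<close>).

  Now let \<open>p\<close> be a prime for which $\mathbb{F}_p[V]^G$ has a basis \<open>B\<close> over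
  $\mathbb{F}_p[V]^\Sigma$.  Comparing the numbers of invariants of bounded degree gives
  $|B|\le\ell$ (\<open>basis_finite_rank\<close>): these numbers grow polynomially, while more than $\ell$
  basis elements would force exponential growth.  Since the $\theta$ form lattice bases, they are
  linearly independent in $A/(S_+A+pA)$ (\<open>independent_mod\<close>).  The constant terms of
  \<open>B\<close>-coordinates identify that quotient with $\mathbb{F}_p^B$, so $\ell\le|\Theta|\le|B|\le\ell$ and
  the $\theta$ span it.  The graded Nakayama lemma then shows that they generate
  $\mathbb{F}_p[V]^G$ (\<open>generates_mod\<close>).  Finally, expressing the $\theta$ through \<open>B\<close> gives a
  surjective endomorphism of a free module of finite rank; truncating at degree \<open>N\<close> turns it into
  a surjection between finite sets of the same size, so it is injective up to degree \<open>N\<close>, for every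
  \<open>N\<close> (\<open>relations_trivial_mod\<close>).  All computations modulo \<open>p\<close> are carried out with integer
  polynomials, compared through \<open>red p\<close>.
\<close>

unbundle no m_inv_syntax

section \<open>Polynomials as finitely supported coefficient functions\<close>

abbreviation lookup where "lookup \<equiv> Poly_Mapping.lookup"
abbreviation keys where "keys \<equiv> Poly_Mapping.keys"
abbreviation single where "single \<equiv> Poly_Mapping.single"
abbreviation mkey where "mkey \<equiv> Poly_Mapping.map_key"

lemma sum_of_monomials:
  fixes f :: "('n, 'a::comm_monoid_add) mpoly"
  shows "f = (\<Sum>m\<in>keys f. single m (lookup f m))"
proof (rule poly_mapping_eqI)
  fix k
  show "lookup f k = lookup (\<Sum>m\<in>keys f. single m (lookup f m)) k"
    by (cases "k \<in> keys f")
       (auto simp: lookup_sum lookup_single when_def sum.delta in_keys_iff)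
qed

lemma mpoly_induct [case_names single add]:
  fixes f :: "('n, 'a::comm_monoid_add) mpoly"
  assumes "\<And>m a. P (single m a)" and "\<And>f g. P f \<Longrightarrow> P g \<Longrightarrow> P (f + g)"
  shows "P f"
proof -
  have "P (\<Sum>m\<in>K. single m (lookup f m))" if "finite K" for K
    using that
  proof (induction K)
    case empty
    show ?case using assms(1)[of 0 0] by simp
  qed (simp add: assms)
  then show ?thesis using sum_of_monomials[of f] finite_keys by metis
qed

lemma mono_degree_0 [simp]: "mono_degree 0 = 0"
  by (simp add: mono_degree_def)

lemma mono_degree_add: "mono_degree (m + m') = mono_degree m + mono_degree m'"
  by (simp add: mono_degree_def lookup_add sum.distrib)

lemma mono_degree_single [simp]: "mono_degree (single i k) = k"
  by (simp add: mono_degree_def lookup_single when_def)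

lemma mono_degree_eq_0_iff [simp]: "mono_degree m = 0 \<longleftrightarrow> m = 0"
  by (auto simp: mono_degree_def poly_mapping_eq_iff fun_eq_iff)

lemma mono_degree_mkey:
  assumes "bij g"
  shows "mono_degree (mkey g m) = mono_degree m"
  unfolding mono_degree_def Poly_Mapping.map_key.rep_eq[OF bij_is_inj[OF assms]]
  using sum.reindex_bij_betw[OF assms, of "lookup m"] by (simp only: o_def)

lemma finite_mono_degree_le: "finite {m :: 'n::finite \<Rightarrow>\<^sub>0 nat. mono_degree m \<le> d}"
  and card_mono_degree_le:
    "card {m :: 'n::finite \<Rightarrow>\<^sub>0 nat. mono_degree m \<le> d} \<le> (d + 1) ^ CARD('n)"
proof -
  let ?A = "{m :: 'n \<Rightarrow>\<^sub>0 nat. mono_degree m \<le> d}"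
  have inj: "inj_on lookup ?A" by (simp add: inj_on_def lookup_inject)
  have sub: "lookup ` ?A \<subseteq> Pi\<^sub>E UNIV (\<lambda>_. {..d})"
  proof -
    have "lookup m i \<le> mono_degree m" for m :: "'n \<Rightarrow>\<^sub>0 nat" and i
      unfolding mono_degree_def by (rule member_le_sum) auto
    then have "lookup m i \<le> d" if "mono_degree m \<le> d" for m :: "'n \<Rightarrow>\<^sub>0 nat" and i
      using that le_trans by blast
    then show ?thesis by auto
  qed
  have fin: "finite (Pi\<^sub>E (UNIV :: 'n set) (\<lambda>_. {..d}))" by (simp add: finite_PiE)
  show "finite ?A" using inj sub fin by (meson finite_imageD finite_subset)
  have "card ?A = card (lookup ` ?A)" using inj by (simp add: card_image)
  also have "\<dots> \<le> card (Pi\<^sub>E (UNIV :: 'n set) (\<lambda>_. {..d}))" using sub fin by (rule card_mono[rotated])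
  also have "\<dots> = (d + 1) ^ CARD('n)" by (simp add: card_PiE)
  finally show "card ?A \<le> (d + 1) ^ CARD('n)" .
qed

lemma homogeneous_0 [simp]: "homogeneous d 0"
  by (simp add: homogeneous_def)

lemma homogeneous_add: "homogeneous d f \<Longrightarrow> homogeneous d g \<Longrightarrow> homogeneous d (f + g)"
  using keys_add[of f g] by (auto simp: homogeneous_def)

lemma homogeneous_sum: "(\<And>i. i \<in> I \<Longrightarrow> homogeneous d (f i)) \<Longrightarrow> homogeneous d (\<Sum>i\<in>I. f i)"
  by (induction I rule: infinite_finite_induct) (auto intro: homogeneous_add)

lemma homogeneous_mult:
  fixes f g :: "('n::finite, 'a::comm_ring_1) mpoly"
  shows "homogeneous d f \<Longrightarrow> homogeneous e g \<Longrightarrow> homogeneous (d + e) (f * g)"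
  using keys_mult[of f g] by (auto simp: homogeneous_def mono_degree_add)

lemma homogeneous_uminus:
  fixes f :: "('n::finite, 'a::comm_ring_1) mpoly"
  shows "homogeneous d f \<Longrightarrow> homogeneous d (- f)"
  by (auto simp: homogeneous_def in_keys_iff)

lemma homogeneous_diff:
  fixes f g :: "('n::finite, 'a::comm_ring_1) mpoly"
  shows "homogeneous d f \<Longrightarrow> homogeneous d g \<Longrightarrow> homogeneous d (f - g)"
  using homogeneous_add[of d f "- g"] homogeneous_uminus[of d g] by simp

lemma homogeneous_single: "homogeneous (mono_degree m) (single m a)"
  by (simp add: homogeneous_def)

lemma homogeneous_const: "homogeneous 0 (single 0 a)"
  using homogeneous_single[of 0 a] by simp

lemma homogeneous_one: "homogeneous 0 (1 :: ('n::finite, 'a::comm_ring_1) mpoly)"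
  by (simp add: homogeneous_def keys_one)

lemma homogeneous_degree_unique:
  "homogeneous d f \<Longrightarrow> homogeneous e f \<Longrightarrow> f \<noteq> 0 \<Longrightarrow> d = e"
  unfolding homogeneous_def by (metis keys_eq_empty ex_in_conv poly_mapping_eqI in_keys_iff lookup_zero)

lemma lookup_const_mult:
  fixes f :: "('n, 'a::comm_ring_1) mpoly"
  shows "lookup (single 0 a * f) m = a * lookup f m"
proof (induction f rule: mpoly_induct)
  case (single m' b)
  then show ?case by (simp add: mult_single lookup_single when_def)
next
  case (add f g)
  then show ?case by (simp add: lookup_add distrib_left)
qed

lemma lookup_of_int_mult:
  fixes f :: "('n, 'a::comm_ring_1) mpoly"
  shows "lookup (of_int a * f) m = of_int a * lookup f m"
  using lookup_const_mult[of "of_int a" f m] by simp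

section \<open>The action of permutations\<close>

lemma mkey_add: "bij g \<Longrightarrow> mkey g (m + m') = mkey g m + mkey g (m' :: 'n \<Rightarrow>\<^sub>0 nat)"
  by (rule map_key_plus) (simp add: bij_is_inj)

lemma mkey_comp:
  "bij g \<Longrightarrow> bij h \<Longrightarrow> mkey g (mkey h m) = mkey (h \<circ> g) (m :: 'n \<Rightarrow>\<^sub>0 nat)"
  by (rule poly_mapping_eqI) (simp add: Poly_Mapping.map_key.rep_eq bij_is_inj inj_compose)

lemma mkey_id [simp]: "mkey id m = (m :: 'n \<Rightarrow>\<^sub>0 nat)"
  by (rule poly_mapping_eqI) (simp add: Poly_Mapping.map_key.rep_eq)

lemma act_comp: "bij g \<Longrightarrow> bij h \<Longrightarrow> act g (act h f) = act (g \<circ> h) f"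
  by (rule poly_mapping_eqI) (simp add: lookup_act mkey_comp bij_comp)

lemma act_0 [simp]: "bij g \<Longrightarrow> act g 0 = 0"
  by (rule poly_mapping_eqI) (simp add: lookup_act)

lemma act_add: "bij g \<Longrightarrow> act g (f + f') = act g f + act g f'"
  by (rule poly_mapping_eqI) (simp add: lookup_act lookup_add)

lemma act_diff: "bij g \<Longrightarrow> act g (f - f') = act g f - act g (f' :: ('n, 'a::ab_group_add) mpoly)"
  by (rule poly_mapping_eqI) (simp add: lookup_act lookup_minus)

lemma act_sum: "bij g \<Longrightarrow> act g (\<Sum>i\<in>I. f i) = (\<Sum>i\<in>I. act g (f i))"
  by (rule poly_mapping_eqI) (simp add: lookup_act lookup_sum)

lemma act_single: "bij g \<Longrightarrow> act g (single m a) = single (mkey (inv_into UNIV g) m) a"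
proof (rule poly_mapping_eqI)
  fix k :: "'a \<Rightarrow>\<^sub>0 nat"
  assume g: "bij g"
  have "mkey (inv_into UNIV g) m = k \<longleftrightarrow> m = mkey g k"
    using mkey_comp[OF g bij_imp_bij_inv[OF g]] mkey_comp[OF bij_imp_bij_inv[OF g] g] g
    by (metis bij_is_inj bij_is_surj inv_o_cancel mkey_id surj_iff)
  then show "lookup (act g (single m a)) k = lookup (single (mkey (inv_into UNIV g) m) a) k"
    using g by (simp add: lookup_act lookup_single when_def)
qed

lemma act_mult:
  fixes f f' :: "('n, 'a::comm_ring_1) mpoly"
  assumes g: "bij g"
  shows "act g (f * f') = act g f * act g f'"
proof (induction f rule: mpoly_induct)
  case (single m a)
  show ?case
  proof (induction f' rule: mpoly_induct)
    case (single m' b)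
    then show ?case using g by (simp add: mult_single act_single mkey_add bij_imp_bij_inv)
  next
    case (add f g)
    then show ?case using g by (simp add: act_add distrib_left)
  qed
next
  case (add f g)
  then show ?case using assms by (simp add: act_add distrib_right)
qed

lemma act_const: "bij g \<Longrightarrow> act g (single 0 a) = single 0 a"
  by (simp add: act_single map_key_zero bij_is_inj bij_imp_bij_inv)

lemma homogeneous_act: "bij g \<Longrightarrow> homogeneous d f \<Longrightarrow> homogeneous d (act g f)"
  unfolding homogeneous_def by (metis in_keys_iff lookup_act mono_degree_mkey)

section \<open>Evaluation\<close>

abbreviation monom_val :: "('n::finite \<Rightarrow>\<^sub>0 nat) \<Rightarrow> ('n \<Rightarrow> 'a::comm_ring_1) \<Rightarrow> 'a" where
  "monom_val m v \<equiv> \<Prod>i\<in>UNIV. v i ^ lookup m i"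

lemma eval_superset:
  "finite K \<Longrightarrow> keys f \<subseteq> K \<Longrightarrow> eval f v = (\<Sum>m\<in>K. lookup f m * monom_val m v)"
  unfolding eval_def by (rule sum.mono_neutral_left) (auto simp: in_keys_iff)

lemma eval_0 [simp]: "eval 0 v = 0"
  by (simp add: eval_def)

lemma eval_single: "eval (single m a) v = a * monom_val m v"
  by (simp add: eval_superset[of "{m}"])

lemma eval_const: "eval (single 0 a) v = a"
  by (simp add: eval_single)

lemma eval_add: "eval (f + g) v = eval f v + eval g v"
proof -
  have K: "finite (keys f \<union> keys g)" by simp
  show ?thesis
    using eval_superset[OF K, of f v] eval_superset[OF K, of g v] eval_superset[OF K keys_add, of v]
    by (simp add: lookup_add distrib_right sum.distrib)
qed

lemma eval_uminus: "eval (- f) v = - eval f v"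
  using eval_add[of f "- f" v] by (simp add: eq_neg_iff_add_eq_0 add.commute)

lemma eval_diff: "eval (f - g) v = eval f v - eval g v"
  using eval_add[of f "- g" v] by (simp add: eval_uminus)

lemma eval_sum: "eval (\<Sum>i\<in>I. f i) v = (\<Sum>i\<in>I. eval (f i) v)"
  by (induction I rule: infinite_finite_induct) (simp_all add: eval_add)

lemma eval_mult: "eval (f * g) v = eval f v * eval g v"
proof (induction f rule: mpoly_induct)
  case (single m a)
  show ?case
  proof (induction g rule: mpoly_induct)
    case (single m' b)
    then show ?case
      by (simp add: mult_single eval_single lookup_add power_add prod.distrib mult_ac)
  next
    case (add f g)
    then show ?case by (simp add: eval_add distrib_left)
  qed
next
  case (add f g)
  then show ?case by (simp add: eval_add distrib_right)
qed

lemma eval_one [simp]: "eval 1 v = 1"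
  using eval_const[of 1 v] by simp

lemma eval_prod: "eval (\<Prod>i\<in>I. f i) v = (\<Prod>i\<in>I. eval (f i) v)"
  by (induction I rule: infinite_finite_induct) (simp_all add: eval_mult)

lemma eval_act_comp: "bij g \<Longrightarrow> eval (act g f) v = eval f (v \<circ> g)"
  by (simp add: eval_act point_act_def inv_inv_eq)

section \<open>Graded pieces\<close>

definition restrict_monos :: "(('n \<Rightarrow>\<^sub>0 nat) \<Rightarrow> bool) \<Rightarrow> ('n, 'a::zero) mpoly \<Rightarrow> ('n, 'a) mpoly" where
  "restrict_monos P f = Poly_Mapping.mapp (\<lambda>m a. a when P m) f"

abbreviation hcomp :: "nat \<Rightarrow> ('n::finite, 'a::zero) mpoly \<Rightarrow> ('n, 'a) mpoly" where
  "hcomp d \<equiv> restrict_monos (\<lambda>m. mono_degree m = d)"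

lemma lookup_restrict_monos: "lookup (restrict_monos P f) m = (lookup f m when P m)"
  by (simp add: restrict_monos_def lookup_mapp when_def in_keys_iff)

lemma restrict_monos_0 [simp]: "restrict_monos P 0 = 0"
  by (rule poly_mapping_eqI) (simp add: lookup_restrict_monos)

lemma restrict_monos_add:
  "restrict_monos P (f + g) = restrict_monos P f + restrict_monos P (g :: ('n, 'a::comm_monoid_add) mpoly)"
  by (rule poly_mapping_eqI) (simp add: lookup_restrict_monos lookup_add when_def)

lemma restrict_monos_diff:
  "restrict_monos P (f - g) = restrict_monos P f - restrict_monos P (g :: ('n, 'a::ab_group_add) mpoly)"
  by (rule poly_mapping_eqI) (simp add: lookup_restrict_monos lookup_minus when_def)

lemma restrict_monos_sum: "restrict_monos P (\<Sum>i\<in>I. f i) = (\<Sum>i\<in>I. restrict_monos P (f i))"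
  by (induction I rule: infinite_finite_induct) (simp_all add: restrict_monos_add)

lemma hcomp_homogeneous: "homogeneous d (hcomp d f)"
  by (auto simp: homogeneous_def in_keys_iff lookup_restrict_monos)

lemma hcomp_of_homogeneous: "homogeneous e f \<Longrightarrow> hcomp d f = (if d = e then f else 0)"
  by (rule poly_mapping_eqI) (auto simp: homogeneous_def in_keys_iff lookup_restrict_monos when_def)

lemma act_restrict_monos:
  assumes "bij g" "\<And>m. P (mkey g m) \<longleftrightarrow> P m"
  shows "act g (restrict_monos P f) = restrict_monos P (act g f)"
  by (rule poly_mapping_eqI) (simp add: assms lookup_act lookup_restrict_monos)

lemma ex_degree_bound:
  fixes f :: "('n::finite, 'a::zero) mpoly"
  shows "\<exists>D. \<forall>m\<in>keys f. mono_degree m \<le> D"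
  using finite_nat_set_iff_bounded_le[of "mono_degree ` keys f"] by auto

lemma sum_hcomp:
  fixes f :: "('n::finite, 'a::comm_monoid_add) mpoly"
  assumes "\<forall>m\<in>keys f. mono_degree m \<le> D"
  shows "f = (\<Sum>d\<le>D. hcomp d f)"
proof (rule poly_mapping_eqI)
  fix m
  show "lookup f m = lookup (\<Sum>d\<le>D. hcomp d f) m"
    using assms by (auto simp: lookup_sum lookup_restrict_monos when_def in_keys_iff)
qed

lemma hcomp_mult_homogeneous:
  fixes f g :: "('n::finite, 'a::comm_ring_1) mpoly"
  assumes g: "homogeneous e g"
  shows "hcomp d (f * g) = (if e \<le> d then hcomp (d - e) f * g else 0)"
proof -
  obtain D where D: "\<forall>m\<in>keys f. mono_degree m \<le> D" using ex_degree_bound by blast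
  have "hcomp d (f * g) = (\<Sum>k\<le>D. hcomp d (hcomp k f * g))"
    by (subst sum_hcomp[OF D]) (simp add: sum_distrib_right restrict_monos_sum)
  also have "\<dots> = (\<Sum>k\<le>D. if d = k + e then hcomp k f * g else 0)"
    by (rule sum.cong) (auto simp: hcomp_of_homogeneous[OF homogeneous_mult[OF hcomp_homogeneous g]])
  also have "\<dots> = (\<Sum>k\<le>D. if k = d - e \<and> e \<le> d then hcomp k f * g else 0)"
    by (rule sum.cong) auto
  also have "\<dots> = (if e \<le> d then hcomp (d - e) f * g else 0)"
  proof -
    have "hcomp (d - e) f = 0" if "\<not> d - e \<le> D"
      using that D by (intro poly_mapping_eqI) (force simp: lookup_restrict_monos when_def in_keys_iff)
    then show ?thesis by (auto simp: sum.delta' if_distrib cong: if_cong)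
  qed
  finally show ?thesis .
qed

section \<open>Change of coefficients\<close>

lemma lookup_coeff_of_int: "lookup (coeff_of_int f) m = of_int (lookup f m)"
  by (simp add: coeff_of_int_def Poly_Mapping.map.rep_eq when_def)

lemma coeff_of_int_0 [simp]: "coeff_of_int 0 = 0"
  by (rule poly_mapping_eqI) (simp add: lookup_coeff_of_int)

lemma coeff_of_int_add: "coeff_of_int (f + g) = coeff_of_int f + coeff_of_int g"
  by (rule poly_mapping_eqI) (simp add: lookup_coeff_of_int lookup_add)

lemma coeff_of_int_sum: "coeff_of_int (\<Sum>i\<in>I. f i) = (\<Sum>i\<in>I. coeff_of_int (f i))"
  by (induction I rule: infinite_finite_induct) (simp_all add: coeff_of_int_add)

lemma coeff_of_int_single: "coeff_of_int (single m a) = single m (of_int a)"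
  by (rule poly_mapping_eqI) (simp add: lookup_coeff_of_int lookup_single when_def)

lemma coeff_of_int_mult:
  "coeff_of_int (f * g) = (coeff_of_int f * coeff_of_int g :: ('n, 'a::comm_ring_1) mpoly)"
proof (induction f rule: mpoly_induct)
  case (single m a)
  show ?case
  proof (induction g rule: mpoly_induct)
    case (single m' b)
    then show ?case by (simp add: mult_single coeff_of_int_single)
  next
    case (add f g)
    then show ?case by (simp add: coeff_of_int_add distrib_left)
  qed
next
  case (add f g)
  then show ?case by (simp add: coeff_of_int_add distrib_right)
qed

lemma act_coeff_of_int: "bij g \<Longrightarrow> act g (coeff_of_int f) = coeff_of_int (act g f)"
  by (rule poly_mapping_eqI) (simp add: lookup_act lookup_coeff_of_int)

lemma coeff_of_int_eq_iff:
  "(coeff_of_int f :: ('n, 'a::ring_char_0) mpoly) = coeff_of_int g \<longleftrightarrow> f = g"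
  by (simp add: poly_mapping_eq_iff fun_eq_iff lookup_coeff_of_int)

lemma homogeneous_coeff_of_int:
  "homogeneous d (coeff_of_int f :: ('n::finite, 'a::ring_char_0) mpoly) \<longleftrightarrow> homogeneous d f"
proof -
  have "keys (coeff_of_int f :: ('n, 'a) mpoly) = keys f"
    by (auto simp: in_keys_iff lookup_coeff_of_int)
  then show ?thesis by (simp add: homogeneous_def)
qed

lemma eval_coeff_of_int:
  "eval (coeff_of_int f :: ('n::finite, 'a::comm_ring_1) mpoly) (\<lambda>i. of_int (v i)) = of_int (eval f v)"
proof (induction f rule: mpoly_induct)
  case (single m a)
  then show ?case by (simp add: coeff_of_int_single eval_single of_int_prod)
next
  case (add f g)
  then show ?case by (simp add: coeff_of_int_add eval_add)
qed

text \<open>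
  Transfers statements about integral polynomials to rational ones: up to a nonzero constant,
  every rational polynomial is integral.
\<close>

lemma clear_denominators:
  fixes f :: "('n, rat) mpoly"
  shows "\<exists>N>0. \<exists>F. single 0 (of_int N) * f = coeff_of_int F"
proof (induction f rule: mpoly_induct)
  case (single m a)
  obtain x y where xy: "quotient_of a = (x, y)" by fastforce
  then have "y > 0" "a = of_int x / of_int y"
    by (simp_all add: quotient_of_denom_pos quotient_of_div)
  then have "single 0 (of_int y) * single m a = coeff_of_int (single m x)"
    by (simp add: mult_single coeff_of_int_single del: single_of_int)
  then show ?case using \<open>y > 0\<close> by blast
next
  case (add f g)
  then obtain N F M H where "N > 0" "single 0 (of_int N) * f = coeff_of_int F"
    "M > 0" "single 0 (of_int M) * g = coeff_of_int H" by blast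
  moreover have "single 0 (of_int (N * M)) * (f + g) =
      single 0 (of_int M) * (single 0 (of_int N) * f) + single 0 (of_int N) * (single 0 (of_int M) * g)"
    by (simp only: single_of_int) (simp add: algebra_simps)
  ultimately have "single 0 (of_int (N * M)) * (f + g) =
      coeff_of_int (single 0 M * F + single 0 N * H)"
    by (simp only: coeff_of_int_add coeff_of_int_mult coeff_of_int_single add.commute)
  moreover have "N * M > 0" using \<open>N > 0\<close> \<open>M > 0\<close> by simp
  ultimately show ?case by blast
qed

section \<open>Invariants\<close>

definition fixed :: "('n \<Rightarrow> 'n) set \<Rightarrow> ('n, 'a::zero) mpoly set" where
  "fixed H = {f. \<forall>g\<in>H. act g f = f}"

abbreviation Sig :: "('n \<Rightarrow> nat) \<Rightarrow> ('n \<Rightarrow> 'n) set" where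
  "Sig c \<equiv> carrier (young c)"

lemma Sig_iff: "\<sigma> \<in> Sig c \<longleftrightarrow> bij \<sigma> \<and> (\<forall>i. c (\<sigma> i) = c i)"
  by (simp add: young_def)

lemma Sig_bij: "\<sigma> \<in> Sig c \<Longrightarrow> bij \<sigma>"
  by (simp add: Sig_iff)

lemma Sig_comp: "\<sigma> \<in> Sig c \<Longrightarrow> \<tau> \<in> Sig c \<Longrightarrow> \<sigma> \<circ> \<tau> \<in> Sig c"
  by (simp add: Sig_iff bij_comp)

lemma Sig_id: "id \<in> Sig c"
  by (simp add: Sig_iff)

lemma Sig_inv:
  assumes "\<sigma> \<in> Sig c"
  shows "inv_into UNIV \<sigma> \<in> Sig c"
proof -
  have "c (inv_into UNIV \<sigma> i) = c i" for i
    using assms by (metis Sig_iff bij_inv_eq_iff)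
  then show ?thesis using assms by (simp add: Sig_iff bij_imp_bij_inv)
qed

text \<open>
  The invariants of any set of permutations form a graded subring; this is needed both for
  $\Sigma$ and for \<open>G\<close>.
\<close>

locale perms =
  fixes H :: "('n::finite \<Rightarrow> 'n) set"
  assumes bij: "g \<in> H \<Longrightarrow> bij g"
begin

lemma fixed_0: "0 \<in> fixed H"
  by (simp add: fixed_def bij)

lemma fixed_const: "single 0 a \<in> fixed H"
  by (simp add: fixed_def bij act_const)

lemma fixed_1: "(1 :: ('n, 'a::comm_ring_1) mpoly) \<in> fixed H"
  using fixed_const[of "1 :: 'a"] by simp

lemma fixed_add: "f \<in> fixed H \<Longrightarrow> g \<in> fixed H \<Longrightarrow> f + g \<in> fixed H"
  by (simp add: fixed_def bij act_add)

lemma fixed_diff: "f \<in> fixed H \<Longrightarrow> g \<in> fixed H \<Longrightarrow> f - g \<in> fixed H"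
  for f g :: "('n, 'a::ab_group_add) mpoly"
  by (simp add: fixed_def bij act_diff)

lemma fixed_mult: "f \<in> fixed H \<Longrightarrow> g \<in> fixed H \<Longrightarrow> f * g \<in> fixed H"
  for f g :: "('n, 'a::comm_ring_1) mpoly"
  by (simp add: fixed_def bij act_mult)

lemma fixed_sum: "(\<And>i. i \<in> I \<Longrightarrow> f i \<in> fixed H) \<Longrightarrow> (\<Sum>i\<in>I. f i) \<in> fixed H"
  by (simp add: fixed_def bij act_sum)

lemma fixed_hcomp: "f \<in> fixed H \<Longrightarrow> hcomp d f \<in> fixed H"
  by (simp add: fixed_def bij act_restrict_monos mono_degree_mkey)

lemma fixed_restrict_degree:
  "f \<in> fixed H \<Longrightarrow> restrict_monos (\<lambda>m. mono_degree m \<le> N) f \<in> fixed H"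
  by (simp add: fixed_def bij act_restrict_monos mono_degree_mkey)

lemma fixed_coeff_of_int_iff:
  "(coeff_of_int f :: ('n, 'a::ring_char_0) mpoly) \<in> fixed H \<longleftrightarrow> f \<in> fixed H"
  by (simp add: fixed_def bij act_coeff_of_int coeff_of_int_eq_iff cong: ball_cong)

end

interpretation Sig: perms "Sig c" for c :: "'n::finite \<Rightarrow> nat"
  by unfold_locales (simp add: Sig_bij)

section \<open>The graded pieces of the augmentation submodule\<close>

text \<open>
  The degree \<open>d\<close> part of $S_+M$, where $S=\mathbb{Z}[V]^\Sigma$ and \<open>M\<close> is $\mathbb{Z}[V]$ or
  $\mathbb{Z}[V]^G$.  Recording the degrees of both factors makes induction on the degree of the
  second factor available without splitting sums into homogeneous components.
\<close>

inductive_set aug :: "('n::finite \<Rightarrow> nat) \<Rightarrow> ('n, int) mpoly set \<Rightarrow> nat \<Rightarrow> ('n, int) mpoly set"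
  for c M d where
    zero: "0 \<in> aug c M d"
  | step: "x \<in> aug c M d \<Longrightarrow> s \<in> fixed (Sig c) \<Longrightarrow> homogeneous e s \<Longrightarrow> 0 < e \<Longrightarrow>
      f \<in> M \<Longrightarrow> homogeneous e' f \<Longrightarrow> e + e' = d \<Longrightarrow> x + s * f \<in> aug c M d"

lemma aug_add: "x \<in> aug c M d \<Longrightarrow> y \<in> aug c M d \<Longrightarrow> x + y \<in> aug c M d"
proof (induction x rule: aug.induct)
  case (step x s e f e')
  then have "(x + y) + s * f \<in> aug c M d" by (intro aug.step)
  then show ?case by (simp add: algebra_simps)
qed simp

lemma aug_mult:
  "x \<in> aug c UNIV d \<Longrightarrow> homogeneous k g \<Longrightarrow> g * x \<in> aug c UNIV (k + d)"
proof (induction x rule: aug.induct)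
  case (step x s e f e')
  then have "g * x + s * (g * f) \<in> aug c UNIV (k + d)"
    by (intro aug.step[where e = e and e' = "k + e'"]) (auto intro: homogeneous_mult)
  then show ?case by (simp add: algebra_simps)
qed (simp add: aug.zero)

lemma aug_const_mult: "x \<in> aug c UNIV d \<Longrightarrow> single 0 a * x \<in> aug c UNIV d"
  using aug_mult[OF _ homogeneous_const] by fastforce

lemma aug_uminus: "x \<in> aug c UNIV d \<Longrightarrow> - x \<in> aug c UNIV d"
  using aug_const_mult[of x c d "-1"] by (simp add: single_uminus)

lemma aug_diff: "x \<in> aug c UNIV d \<Longrightarrow> y \<in> aug c UNIV d \<Longrightarrow> x - y \<in> aug c UNIV d"
  using aug_add[of x c UNIV d "- y"] aug_uminus[of y c d] by simp

section \<open>Complete symmetric polynomials\<close>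

definition complete_symmetric :: "nat \<Rightarrow> 'n set \<Rightarrow> ('n::finite, int) mpoly" where
  "complete_symmetric q T = (\<Sum>m\<in>{m. keys m \<subseteq> T \<and> mono_degree m = q}. single m 1)"

lemma finite_monos: "finite {m :: 'n::finite \<Rightarrow>\<^sub>0 nat. keys m \<subseteq> T \<and> mono_degree m = q}"
  by (rule finite_subset[OF _ finite_mono_degree_le[of q]]) auto

lemma lookup_complete_symmetric:
  "lookup (complete_symmetric q T) m = (1 when keys m \<subseteq> T \<and> mono_degree m = q)"
proof -
  have "lookup (complete_symmetric q T) m =
      (\<Sum>m'\<in>{m. keys m \<subseteq> T \<and> mono_degree m = q}. if m = m' then 1 else 0)"
    by (auto simp: complete_symmetric_def lookup_sum lookup_single when_def intro!: sum.cong)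
  also have "\<dots> = (1 when keys m \<subseteq> T \<and> mono_degree m = q)"
    using finite_monos[of T q] by (subst sum.delta') (auto simp: when_def)
  finally show ?thesis .
qed

lemma complete_symmetric_homogeneous: "homogeneous q (complete_symmetric q T)"
  by (auto simp: homogeneous_def in_keys_iff lookup_complete_symmetric)

lemma complete_symmetric_0 [simp]: "complete_symmetric 0 T = 1"
  by (rule poly_mapping_eqI) (auto simp: lookup_complete_symmetric lookup_one when_def)

lemma complete_symmetric_block:
  "complete_symmetric q {v. c v = k} \<in> fixed (Sig c)"
proof -
  have "act \<sigma> (complete_symmetric q {v. c v = k}) = complete_symmetric q {v. c v = k}"
    if \<sigma>: "\<sigma> \<in> Sig c" for \<sigma>
  proof (rule poly_mapping_eqI)
    fix m :: "'a \<Rightarrow>\<^sub>0 nat"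
    have b: "bij \<sigma>" and cc: "\<And>i. c (\<sigma> i) = c i" using \<sigma> by (auto simp: Sig_iff)
    have "keys (mkey \<sigma> m) = \<sigma> -` keys m"
      using b by (simp add: keys_map_key bij_is_inj)
    then have "keys (mkey \<sigma> m) \<subseteq> {v. c v = k} \<longleftrightarrow> keys m \<subseteq> {v. c v = k}"
      using b cc by (auto simp: subset_iff) (metis bij_pointE)
    then show "lookup (act \<sigma> (complete_symmetric q {v. c v = k})) m =
        lookup (complete_symmetric q {v. c v = k}) m"
      using b by (simp add: lookup_act lookup_complete_symmetric mono_degree_mkey)
  qed
  then show ?thesis by (simp add: fixed_def)
qed

text \<open>
  Sort the monomials of degree \<open>Suc q\<close> by whether $x_i$ divides them.
\<close>

lemma complete_symmetric_insert:
  assumes "i \<notin> T"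
  shows "complete_symmetric (Suc q) (insert i T) =
    complete_symmetric (Suc q) T + single (single i 1) 1 * complete_symmetric q (insert i T)"
proof -
  let ?A = "{m :: 'a \<Rightarrow>\<^sub>0 nat. keys m \<subseteq> insert i T \<and> mono_degree m = Suc q}"
  let ?B = "{m :: 'a \<Rightarrow>\<^sub>0 nat. keys m \<subseteq> T \<and> mono_degree m = Suc q}"
  let ?C = "{m :: 'a \<Rightarrow>\<^sub>0 nat. keys m \<subseteq> insert i T \<and> mono_degree m = q}"
  have inj: "inj_on (\<lambda>m. single i 1 + m) ?C" by (auto simp: inj_on_def)
  have A: "?A = ?B \<union> (\<lambda>m. single i 1 + m) ` ?C"
  proof (intro equalityI subsetI)
    fix m assume m: "m \<in> ?A"
    show "m \<in> ?B \<union> (\<lambda>m. single i 1 + m) ` ?C"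
    proof (cases "i \<in> keys m")
      case False
      then show ?thesis using m by auto
    next
      case True
      have e: "m = single i 1 + (m - single i 1)"
        using True by (intro poly_mapping_eqI)
          (auto simp: lookup_add lookup_minus lookup_single when_def in_keys_iff)
      have "mono_degree m = 1 + mono_degree (m - single i 1)"
        by (subst e) (simp only: mono_degree_add mono_degree_single)
      moreover have "keys (m - single i 1) \<subseteq> keys m"
        by (auto simp: in_keys_iff lookup_minus)
      ultimately have "m - single i 1 \<in> ?C" using m by auto
      then show ?thesis using e by blast
    qed
  next
    fix m assume "m \<in> ?B \<union> (\<lambda>m. single i 1 + m) ` ?C"
    then show "m \<in> ?A"
    proof
      assume "m \<in> (\<lambda>m. single i 1 + m) ` ?C"
      then obtain m' where m': "m = single i 1 + m'" "m' \<in> ?C" by blast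
      then have "keys m \<subseteq> insert i (keys m')"
        using keys_add[of "single i 1" m'] by auto
      then show ?thesis using m' by (auto simp: mono_degree_add)
    qed auto
  qed
  have disj: "?B \<inter> (\<lambda>m. single i 1 + m) ` ?C = {}"
    using assms by (auto simp: in_keys_iff lookup_add subset_iff)
  have "complete_symmetric (Suc q) (insert i T) =
      complete_symmetric (Suc q) T + (\<Sum>m\<in>?C. single (single i 1 + m) 1)"
    unfolding complete_symmetric_def A
    using finite_monos[of T] finite_monos[of "insert i T"] inj disj
    by (subst sum.union_disjoint) (auto simp: sum.reindex)
  also have "(\<Sum>m\<in>?C. single (single i 1 + m) 1) =
      single (single i 1) 1 * complete_symmetric q (insert i T)"
    by (simp add: complete_symmetric_def sum_distrib_left mult_single)
  finally show ?thesis .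
qed

text \<open>
  Removing a variable from a block costs one degree: by \<open>complete_symmetric_insert\<close>,
  $h_q(T\setminus\{i\})=h_q(T)-x_i h_{q-1}(T)$, and for the full block $h_q$ is $\Sigma$-invariant of
  positive degree.
\<close>

lemma complete_symmetric_aug:
  assumes "C \<subseteq> {v. c v = k}" "card C < q"
  shows "complete_symmetric q ({v. c v = k} - C) \<in> aug c UNIV q"
  using finite[of C] assms
proof (induction C arbitrary: q rule: finite_induct)
  case empty
  have "0 + complete_symmetric q {v. c v = k} * 1 \<in> aug c UNIV q"
    using empty complete_symmetric_homogeneous homogeneous_one
    by (intro aug.step[where e = q and e' = 0] aug.zero complete_symmetric_block) auto
  then show ?case by simp
next
  case (insert i C)
  obtain r where r: "q = Suc r" using insert.prems by (cases q) auto
  let ?D = "{v. c v = k} - insert i C"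
  have D: "{v. c v = k} - C = insert i ?D" using insert.prems insert.hyps by auto
  have "complete_symmetric q (insert i ?D) \<in> aug c UNIV q"
    using insert.IH[of q] insert.prems insert.hyps unfolding D by auto
  moreover have "single (single i 1) 1 * complete_symmetric r (insert i ?D) \<in> aug c UNIV (1 + r)"
    using insert.IH[of r] insert.prems insert.hyps homogeneous_single[of "single i 1" "1::int"]
    unfolding D r by (intro aug_mult) auto
  ultimately have "complete_symmetric (Suc r) (insert i ?D) -
      single (single i 1) 1 * complete_symmetric r (insert i ?D) \<in> aug c UNIV q"
    unfolding r by (intro aug_diff) auto
  then show ?case using complete_symmetric_insert[of i ?D r] r by simp
qed

section \<open>Counting the permutations of a Young subgroup\<close>

text \<open>
  For \<open>U\<close> the set of all variables this is $\Sigma$; letting \<open>U\<close> grow by one element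
  at a time counts $\Sigma$ by the same factors that bound the exponents in Artin's spanning set.
\<close>

definition colour_perms :: "('n \<Rightarrow> nat) \<Rightarrow> 'n set \<Rightarrow> ('n \<Rightarrow> 'n) set" where
  "colour_perms c U = {p. p permutes U \<and> (\<forall>v. c (p v) = c v)}"

lemma colour_perms_UNIV: "colour_perms c UNIV = Sig c"
  by (simp add: set_eq_iff colour_perms_def Sig_iff permutes_def bij_iff)

lemma colour_perms_empty: "colour_perms c {} = {id}"
  by (auto simp: colour_perms_def)

text \<open>
  A permutation of \<open>insert x U\<close> is a transposition moving \<open>x\<close> to its image after a
  permutation of \<open>U\<close>; it respects colours exactly if both factors do.
\<close>

lemma card_colour_perms_insert:
  fixes c :: "'n::finite \<Rightarrow> nat"
  assumes x: "x \<notin> U"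
  shows "card (colour_perms c (insert x U)) = card {b \<in> insert x U. c b = c x} * card (colour_perms c U)"
proof -
  let ?f = "\<lambda>(b, p). Transposition.transpose x b \<circ> p"
  let ?P = "{b \<in> insert x U. c b = c x} \<times> colour_perms c U"
  have fixx: "p x = x" if "p permutes U" for p using that x by (simp add: permutes_not_in)
  have orbit_sum: "c (Transposition.transpose x b v) = c v" if "c b = c x" for b v
    using that by (cases "v = x"; cases "v = b") auto
  have "colour_perms c (insert x U) = ?f ` ?P"
  proof (intro equalityI subsetI)
    fix q assume q: "q \<in> colour_perms c (insert x U)"
    then have "q \<in> {p. p permutes insert x U}" by (simp add: colour_perms_def)
    then obtain b p where bp: "b \<in> insert x U" "p permutes U" "q = Transposition.transpose x b \<circ> p"
      unfolding permutes_insert by auto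
    have qx: "q x = b" using fixx[OF bp(2)] bp(3) by simp
    then have cb: "c b = c x" using q by (auto simp: colour_perms_def)
    have "c (p v) = c v" for v
      using q orbit_sum[OF cb, of "p v"] bp(3) by (auto simp: colour_perms_def)
    then have "(b, p) \<in> ?P" using bp cb by (auto simp: colour_perms_def)
    then show "q \<in> ?f ` ?P" using bp(3) by force
  next
    fix q assume "q \<in> ?f ` ?P"
    then obtain b p where bp: "b \<in> insert x U" "c b = c x" "p \<in> colour_perms c U"
      "q = Transposition.transpose x b \<circ> p" by auto
    then have "q \<in> {p. p permutes insert x U}"
      unfolding permutes_insert by (auto simp: colour_perms_def)
    then show "q \<in> colour_perms c (insert x U)"
      using bp orbit_sum by (auto simp: colour_perms_def)
  qed
  moreover have "inj_on ?f ?P"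
  proof (rule inj_onI, clarify)
    fix b p b' p'
    assume p: "p \<in> colour_perms c U" "p' \<in> colour_perms c U"
      and e: "Transposition.transpose x b \<circ> p = Transposition.transpose x b' \<circ> p'"
    have "p x = x" "p' x = x" using p fixx by (simp_all add: colour_perms_def)
    then have "b = b'" using fun_cong[OF e, of x] by simp
    moreover have "p = p'"
      using e unfolding \<open>b = b'\<close> by (metis fun.map_comp fun.map_id transpose_comp_involutory)
    ultimately show "b = b' \<and> p = p'" by simp
  qed
  ultimately show ?thesis by (simp add: card_image card_cartesian_product)
qed

section \<open>Artin's spanning set\<close>

definition reducible :: "('n::finite \<Rightarrow> nat) \<Rightarrow> ('n \<Rightarrow>\<^sub>0 nat) set \<Rightarrow> nat \<Rightarrow> ('n, int) mpoly \<Rightarrow> bool" where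
  "reducible c E d f \<longleftrightarrow>
     (\<exists>k. f - (\<Sum>a\<in>{a \<in> E. mono_degree a = d}. single a (k a)) \<in> aug c UNIV d)"

lemma reducible_add:
  assumes "reducible c E d f" "reducible c E d g"
  shows "reducible c E d (f + g)"
proof -
  let ?s = "\<lambda>k. \<Sum>a\<in>{a \<in> E. mono_degree a = d}. single a (k a)"
  obtain k k' where "f - ?s k \<in> aug c UNIV d" "g - ?s k' \<in> aug c UNIV d"
    using assms by (auto simp: reducible_def)
  then have "(f - ?s k) + (g - ?s k') \<in> aug c UNIV d" by (rule aug_add)
  moreover have "(f - ?s k) + (g - ?s k') = f + g - ?s (\<lambda>a. k a + k' a)"
    by (simp add: single_add sum.distrib)
  ultimately have "f + g - ?s (\<lambda>a. k a + k' a) \<in> aug c UNIV d" by simp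
  then show ?thesis unfolding reducible_def by (rule exI[where x = "\<lambda>a. k a + k' a"])
qed

lemma reducible_aug: "f \<in> aug c UNIV d \<Longrightarrow> reducible c E d f"
  unfolding reducible_def by (rule exI[of _ "\<lambda>_. 0"]) simp

lemma reducible_sum:
  "(\<And>i. i \<in> I \<Longrightarrow> reducible c E d (f i)) \<Longrightarrow> reducible c E d (\<Sum>i\<in>I. f i)"
  by (induction I rule: infinite_finite_induct)
     (auto intro: reducible_add reducible_aug aug.zero)

lemma reducible_uminus:
  assumes "reducible c E d f"
  shows "reducible c E d (- f)"
proof -
  let ?s = "\<lambda>k. \<Sum>a\<in>{a \<in> E. mono_degree a = d}. single a (k a)"
  obtain k where "f - ?s k \<in> aug c UNIV d" using assms by (auto simp: reducible_def)
  then have "- (f - ?s k) \<in> aug c UNIV d" by (rule aug_uminus)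
  then have "- f - ?s (\<lambda>a. - k a) \<in> aug c UNIV d"
    by (simp add: single_uminus sum_negf)
  then show ?thesis unfolding reducible_def by (rule exI[where x = "\<lambda>a. - k a"])
qed

lemma reducible_diff: "reducible c E d f \<Longrightarrow> reducible c E d g \<Longrightarrow> reducible c E d (f - g)"
  using reducible_add[of c E d f "- g"] reducible_uminus[of c E d g] by simp

lemma reducible_single:
  fixes E :: "('n::finite \<Rightarrow>\<^sub>0 nat) set"
  assumes "finite E" "a \<in> E" "mono_degree a = d"
  shows "reducible c E d (single a b)"
proof -
  have "(\<Sum>a'\<in>{a \<in> E. mono_degree a = d}. single a' (b when a' = a)) =
      (\<Sum>a'\<in>{a \<in> E. mono_degree a = d}. if a' = a then single a b else 0)"
    by (rule sum.cong) (auto simp: when_def)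
  also have "\<dots> = single a b" using assms by simp
  finally have "single a b - (\<Sum>a'\<in>{a \<in> E. mono_degree a = d}. single a' (b when a' = a)) \<in> aug c UNIV d"
    by (simp add: aug.zero)
  then show ?thesis unfolding reducible_def by (rule exI[where x = "\<lambda>a'. b when a' = a"])
qed

definition supported :: "'n set \<Rightarrow> ('n::finite, int) mpoly \<Rightarrow> bool" where
  "supported T f \<longleftrightarrow> (\<forall>m\<in>keys f. keys m \<subseteq> T)"

lemma supported_mult: "supported T f \<Longrightarrow> supported T g \<Longrightarrow> supported T (f * g)"
  unfolding supported_def
  using keys_mult[of f g] keys_add by (fastforce simp: subset_iff)

lemma reducible_mono:
  fixes E :: "('n::finite \<Rightarrow>\<^sub>0 nat) set"
  assumes "finite E'" "reducible c E d f" and x: "\<And>a. a \<in> E \<Longrightarrow> mono_degree a = d \<Longrightarrow> x + a \<in> E'"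
  shows "reducible c E' (mono_degree x + d) (single x 1 * f)"
proof -
  let ?E = "{a \<in> E. mono_degree a = d}"
  obtain k where k: "f - (\<Sum>a\<in>?E. single a (k a)) \<in> aug c UNIV d"
    using assms by (auto simp: reducible_def)
  have "reducible c E' (mono_degree x + d) (single x 1 * (f - (\<Sum>a\<in>?E. single a (k a))))"
    by (intro reducible_aug aug_mult k homogeneous_single)
  moreover have "reducible c E' (mono_degree x + d) (\<Sum>a\<in>?E. single (x + a) (k a))"
    using x assms(1) by (intro reducible_sum reducible_single) (auto simp: mono_degree_add)
  ultimately have "reducible c E' (mono_degree x + d)
     (single x 1 * (f - (\<Sum>a\<in>?E. single a (k a))) + (\<Sum>a\<in>?E. single (x + a) (k a)))"
    by (rule reducible_add)
  moreover have "single x 1 * (f - (\<Sum>a\<in>?E. single a (k a))) + (\<Sum>a\<in>?E. single (x + a) (k a))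
      = single x 1 * f"
    by (simp add: right_diff_distrib sum_distrib_left mult_single)
  ultimately show ?thesis by simp
qed

text \<open>
  Let \<open>k\<close> be the number of variables outside \<open>T\<close> of the colour of \<open>i\<close>.  The complete
  symmetric polynomial of degree \<open>k\<close> in $x_i$ and the variables of that colour in \<open>T\<close> lies
  in the augmentation ideal and has leading term $x_i^k$ as a polynomial in $x_i$; hence powers
  of $x_i$ can be reduced below the exponent \<open>k\<close>.
\<close>

lemma artin_step:
  fixes c :: "'n::finite \<Rightarrow> nat"
  assumes i: "i \<notin> T" and finE: "finite E"
    and IH: "\<And>d f. homogeneous d f \<Longrightarrow> supported T f \<Longrightarrow> reducible c E d f"
    and k: "k = card {b \<in> - T. c b = c i}"
    and E': "E' = (\<lambda>(e, a). single i e + a) ` ({..<k} \<times> E)"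
    and f: "homogeneous d f" "supported T f"
  shows "reducible c E' (e + d) (single (single i e) 1 * f)"
  using f
proof (induction e arbitrary: d f rule: less_induct)
  case (less e)
  have finE': "finite E'" using E' finE by simp
  show ?case
  proof (cases "e < k")
    case True
    have "reducible c E' (mono_degree (single i e) + d) (single (single i e) 1 * f)"
      using True E' by (intro reducible_mono[OF finE' IH[OF less.prems]]) auto
    then show ?thesis by simp
  next
    case False
    let ?B = "{v. c v = c i}"
    let ?T = "?B \<inter> T"
    let ?T' = "insert i ?T"
    have iT: "i \<notin> ?T" using i by simp
    have T': "?T' = ?B - (?B - ?T')" by auto
    have "{b \<in> - T. c b = c i} = insert i (?B - ?T')" using i by auto
    then have cardk: "k = Suc (card (?B - ?T'))" using k by (simp add: card_insert_if)
    \<comment> \<open>Since $h_{q+1}(C)=h_{q+1}(C\setminus\{i\})+x_i h_q(C)$, replacing $x_i^r h_q$ by $x_i^{r+q}$ only costs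
       terms of smaller degree in $x_i$, which are reducible by induction on \<open>e\<close>.\<close>
    have *: "reducible c E' (e + d)
        (single (single i r) 1 * complete_symmetric q ?T' * f - single (single i e) 1 * f)"
      if "r + q = e" for r q
      using that
    proof (induction q arbitrary: r)
      case 0
      then show ?case by (simp add: reducible_aug aug.zero)
    next
      case (Suc q)
      have "reducible c E' (r + (Suc q + d)) (single (single i r) 1 * (complete_symmetric (Suc q) ?T * f))"
        using Suc.prems less.prems
        by (intro less.IH homogeneous_mult complete_symmetric_homogeneous supported_mult)
           (auto simp: supported_def in_keys_iff lookup_complete_symmetric)
      moreover have "reducible c E' (e + d)
        (single (single i (Suc r)) 1 * complete_symmetric q ?T' * f - single (single i e) 1 * f)"
        using Suc.prems by (intro Suc.IH) simp
      moreover have split: "single (single i r) 1 * complete_symmetric (Suc q) ?T' * f =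
          single (single i r) 1 * (complete_symmetric (Suc q) ?T * f) +
          single (single i (Suc r)) 1 * complete_symmetric q ?T' * f"
      proof -
        have "single (single i (Suc r)) (1::int) = single (single i r) 1 * single (single i 1) 1"
          by (simp add: mult_single single_add[symmetric])
        then show ?thesis unfolding complete_symmetric_insert[OF iT]
          by (simp add: algebra_simps)
      qed
      moreover have "r + (Suc q + d) = e + d" using Suc.prems by simp
      ultimately have "reducible c E' (e + d)
          (single (single i r) 1 * (complete_symmetric (Suc q) ?T * f) +
          (single (single i (Suc r)) 1 * complete_symmetric q ?T' * f - single (single i e) 1 * f))"
        by (intro reducible_add) (simp_all only:)
      then show ?case using split by (simp only: add_diff_eq)
    qed
    have "reducible c E' (e + d)
        (single (single i (e - k)) 1 * complete_symmetric k ?T' * f - single (single i e) 1 * f)"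
      using False by (intro *) simp
    moreover have "reducible c E' (e + d) (single (single i (e - k)) 1 * complete_symmetric k ?T' * f)"
    proof (rule reducible_aug)
      have "complete_symmetric k ?T' \<in> aug c UNIV k"
        by (subst T', rule complete_symmetric_aug) (auto simp: cardk)
      then have "(single (single i (e - k)) 1 * f) * complete_symmetric k ?T' \<in> aug c UNIV ((e - k + d) + k)"
        using homogeneous_mult[OF homogeneous_single less.prems(1), of "single i (e - k)" 1]
        by (intro aug_mult) auto
      then show "single (single i (e - k)) 1 * complete_symmetric k ?T' * f \<in> aug c UNIV (e + d)"
        using False by (simp add: mult_ac)
    qed
    ultimately have "reducible c E' (e + d)
        (single (single i (e - k)) 1 * complete_symmetric k ?T' * f -
        (single (single i (e - k)) 1 * complete_symmetric k ?T' * f - single (single i e) 1 * f))"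
      by (rule reducible_diff[rotated])
    then show ?thesis by simp
  qed
qed

text \<open>
  Adding a variable \<open>i\<close> to \<open>T\<close> multiplies the number of monomials by at most \<open>k\<close> and
  divides the number of colour preserving permutations of the complement by exactly \<open>k\<close>.
\<close>

lemma artin_supported:
  fixes c :: "'n::finite \<Rightarrow> nat"
  shows "\<exists>E. finite E \<and> card E * card (colour_perms c (- T)) \<le> card (Sig c) \<and>
    (\<forall>d f. homogeneous d f \<longrightarrow> supported T f \<longrightarrow> reducible c E d f)"
  using finite[of T]
proof (induction T rule: finite_induct)
  case empty
  have "reducible c {0} d f" if "homogeneous d f" "supported {} f" for d and f :: "('n, int) mpoly"
  proof (cases "f = 0")
    case True
    then show ?thesis by (simp add: reducible_aug aug.zero)
  next
    case False
    have "m = 0" if "m \<in> keys f" for m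
      using \<open>supported {} f\<close> that by (auto simp: supported_def)
    then have e: "f = single 0 (lookup f 0)"
      by (intro poly_mapping_eqI) (auto simp: lookup_single when_def in_keys_iff)
    then have "d = 0" using homogeneous_degree_unique[OF that(1) _ False, of 0] homogeneous_const by metis
    then show ?thesis by (subst e) (rule reducible_single, auto)
  qed
  then show ?case by (intro exI[of _ "{0}"]) (simp add: colour_perms_UNIV)
next
  case (insert i T)
  then obtain E where E: "finite E" "card E * card (colour_perms c (- T)) \<le> card (Sig c)"
    "\<And>d f. homogeneous d f \<Longrightarrow> supported T f \<Longrightarrow> reducible c E d f" by blast
  define k where "k = card {b \<in> - T. c b = c i}"
  define E' where "E' = (\<lambda>(e, a). single i e + a) ` ({..<k} \<times> E)"
  have finE': "finite E'" using E E'_def by simp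
  have "card E' \<le> k * card E"
    unfolding E'_def using E(1) card_image_le[of "{..<k} \<times> E"] by (simp add: card_cartesian_product)
  then have "card E' * card (colour_perms c (- insert i T)) \<le> card E * (k * card (colour_perms c (- insert i T)))"
    by (metis mult.assoc mult.commute mult_le_mono1)
  also have "k * card (colour_perms c (- insert i T)) = card (colour_perms c (- T))"
  proof -
    have "- T = insert i (- insert i T)" using insert.hyps by auto
    then show ?thesis using card_colour_perms_insert[of i "- insert i T" c] k_def by simp
  qed
  finally have card: "card E' * card (colour_perms c (- insert i T)) \<le> card (Sig c)" using E(2) by linarith
  have "reducible c E' d f" if f: "homogeneous d f" "supported (insert i T) f" for d f
  proof -
    have "reducible c E' d (single m (lookup f m))" if m: "m \<in> keys f" for m
    proof -
      define m0 where "m0 = Poly_Mapping.update i 0 m"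
      have mm: "m = single i (lookup m i) + m0"
        by (rule poly_mapping_eqI)
           (simp add: m0_def lookup_add lookup_single lookup_update when_def)
      have "keys m0 \<subseteq> T" using f(2) m by (auto simp: supported_def m0_def keys_update)
      then have "reducible c E' (lookup m i + mono_degree m0)
          (single (single i (lookup m i)) 1 * single m0 (lookup f m))"
        by (intro artin_step[OF insert.hyps(2) E(1) E(3) k_def E'_def] homogeneous_single)
           (auto simp: supported_def)
      moreover have "d = lookup m i + mono_degree m0"
        using f(1) m mono_degree_add[of "single i (lookup m i)" m0] mm by (auto simp: homogeneous_def)
      ultimately show ?thesis using mm by (simp add: mult_single)
    qed
    then have "reducible c E' d (\<Sum>m\<in>keys f. single m (lookup f m))" by (intro reducible_sum)
    then show ?thesis using sum_of_monomials[of f] by simp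
  qed
  then show ?case using finE' card by blast
qed

text \<open>
  Artin's bound on the coinvariants: $\mathbb{Z}[V]/S_+\mathbb{Z}[V]$ is spanned by at most $|\Sigma|$ monomials.
\<close>

theorem artin_spanning:
  fixes c :: "'n::finite \<Rightarrow> nat"
  obtains E where "finite E" "card E \<le> card (Sig c)" "\<And>d f. homogeneous d f \<Longrightarrow> reducible c E d f"
  using artin_supported[of c UNIV] colour_perms_empty[of c] by (auto simp: supported_def)

locale young_setting =
  fixes c :: "'n::finite \<Rightarrow> nat"
    and G :: "('n \<Rightarrow> 'n) set"
    and \<gamma> :: "'l::finite \<Rightarrow> 'n \<Rightarrow> 'n"
    and \<omega> :: "('n, int) mpoly"
    and z :: "'n \<Rightarrow> int"
  assumes G_subgroup: "subgroup G (young c)"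
    and reps: "left_coset_reps c G \<gamma>"
    and \<omega>: "\<omega> \<in> invariants_deg ZV (carrier (young c)) 1"
    and free_orbit: "\<forall>\<sigma>\<in>carrier (young c). point_act \<sigma> z = z \<longrightarrow> \<sigma> = id"
    and \<omega>_z: "eval \<omega> z \<noteq> 0"
begin

section \<open>The orbit of the base point\<close>

lemma G_Sig: "g \<in> G \<Longrightarrow> g \<in> Sig c"
  using subgroup.mem_carrier[OF G_subgroup] .

lemma G_id: "id \<in> G"
  using subgroup.one_closed[OF G_subgroup] by (simp add: young_def)

lemma G_comp: "g \<in> G \<Longrightarrow> h \<in> G \<Longrightarrow> g \<circ> h \<in> G"
  using subgroup.m_closed[OF G_subgroup] by (simp add: young_def)

lemma G_inv:
  assumes g: "g \<in> G"
  shows "inv_into UNIV g \<in> G"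
proof -
  have b: "bij g" using G_Sig[OF g] by (rule Sig_bij)
  have y: "h \<in> G \<Longrightarrow> \<exists>h'\<in>G. h' \<circ> h = id" for h
  proof -
    assume h: "h \<in> G"
    have "group (young c)"
    proof (rule groupI)
      fix x assume x: "x \<in> Sig c"
      have "inv_into UNIV x \<otimes>\<^bsub>young c\<^esub> x = \<one>\<^bsub>young c\<^esub>"
        using Sig_bij[OF x] by (simp add: young_def bij_is_inj)
      then show "\<exists>y\<in>Sig c. y \<otimes>\<^bsub>young c\<^esub> x = \<one>\<^bsub>young c\<^esub>" using Sig_inv[OF x] by blast
    qed (use Sig_comp Sig_id in \<open>auto simp: young_def o_assoc\<close>)
    then have "m_inv (young c) h \<otimes>\<^bsub>young c\<^esub> h = \<one>\<^bsub>young c\<^esub>"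
      using G_Sig[OF h] by (simp add: group.l_inv)
    then show ?thesis using subgroup.m_inv_closed[OF G_subgroup h] by (auto simp: young_def)
  qed
  obtain h where h: "h \<in> G" "h \<circ> g = id" using y[OF g] by blast
  have "h = inv_into UNIV g"
    using h(2) b by (metis bij_is_surj comp_assoc comp_id id_comp surj_iff)
  then show ?thesis using h by simp
qed

sublocale G: perms G
  by unfold_locales (use G_Sig Sig_bij in blast)

lemma \<gamma>_Sig: "\<gamma> i \<in> Sig c"
  using reps by (auto simp: left_coset_reps_def)

lemma coset_eq: "\<gamma> i <#\<^bsub>young c\<^esub> G = (\<lambda>g. \<gamma> i \<circ> g) ` G"
  by (auto simp: l_coset_def young_def)

lemma coset_exists:
  assumes "\<sigma> \<in> Sig c"
  shows "\<exists>i. \<exists>g\<in>G. \<sigma> = \<gamma> i \<circ> g"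
proof -
  have "\<sigma> <#\<^bsub>young c\<^esub> G \<in> lcosets\<^bsub>young c\<^esub> G"
    using assms by (auto simp: LCOSETS_def)
  then have "\<sigma> <#\<^bsub>young c\<^esub> G \<in> range (\<lambda>i. \<gamma> i <#\<^bsub>young c\<^esub> G)"
    using reps by (simp add: left_coset_reps_def bij_betw_def)
  then obtain i where "\<sigma> <#\<^bsub>young c\<^esub> G = \<gamma> i <#\<^bsub>young c\<^esub> G"
    by (rule rangeE)
  moreover have "\<sigma> \<in> \<sigma> <#\<^bsub>young c\<^esub> G"
    using G_id by (auto simp: l_coset_def young_def intro!: bexI[of _ id])
  ultimately have "\<sigma> \<in> (\<lambda>g. \<gamma> i \<circ> g) ` G" using coset_eq by simp
  then show ?thesis by blast
qed

lemma coset_unique: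
  assumes gh: "g \<in> G" "h \<in> G" and e: "\<gamma> i \<circ> g = \<gamma> j \<circ> h"
  shows "i = j"
proof -
  have ig: "g \<circ> inv_into UNIV g = id" and ih: "h \<circ> inv_into UNIV h = id"
    using gh G_Sig Sig_bij by (metis bij_is_surj surj_iff)+
  have sub: "\<gamma> i <#\<^bsub>young c\<^esub> G \<subseteq> \<gamma> j <#\<^bsub>young c\<^esub> G"
    if "g \<in> G" "h \<in> G" "\<gamma> i \<circ> g = \<gamma> j \<circ> h" "g \<circ> inv_into UNIV g = id" for i j g h
  proof
    fix x assume "x \<in> \<gamma> i <#\<^bsub>young c\<^esub> G"
    then obtain k where k: "k \<in> G" "x = \<gamma> i \<circ> k" unfolding coset_eq by blast
    have "x = \<gamma> i \<circ> (g \<circ> inv_into UNIV g) \<circ> k" using k that by simp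
    also have "\<dots> = (\<gamma> i \<circ> g) \<circ> (inv_into UNIV g \<circ> k)" by (simp only: o_assoc)
    also have "\<dots> = \<gamma> j \<circ> (h \<circ> (inv_into UNIV g \<circ> k))" using that by (simp only: o_assoc)
    finally show "x \<in> \<gamma> j <#\<^bsub>young c\<^esub> G"
      unfolding coset_eq using that(1,2) k(1) by (simp add: G_comp G_inv)
  qed
  have "\<gamma> i <#\<^bsub>young c\<^esub> G = \<gamma> j <#\<^bsub>young c\<^esub> G"
    using sub[OF gh e ig] sub[OF gh(2,1) e[symmetric] ih] by blast
  then show ?thesis using reps by (auto simp: left_coset_reps_def bij_betw_def inj_on_def)
qed

text \<open>
  The stabilizer of \<open>z\<close> is trivial, so the orbit has $|\Sigma|$ points.
\<close>

lemma orbit_free: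
  assumes "\<sigma> \<in> Sig c" "\<tau> \<in> Sig c" "z \<circ> \<sigma> = z \<circ> \<tau>"
  shows "\<sigma> = \<tau>"
proof -
  have b: "bij \<sigma>" "bij \<tau>" using assms Sig_bij by blast+
  let ?\<rho> = "\<tau> \<circ> inv_into UNIV \<sigma>"
  have r: "?\<rho> \<in> Sig c" using assms by (intro Sig_comp Sig_inv)
  have "inv_into UNIV ?\<rho> = \<sigma> \<circ> inv_into UNIV \<tau>"
    using b by (simp add: o_inv_distrib bij_imp_bij_inv inv_inv_eq)
  then have "point_act ?\<rho> z = (z \<circ> \<sigma>) \<circ> inv_into UNIV \<tau>"
    by (simp add: point_act_def o_assoc)
  also have "\<dots> = z \<circ> (\<tau> \<circ> inv_into UNIV \<tau>)" using assms by (simp add: o_assoc)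
  also have "\<tau> \<circ> inv_into UNIV \<tau> = id" using b bij_is_surj surj_iff by blast
  finally have "point_act ?\<rho> z = z" by (simp only: comp_id)
  then have "?\<rho> = id" by (rule bspec[OF free_orbit r, THEN mp])
  then have "\<tau> \<circ> (inv_into UNIV \<sigma> \<circ> \<sigma>) = \<sigma>" by (simp add: o_assoc)
  then show ?thesis using b by (simp add: bij_is_inj)
qed

lemma eval_fixed: "f \<in> fixed H \<Longrightarrow> g \<in> H \<Longrightarrow> bij g \<Longrightarrow> eval f (v \<circ> g) = eval f v"
  using eval_act_comp[of g f v] by (simp add: fixed_def)

lemma eval_Sig: "s \<in> fixed (Sig c) \<Longrightarrow> \<sigma> \<in> Sig c \<Longrightarrow> eval s (v \<circ> \<sigma>) = eval s v"
  by (rule eval_fixed) (auto simp: Sig_bij)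

lemma eval_coset: "f \<in> fixed G \<Longrightarrow> g \<in> G \<Longrightarrow> eval f (v \<circ> (\<gamma> i \<circ> g)) = eval f (v \<circ> \<gamma> i)"
  using eval_fixed[of f G g "v \<circ> \<gamma> i"] G.bij by (simp add: o_assoc)

lemma fixed_Sig_subset: "fixed (Sig c) \<subseteq> fixed G"
  using G_Sig by (auto simp: fixed_def)

section \<open>Restriction to the orbit\<close>

definition resZ :: "('n, int) mpoly \<Rightarrow> real ^ 'l" where
  "resZ f = (\<chi> i. real_of_int (eval f (z \<circ> \<gamma> i)))"

text \<open>
  Restriction to the full orbit $\Sigma z$, the analogue of \<open>resZ\<close> for the trivial group.
  The functions on $\Sigma$ are realized inside the Euclidean space with one coordinate for every self-map
  of the index set, the coordinates outside $\Sigma$ being zero.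
\<close>

definition orbit_val :: "('n, int) mpoly \<Rightarrow> real ^ ('n \<Rightarrow> 'n)" where
  "orbit_val f = (\<chi> \<sigma>. if \<sigma> \<in> Sig c then real_of_int (eval f (z \<circ> \<sigma>)) else 0)"

lemma resZ_0 [simp]: "resZ 0 = 0" by (simp add: resZ_def vec_eq_iff)
lemma resZ_add: "resZ (f + g) = resZ f + resZ g" by (simp add: resZ_def vec_eq_iff eval_add)
lemma resZ_diff: "resZ (f - g) = resZ f - resZ g" by (simp add: resZ_def vec_eq_iff eval_diff)
lemma resZ_sum: "resZ (\<Sum>i\<in>I. f i) = (\<Sum>i\<in>I. resZ (f i))"
  by (induction I rule: infinite_finite_induct) (simp_all add: resZ_add)
lemma resZ_mult: "s \<in> fixed (Sig c) \<Longrightarrow> resZ (s * f) = real_of_int (eval s z) *\<^sub>R resZ f"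
  by (simp add: resZ_def vec_eq_iff eval_mult eval_Sig \<gamma>_Sig)

lemma orbit_val_0 [simp]: "orbit_val 0 = 0" by (simp add: orbit_val_def vec_eq_iff)
lemma orbit_val_add: "orbit_val (f + g) = orbit_val f + orbit_val g" by (simp add: orbit_val_def vec_eq_iff eval_add)
lemma orbit_val_diff: "orbit_val (f - g) = orbit_val f - orbit_val g" by (simp add: orbit_val_def vec_eq_iff eval_diff)
lemma orbit_val_sum: "orbit_val (\<Sum>i\<in>I. f i) = (\<Sum>i\<in>I. orbit_val (f i))"
  by (induction I rule: infinite_finite_induct) (simp_all add: orbit_val_add)
lemma orbit_val_mult: "s \<in> fixed (Sig c) \<Longrightarrow> orbit_val (s * f) = real_of_int (eval s z) *\<^sub>R orbit_val f"
  by (simp add: orbit_val_def vec_eq_iff eval_mult eval_Sig)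

lemma orbit_val_single: "orbit_val (single a k) = real_of_int k *\<^sub>R orbit_val (single a 1)"
  using orbit_val_mult[OF Sig.fixed_const, of k "single a 1"]
  by (simp add: mult_single eval_const del: single_of_int)

text \<open>
  On the orbit an element of \<open>S\<close> is constant, so multiplication by it preserves subspaces.
\<close>

lemma orbit_val_aug:
  assumes "x \<in> aug c M d" "subspace V"
    and "\<And>f e. f \<in> M \<Longrightarrow> e < d \<Longrightarrow> homogeneous e f \<Longrightarrow> orbit_val f \<in> V"
  shows "orbit_val x \<in> V"
  using assms(1)
proof induction
  case zero
  show ?case using assms(2) by (simp add: subspace_0)
next
  case (step x s e f e')
  then show ?case
    using assms(3)[of f e'] by (simp add: orbit_val_add orbit_val_mult subspace_add subspace_scale assms(2))
qed

text \<open>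
  A product of linear factors, one for each of the other points, each factor vanishing at its point.
\<close>

lemma separate_orbit:
  assumes \<sigma>: "\<sigma> \<in> Sig c"
  obtains g :: "('n, int) mpoly" where "eval g (z \<circ> \<sigma>) \<noteq> 0"
    "\<And>\<tau>. \<tau> \<in> Sig c \<Longrightarrow> \<tau> \<noteq> \<sigma> \<Longrightarrow> eval g (z \<circ> \<tau>) = 0"
proof -
  have "\<exists>i. z (\<tau> i) \<noteq> z (\<sigma> i)" if "\<tau> \<in> Sig c - {\<sigma>}" for \<tau>
    using orbit_free[of \<tau> \<sigma>] \<sigma> that by (auto simp: fun_eq_iff)
  then obtain ix where ix: "z (\<tau> (ix \<tau>)) \<noteq> z (\<sigma> (ix \<tau>))" if "\<tau> \<in> Sig c - {\<sigma>}" for \<tau>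
    by metis
  define g :: "('n, int) mpoly" where "g = (\<Prod>\<tau>\<in>Sig c - {\<sigma>}. single (single (ix \<tau>) 1) 1 - single 0 (z (\<tau> (ix \<tau>))))"
  have var: "eval (single (single i 1) (1::int)) v = v i" for i :: 'n and v
    by (simp add: eval_single lookup_single when_def power_0 if_distrib cong: if_cong)
  have g: "eval g v = (\<Prod>\<tau>\<in>Sig c - {\<sigma>}. v (ix \<tau>) - z (\<tau> (ix \<tau>)))" for v
    unfolding g_def eval_prod eval_diff var eval_const ..
  show thesis
  proof
    show "eval g (z \<circ> \<sigma>) \<noteq> 0" using ix by (force simp: g)
    show "eval g (z \<circ> \<tau>) = 0" if "\<tau> \<in> Sig c" "\<tau> \<noteq> \<sigma>" for \<tau>
      unfolding g by (rule prod_zero) (use that in auto)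
  qed
qed

section \<open>Independence of Artin's spanning set on the orbit\<close>

definition artin_set :: "('n \<Rightarrow>\<^sub>0 nat) set" where
  "artin_set = (SOME E. finite E \<and> card E \<le> card (Sig c) \<and> (\<forall>d f. homogeneous d f \<longrightarrow> reducible c E d f))"

lemma artin_set:
  "finite artin_set" "card artin_set \<le> card (Sig c)" "homogeneous d f \<Longrightarrow> reducible c artin_set d f"
proof -
  have "\<exists>E. finite E \<and> card E \<le> card (Sig c) \<and> (\<forall>d f. homogeneous d f \<longrightarrow> reducible c E d f)"
    using artin_spanning[of c] by metis
  from someI_ex[OF this, folded artin_set_def]
  show "finite artin_set" "card artin_set \<le> card (Sig c)" "homogeneous d f \<Longrightarrow> reducible c artin_set d f"
    by blast+
qed

abbreviation artin_val :: "('n \<Rightarrow>\<^sub>0 nat) \<Rightarrow> real ^ ('n \<Rightarrow> 'n)" where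
  "artin_val a \<equiv> orbit_val (single a 1)"

lemma orbit_val_in_span: "homogeneous d f \<Longrightarrow> orbit_val f \<in> span (artin_val ` {a \<in> artin_set. mono_degree a \<le> d})"
proof (induction d arbitrary: f rule: less_induct)
  case (less d)
  let ?V = "span (artin_val ` {a \<in> artin_set. mono_degree a \<le> d})"
  obtain k where k: "f - (\<Sum>a\<in>{a \<in> artin_set. mono_degree a = d}. single a (k a)) \<in> aug c UNIV d"
    using artin_set(3)[OF less.prems] by (auto simp: reducible_def)
  have "orbit_val (f - (\<Sum>a\<in>{a \<in> artin_set. mono_degree a = d}. single a (k a))) \<in> ?V"
  proof (rule orbit_val_aug[OF k])
    fix f e assume "e < d" "homogeneous e (f :: ('n, int) mpoly)"
    then have "orbit_val f \<in> span (artin_val ` {a \<in> artin_set. mono_degree a \<le> e})" by (rule less.IH)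
    also have "\<dots> \<subseteq> ?V" using \<open>e < d\<close> by (intro span_mono) auto
    finally show "orbit_val f \<in> ?V" .
  qed simp
  moreover have "orbit_val (\<Sum>a\<in>{a \<in> artin_set. mono_degree a = d}. single a (k a)) \<in> ?V"
    unfolding orbit_val_sum
  proof (rule span_sum)
    fix a assume "a \<in> {a \<in> artin_set. mono_degree a = d}"
    then show "orbit_val (single a (k a)) \<in> ?V"
      by (subst orbit_val_single) (intro span_scale span_base, auto)
  qed
  ultimately have "orbit_val (f - (\<Sum>a\<in>{a \<in> artin_set. mono_degree a = d}. single a (k a))) +
     orbit_val (\<Sum>a\<in>{a \<in> artin_set. mono_degree a = d}. single a (k a)) \<in> ?V" by (rule span_add)
  then show ?case by (simp add: orbit_val_diff)
qed

text \<open>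
  Separating polynomials show that the restrictions of Artin's monomials span all functions on the
  orbit, a space of dimension $|\Sigma|$.  There are at most $|\Sigma|$ monomials, so their
  restrictions are distinct and form a basis.
\<close>

lemma artin_val_independent: "inj_on artin_val artin_set" "independent (artin_val ` artin_set)"
proof -
  let ?V = "span (artin_val ` artin_set)" and ?A = "(\<lambda>\<sigma>. axis \<sigma> (1::real)) ` Sig c"
  have fin: "finite (artin_val ` artin_set)" using artin_set by simp
  have inV: "orbit_val f \<in> ?V" for f
  proof -
    obtain D where D: "\<forall>m\<in>keys f. mono_degree m \<le> D" using ex_degree_bound by blast
    have "orbit_val f = (\<Sum>d\<le>D. orbit_val (hcomp d f))" by (subst sum_hcomp[OF D]) (simp add: orbit_val_sum)
    also have "\<dots> \<in> ?V"
    proof (rule span_sum)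
      fix d
      have "orbit_val (hcomp d f) \<in> span (artin_val ` {a \<in> artin_set. mono_degree a \<le> d})"
        by (rule orbit_val_in_span[OF hcomp_homogeneous])
      also have "\<dots> \<subseteq> ?V" by (intro span_mono) auto
      finally show "orbit_val (hcomp d f) \<in> ?V" .
    qed
    finally show ?thesis .
  qed
  have "axis \<sigma> 1 \<in> ?V" if \<sigma>: "\<sigma> \<in> Sig c" for \<sigma>
  proof -
    obtain g where g: "eval g (z \<circ> \<sigma>) \<noteq> 0" "\<And>\<tau>. \<tau> \<in> Sig c \<Longrightarrow> \<tau> \<noteq> \<sigma> \<Longrightarrow> eval g (z \<circ> \<tau>) = 0"
      using separate_orbit[OF \<sigma>] by blast
    have "axis \<sigma> 1 = (1 / real_of_int (eval g (z \<circ> \<sigma>))) *\<^sub>R orbit_val g"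
      using g \<sigma> by (auto simp: vec_eq_iff orbit_val_def axis_def)
    then show ?thesis using inV by (simp add: span_scale)
  qed
  then have A: "?A \<subseteq> ?V" by auto
  have injA: "inj_on (\<lambda>\<sigma>. axis \<sigma> (1::real)) (Sig c)"
    by (auto simp: inj_on_def axis_eq_axis)
  have "independent ?A"
    by (rule independent_mono[OF independent_Basis]) (auto simp: Basis_vec_def)
  then have "card ?A \<le> card (artin_val ` artin_set)"
    using independent_span_bound[OF fin _ A] by blast
  then have le: "card (Sig c) \<le> card (artin_val ` artin_set)" using injA by (simp add: card_image)
  then have "card (artin_val ` artin_set) = card artin_set"
    using artin_set card_image_le[of artin_set artin_val] by linarith
  then show "inj_on artin_val artin_set" using artin_set by (simp add: eq_card_imp_inj_on)
  have "card ?A = card (Sig c)" using injA by (simp add: card_image)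
  have "card (artin_val ` artin_set) \<le> card ?A"
    using artin_set card_image_le[of artin_set artin_val] injA by (simp add: card_image)
  also have "\<dots> \<le> dim ?V" using \<open>independent ?A\<close> A by (intro independent_card_le_dim)
  finally have "card (artin_val ` artin_set) \<le> dim ?V" .
  then show "independent (artin_val ` artin_set)"
    using card_le_dim_spanning[of "artin_val ` artin_set" ?V] fin by (simp add: span_superset)
qed

text \<open>
  A combination of restricted monomials of degree \<open>d\<close> which lies in the span of those of
  smaller degree is trivial, by independence.
\<close>

lemma leading_coeffs_vanish:
  assumes "(\<Sum>a\<in>{a \<in> artin_set. mono_degree a = d}. k a *\<^sub>R artin_val a) \<in> span (artin_val ` {a \<in> artin_set. mono_degree a < d})"
    and a: "a \<in> artin_set" "mono_degree a = d"
  shows "k a = 0"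
proof -
  let ?E = artin_set
  have fin: "finite (artin_val ` {a \<in> ?E. mono_degree a < d})" using artin_set by simp
  obtain u where u: "(\<Sum>a\<in>{a \<in> ?E. mono_degree a = d}. k a *\<^sub>R artin_val a) =
      (\<Sum>b\<in>artin_val ` {a \<in> ?E. mono_degree a < d}. u b *\<^sub>R b)"
    using assms(1) unfolding span_finite[OF fin] by auto
  have inj: "inj_on artin_val ?E" by (rule artin_val_independent)
  define w where "w a = (if mono_degree a = d then k a else if mono_degree a < d then - u (artin_val a) else 0)" for a
  have "(\<Sum>a\<in>?E. w a *\<^sub>R artin_val a) =
     (\<Sum>a\<in>?E. (if mono_degree a = d then k a *\<^sub>R artin_val a else 0) - (if mono_degree a < d then u (artin_val a) *\<^sub>R artin_val a else 0))"
    by (rule sum.cong) (auto simp: w_def)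
  also have "\<dots> = (\<Sum>a\<in>{a \<in> ?E. mono_degree a = d}. k a *\<^sub>R artin_val a) -
      (\<Sum>a\<in>{a \<in> ?E. mono_degree a < d}. u (artin_val a) *\<^sub>R artin_val a)"
    using artin_set(1) by (simp add: sum_subtractf sum.inter_filter)
  also have "(\<Sum>a\<in>{a \<in> ?E. mono_degree a < d}. u (artin_val a) *\<^sub>R artin_val a) =
      (\<Sum>b\<in>artin_val ` {a \<in> ?E. mono_degree a < d}. u b *\<^sub>R b)"
    by (subst sum.reindex) (auto intro: inj_on_subset[OF inj])
  finally have "(\<Sum>a\<in>?E. w a *\<^sub>R artin_val a) = 0" using u by simp
  moreover have "(\<Sum>b\<in>artin_val ` ?E. w (inv_into ?E artin_val b) *\<^sub>R b) = (\<Sum>a\<in>?E. w a *\<^sub>R artin_val a)"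
    by (subst sum.reindex[OF inj]) (auto intro: sum.cong simp: inv_into_f_f[OF inj])
  ultimately have "w (inv_into ?E artin_val (artin_val a)) = 0"
    using a(1) artin_set(1) by (intro independentD[OF artin_val_independent(2), of "artin_val ` ?E"]) auto
  then show ?thesis using a by (simp add: inv_into_f_f[OF inj] w_def)
qed

text \<open>
  The case of the trivial group: a form of degree \<open>d\<close> that agrees on the orbit with a
  polynomial of smaller degree lies in $S_+\mathbb{Z}[V]$.  Its reduction to Artin's monomials must
  have vanishing coefficients.
\<close>

lemma aug_if_low_span:
  assumes f: "homogeneous d f" and low: "orbit_val f \<in> span (artin_val ` {a \<in> artin_set. mono_degree a < d})"
  shows "f \<in> aug c UNIV d"
proof -
  let ?V = "span (artin_val ` {a \<in> artin_set. mono_degree a < d})"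
  let ?D = "{a \<in> artin_set. mono_degree a = d}"
  obtain k where k: "f - (\<Sum>a\<in>?D. single a (k a)) \<in> aug c UNIV d"
    using artin_set(3)[OF f] by (auto simp: reducible_def)
  have "orbit_val (f - (\<Sum>a\<in>?D. single a (k a))) \<in> ?V"
  proof (rule orbit_val_aug[OF k])
    fix f e assume "e < d" "homogeneous e (f :: ('n, int) mpoly)"
    then have "orbit_val f \<in> span (artin_val ` {a \<in> artin_set. mono_degree a \<le> e})" by (intro orbit_val_in_span)
    also have "\<dots> \<subseteq> ?V" using \<open>e < d\<close> by (intro span_mono) auto
    finally show "orbit_val f \<in> ?V" .
  qed simp
  then have "orbit_val f - orbit_val (f - (\<Sum>a\<in>?D. single a (k a))) \<in> ?V" using low by (rule span_diff[rotated])
  then have "(\<Sum>a\<in>?D. real_of_int (k a) *\<^sub>R artin_val a) \<in> ?V"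
    by (simp add: orbit_val_diff orbit_val_sum) (simp add: orbit_val_single[of _ "k _"])
  then have "k a = 0" if "a \<in> ?D" for a
    using leading_coeffs_vanish[where d = d and k = "\<lambda>a. real_of_int (k a)" and a = a] that by simp
  then show ?thesis using k by simp
qed

section \<open>Averaging over the subgroup\<close>

definition orbit_sum :: "('n, 'a::comm_ring_1) mpoly \<Rightarrow> ('n, 'a) mpoly" where
  "orbit_sum f = (\<Sum>g\<in>G. act g f)"

lemma orbit_sum_add: "orbit_sum (f + g) = orbit_sum f + orbit_sum g"
  by (simp add: orbit_sum_def act_add G.bij sum.distrib)

lemma orbit_sum_sum: "orbit_sum (\<Sum>i\<in>I. f i) = (\<Sum>i\<in>I. orbit_sum (f i))"
  by (simp add: orbit_sum_def act_sum G.bij) (rule sum.swap)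

lemma orbit_sum_mult: "s \<in> fixed (Sig c) \<Longrightarrow> orbit_sum (s * f) = s * orbit_sum f"
proof -
  assume "s \<in> fixed (Sig c)"
  then have "act g s = s" if "g \<in> G" for g using that G_Sig by (auto simp: fixed_def)
  then show ?thesis by (simp add: orbit_sum_def act_mult G.bij sum_distrib_left)
qed

lemma orbit_sum_fixed: "orbit_sum f \<in> fixed G"
proof -
  have "act g (orbit_sum f) = orbit_sum f" if g: "g \<in> G" for g
  proof -
    have bb: "bij_betw (\<lambda>h. g \<circ> h) G G"
    proof (rule bij_betwI[where g = "\<lambda>h. inv_into UNIV g \<circ> h"])
      have b: "bij g" using g by (rule G.bij)
      show "inv_into UNIV g \<circ> (g \<circ> x) = x" for x :: "'n \<Rightarrow> 'n"
        using b by (simp add: o_assoc bij_is_inj)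
      have "g \<circ> inv_into UNIV g = id" using b bij_is_surj surj_iff by blast
      then show "g \<circ> (inv_into UNIV g \<circ> x) = x" for x :: "'n \<Rightarrow> 'n"
        by (simp add: o_assoc)
    qed (use g G_comp G_inv in auto)
    have "act g (orbit_sum f) = (\<Sum>h\<in>G. act (g \<circ> h) f)"
      unfolding orbit_sum_def act_sum[OF G.bij[OF g]]
      by (rule sum.cong) (use g G.bij in \<open>auto simp: act_comp\<close>)
    also have "\<dots> = orbit_sum f" unfolding orbit_sum_def by (rule sum.reindex_bij_betw[OF bb])
    finally show ?thesis .
  qed
  then show ?thesis by (simp add: fixed_def)
qed

lemma orbit_sum_homogeneous: "homogeneous d f \<Longrightarrow> homogeneous d (orbit_sum f)"
  unfolding orbit_sum_def by (intro homogeneous_sum homogeneous_act G.bij)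

lemma orbit_sum_of_fixed: "f \<in> fixed G \<Longrightarrow> orbit_sum f = of_nat (card G) * f"
  by (simp add: orbit_sum_def fixed_def)

lemma card_G_pos: "card G > 0"
  using G_id by (auto simp: card_gt_0_iff)

text \<open>
  \<open>orbit_sum\<close> is \<open>S\<close>-linear, so it can be applied to the second factors.
\<close>

lemma orbit_sum_aug: "x \<in> aug c UNIV d \<Longrightarrow> orbit_sum x \<in> aug c (fixed G) d"
proof (induction rule: aug.induct)
  case zero
  have "orbit_sum 0 = (0 :: ('n, int) mpoly)" by (simp add: orbit_sum_def G.bij)
  then show ?case by (simp add: aug.zero)
next
  case (step x s e f e')
  then have "orbit_sum x + s * orbit_sum f \<in> aug c (fixed G) d"
    by (intro aug.step[where e = e and e' = e'] orbit_sum_fixed orbit_sum_homogeneous)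
  then show ?case using step by (simp add: orbit_sum_add orbit_sum_mult)
qed

section \<open>The filtration of functions on the points\<close>

text \<open>
  The lattice $M_d$.  Its real span is $\mathbb{R}L_d$ (see \<open>RL_eq\<close>), which makes it unnecessary
  to work with real polynomials; accordingly \<open>res_lower d\<close> is $\mathbb{R}L_{d-1}$.
\<close>

definition res_lattice :: "nat \<Rightarrow> (real ^ 'l) set" where
  "res_lattice d = resZ ` {f \<in> fixed G. homogeneous d f}"

definition res_lower :: "nat \<Rightarrow> (real ^ 'l) set" where
  "res_lower d = (if d = 0 then {0} else span (res_lattice (d - 1)))"

lemma subspace_res_lower: "subspace (res_lower d)"
  by (simp add: res_lower_def)

lemma \<omega>_props: "\<omega> \<in> fixed (Sig c)" "homogeneous 1 \<omega>"
  using \<omega> by (auto simp: invariants_deg_def invariants_def fixed_def)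

text \<open>
  On \<open>X\<close> multiplication by $\omega$ is multiplication by the nonzero number $\omega(z)$.
\<close>

lemma span_res_lattice_Suc: "span (res_lattice d) \<subseteq> span (res_lattice (Suc d))"
proof (rule span_minimal[OF _ subspace_span], rule subsetI)
  fix v assume "v \<in> res_lattice d"
  then obtain f where f: "v = resZ f" "f \<in> fixed G" "homogeneous d f" by (auto simp: res_lattice_def)
  have "homogeneous (Suc d) (\<omega> * f)" using homogeneous_mult[OF \<omega>_props(2) f(3)] by simp
  moreover have "\<omega> * f \<in> fixed G" using \<omega>_props fixed_Sig_subset f by (auto intro: G.fixed_mult)
  ultimately have "resZ (\<omega> * f) \<in> res_lattice (Suc d)" by (auto simp: res_lattice_def)
  then have "(1 / real_of_int (eval \<omega> z)) *\<^sub>R resZ (\<omega> * f) \<in> span (res_lattice (Suc d))"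
    by (intro span_scale span_base)
  then show "v \<in> span (res_lattice (Suc d))" using \<omega>_z \<omega>_props by (simp add: resZ_mult f)
qed

lemma span_res_lattice_mono: "d \<le> e \<Longrightarrow> span (res_lattice d) \<subseteq> span (res_lattice e)"
  by (rule lift_Suc_mono_le[of "\<lambda>d. span (res_lattice d)"]) (use span_res_lattice_Suc in auto)

lemma res_lower_subset: "res_lower d \<subseteq> span (res_lattice d)"
  using span_res_lattice_Suc[of "d - 1"] by (auto simp: res_lower_def span_0)

lemma res_lattice_in_lower: "e < d \<Longrightarrow> span (res_lattice e) \<subseteq> res_lower d"
  using span_res_lattice_mono[of e "d - 1"] by (auto simp: res_lower_def)

lemma resZ_aug:
  assumes "x \<in> aug c (fixed G) d"
  shows "resZ x \<in> res_lower d"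
  using assms
proof induction
  case zero
  show ?case by (simp add: subspace_0 subspace_res_lower)
next
  case (step x s e f e')
  have "resZ f \<in> res_lower d"
    using res_lattice_in_lower[of e' d] step by (auto simp: res_lattice_def intro: span_base)
  then show ?case
    using step by (simp add: resZ_add resZ_mult subspace_add subspace_scale subspace_res_lower)
qed

text \<open>
  A \<open>G\<close>-invariant polynomial is determined on the orbit by its values on \<open>X\<close>, linearly:
  every point of $\Sigma z$ is in the \<open>G\<close>-orbit of exactly one $w_i$.
\<close>

lemma orbit_val_of_resZ:
  obtains T where "linear T" "\<And>f. f \<in> fixed G \<Longrightarrow> T (resZ f) = orbit_val f"
proof -
  obtain ix where ix: "\<exists>g\<in>G. \<sigma> = \<gamma> (ix \<sigma>) \<circ> g" if "\<sigma> \<in> Sig c" for \<sigma>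
    using coset_exists by metis
  define T :: "real ^ 'l \<Rightarrow> real ^ ('n \<Rightarrow> 'n)" where
    "T v = (\<chi> \<sigma>. if \<sigma> \<in> Sig c then v $ ix \<sigma> else 0)" for v
  have "linear T" by (rule linearI) (simp_all add: T_def vec_eq_iff)
  moreover have "T (resZ f) = orbit_val f" if f: "f \<in> fixed G" for f
  proof -
    have "eval f (z \<circ> \<gamma> (ix \<sigma>)) = eval f (z \<circ> \<sigma>)" if "\<sigma> \<in> Sig c" for \<sigma>
      using ix[OF that] eval_coset[OF f] by metis
    then show ?thesis by (simp add: T_def resZ_def orbit_val_def vec_eq_iff)
  qed
  ultimately show thesis using that by blast
qed

text \<open>
  The converse of \<open>resZ_aug\<close>.  Passing to the full orbit, \<open>aug_if_low_span\<close> gives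
  $f\in S_+\mathbb{Z}[V]$, and averaging over \<open>G\<close> replaces the second factors by invariants at the
  cost of the factor $|G|$.
\<close>

theorem kernel_of_graded_restriction:
  assumes f: "f \<in> fixed G" "homogeneous d f" and low: "resZ f \<in> res_lower d"
  shows "of_nat (card G) * f \<in> aug c (fixed G) d"
proof -
  obtain T where T: "linear T" "\<And>f. f \<in> fixed G \<Longrightarrow> T (resZ f) = orbit_val f"
    using orbit_val_of_resZ by blast
  let ?V = "span (artin_val ` {a \<in> artin_set. mono_degree a < d})"
  have low_V: "T v \<in> ?V" if "v \<in> res_lower d" for v
  proof (cases "d = 0")
    case True
    then show ?thesis using that T(1) by (simp add: res_lower_def linear_0 span_0)
  next
    case False
    have "T ` res_lattice (d - 1) \<subseteq> ?V"
    proof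
      fix w assume "w \<in> T ` res_lattice (d - 1)"
      then obtain h where "w = orbit_val h" "homogeneous (d - 1) h" by (auto simp: res_lattice_def T)
      then have "w \<in> span (artin_val ` {a \<in> artin_set. mono_degree a \<le> d - 1})" using orbit_val_in_span by blast
      also have "\<dots> \<subseteq> ?V" using False by (intro span_mono) auto
      finally show "w \<in> ?V" .
    qed
    then have "span (T ` res_lattice (d - 1)) \<subseteq> ?V" by (simp add: span_minimal)
    then have "T ` span (res_lattice (d - 1)) \<subseteq> ?V" using linear_span_image[OF T(1)] by metis
    then show ?thesis using that False by (auto simp: res_lower_def)
  qed
  have "orbit_val f \<in> ?V" using low_V[OF low] unfolding T(2)[OF f(1)] .
  then have "f \<in> aug c UNIV d" using f by (intro aug_if_low_span)
  then have "orbit_sum f \<in> aug c (fixed G) d" by (rule orbit_sum_aug)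
  then show ?thesis using orbit_sum_of_fixed[OF f(1)] by simp
qed

text \<open>
  Averaging a polynomial that separates $w_i$ from the rest of $\Sigma z$ gives an invariant that is
  nonzero at exactly one point of \<open>X\<close>.
\<close>

lemma res_lattice_span_all: "v \<in> span (\<Union>d. res_lattice d)"
proof -
  let ?V = "span (\<Union>d. res_lattice d)"
  have inV: "resZ f \<in> ?V" if f: "f \<in> fixed G" for f
  proof -
    obtain D where D: "\<forall>m\<in>keys f. mono_degree m \<le> D" using ex_degree_bound by blast
    have "resZ f = (\<Sum>d\<le>D. resZ (hcomp d f))" by (subst sum_hcomp[OF D]) (simp add: resZ_sum)
    also have "\<dots> \<in> ?V"
      proof (rule span_sum, rule span_base)
      fix d
      have "resZ (hcomp d f) \<in> res_lattice d"
        by (simp add: res_lattice_def G.fixed_hcomp[OF f] hcomp_homogeneous)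
      then show "resZ (hcomp d f) \<in> (\<Union>d. res_lattice d)" by blast
    qed
    finally show ?thesis .
  qed
  have "axis i 1 \<in> ?V" for i
  proof -
    obtain g where g: "eval g (z \<circ> \<gamma> i) \<noteq> 0" "\<And>\<tau>. \<tau> \<in> Sig c \<Longrightarrow> \<tau> \<noteq> \<gamma> i \<Longrightarrow> eval g (z \<circ> \<tau>) = 0"
      using separate_orbit[OF \<gamma>_Sig] by blast
    have ev: "eval (orbit_sum g) (z \<circ> \<gamma> j) = (\<Sum>h\<in>G. eval g (z \<circ> (\<gamma> j \<circ> h)))" for j
      by (simp add: orbit_sum_def eval_sum eval_act_comp G.bij o_assoc)
    have "eval (orbit_sum g) (z \<circ> \<gamma> j) = 0" if "j \<noteq> i" for j
      unfolding ev
    proof (rule sum.neutral, rule ballI)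
      fix h assume h: "h \<in> G"
      then have "\<gamma> j \<circ> h \<noteq> \<gamma> i" using coset_unique[OF h G_id, of j i] that by auto
      then show "eval g (z \<circ> (\<gamma> j \<circ> h)) = 0"
        using g(2) Sig_comp[OF \<gamma>_Sig G_Sig[OF h]] by blast
    qed
    moreover have "eval (orbit_sum g) (z \<circ> \<gamma> i) = eval g (z \<circ> \<gamma> i)"
    proof -
      have "eval g (z \<circ> (\<gamma> i \<circ> h)) = 0" if h: "h \<in> G - {id}" for h
      proof -
        have "\<gamma> i \<circ> h \<noteq> \<gamma> i"
        proof
          assume "\<gamma> i \<circ> h = \<gamma> i"
          then have "\<gamma> i (h x) = \<gamma> i x" for x by (metis comp_apply)
          then have "h x = x" for x using Sig_bij[OF \<gamma>_Sig] by (meson bij_is_inj injD)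
          then show False using h by auto
        qed
        then show ?thesis using g(2) Sig_comp[OF \<gamma>_Sig G_Sig] h by blast
      qed
      then show ?thesis unfolding ev using G_id by (simp add: sum.remove[of G id])
    qed
    ultimately have "axis i 1 = (1 / real_of_int (eval g (z \<circ> \<gamma> i))) *\<^sub>R resZ (orbit_sum g)"
      using g by (auto simp: vec_eq_iff resZ_def axis_def)
    then show ?thesis using inV[OF orbit_sum_fixed] by (simp add: span_scale)
  qed
  then have "Basis \<subseteq> ?V" by (auto simp: Basis_vec_def)
  then have "span Basis \<subseteq> ?V" by (rule span_minimal) (rule subspace_span)
  then show ?thesis unfolding span_Basis by blast
qed

end

section \<open>Submodules generated by a set\<close>

text \<open>
  The set of \<open>S\<close>-linear combinations of elements of \<open>B\<close>.  The inductive form avoids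
  coefficient families with finite support, which only appear in \<open>module_generators_iff_smod\<close>.
\<close>

inductive_set smod :: "'a::comm_ring_1 set \<Rightarrow> 'a set \<Rightarrow> 'a set" for S B where
  zero: "0 \<in> smod S B"
| step: "x \<in> smod S B \<Longrightarrow> s \<in> S \<Longrightarrow> b \<in> B \<Longrightarrow> x + s * b \<in> smod S B"

lemma smod_add: "x \<in> smod S B \<Longrightarrow> y \<in> smod S B \<Longrightarrow> x + y \<in> smod S B"
proof (induction x rule: smod.induct)
  case (step x s b)
  then have "(x + y) + s * b \<in> smod S B" by (intro smod.step)
  then show ?case by (simp add: algebra_simps)
qed simp

lemma smod_sum: "(\<And>i. i \<in> I \<Longrightarrow> f i \<in> smod S B) \<Longrightarrow> (\<Sum>i\<in>I. f i) \<in> smod S B"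
  by (induction I rule: infinite_finite_induct) (auto intro: smod_add smod.zero)

lemma smod_gen: "s \<in> S \<Longrightarrow> b \<in> B \<Longrightarrow> s * b \<in> smod S B"
  using smod.step[OF smod.zero] by fastforce

lemma smod_mult:
  assumes "\<And>s t. s \<in> S \<Longrightarrow> t \<in> S \<Longrightarrow> s * t \<in> S" and "s \<in> S" and "x \<in> smod S B"
  shows "s * x \<in> smod S B"
  using assms(3)
proof induction
  case (step x t b)
  then have "s * x + (s * t) * b \<in> smod S B" using assms by (intro smod.step)
  then show ?case by (simp add: algebra_simps)
qed (simp add: smod.zero)

lemma smod_trans:
  assumes "\<And>s t. s \<in> S \<Longrightarrow> t \<in> S \<Longrightarrow> s * t \<in> S" and "x \<in> smod S B" and "B \<subseteq> smod S C"
  shows "x \<in> smod S C"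
  using assms(2)
proof induction
  case (step x s b)
  have "s * b \<in> smod S C"
    by (rule smod_mult[OF assms(1)]) (use step assms(3) in auto)
  then show ?case using step by (intro smod_add)
qed (rule smod.zero)

lemma smod_mono: "x \<in> smod S B \<Longrightarrow> B \<subseteq> C \<Longrightarrow> x \<in> smod S C"
  by (induction rule: smod.induct) (auto intro: smod.intros)

lemma smod_finite_support: "x \<in> smod S B \<Longrightarrow> \<exists>K. finite K \<and> K \<subseteq> B \<and> x \<in> smod S K"
proof (induction rule: smod.induct)
  case zero
  show ?case by (intro exI[of _ "{}"]) (simp add: smod.zero)
next
  case (step x s b)
  then obtain K where K: "finite K" "K \<subseteq> B" "x \<in> smod S K" by blast
  have "x + s * b \<in> smod S (insert b K)"
    using step smod_mono[OF K(3), of "insert b K"] by (intro smod.step) auto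
  then show ?case using K step by (intro exI[of _ "insert b K"]) simp
qed

lemma smod_explicit:
  assumes "finite B" and "0 \<in> S" and "\<And>s t. s \<in> S \<Longrightarrow> t \<in> S \<Longrightarrow> s + t \<in> S"
  shows "x \<in> smod S B \<longleftrightarrow> (\<exists>k. (\<forall>b\<in>B. k b \<in> S) \<and> x = (\<Sum>b\<in>B. k b * b))"
proof
  assume "x \<in> smod S B"
  then show "\<exists>k. (\<forall>b\<in>B. k b \<in> S) \<and> x = (\<Sum>b\<in>B. k b * b)"
  proof induction
    case zero
    show ?case using assms(2) by (intro exI[of _ "\<lambda>_. 0"]) simp
  next
    case (step x s b)
    then obtain k where k: "\<forall>b\<in>B. k b \<in> S" "x = (\<Sum>b\<in>B. k b * b)" by blast
    let ?k = "k(b := k b + s)"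
    have "(\<Sum>b\<in>B. ?k b * b) = x + s * b"
      using step.hyps assms(1) unfolding k(2)
      by (simp add: sum.remove[of B b] distrib_right add_ac)
    then show ?case using k step assms(3) by (intro exI[of _ ?k]) auto
  qed
next
  assume "\<exists>k. (\<forall>b\<in>B. k b \<in> S) \<and> x = (\<Sum>b\<in>B. k b * b)"
  then show "x \<in> smod S B" by (auto intro: smod_sum smod_gen)
qed

lemma finsum_type_ring:
  fixes f :: "'i \<Rightarrow> 'a::comm_ring_1"
  assumes "finite I"
  shows "finsum (ring_of_type_algebra :: 'a ring) f I = sum f I"
proof -
  interpret R: cring "ring_of_type_algebra :: 'a ring" by (rule cring_from_type_algebra)
  have [simp]: "carrier (ring_of_type_algebra :: 'a ring) = UNIV"
    by (simp add: ring_of_type_algebra_def)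
  show ?thesis using assms
    by (induction I rule: finite_induct) (simp_all, simp_all add: ring_of_type_algebra_def)
qed

lemma module_generators_iff_smod:
  fixes S M B :: "'a::comm_ring_1 set"
  assumes S: "0 \<in> S" "\<And>s t. s \<in> S \<Longrightarrow> t \<in> S \<Longrightarrow> s + t \<in> S"
  shows "module_generators ring_of_type_algebra S M B \<longleftrightarrow> B \<subseteq> M \<and> M \<subseteq> smod S B"
proof -
  let ?R = "ring_of_type_algebra :: 'a ring"
  have sel: "x \<otimes>\<^bsub>?R\<^esub> y = x * y" "\<zero>\<^bsub>?R\<^esub> = 0" for x y
    by (simp_all add: ring_of_type_algebra_def)
  have "(\<exists>k\<in>coeff_families ?R S B. x = lin_comb ?R (\<lambda>b. b) k) \<longleftrightarrow> x \<in> smod S B" for x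
  proof
    assume "\<exists>k\<in>coeff_families ?R S B. x = lin_comb ?R (\<lambda>b. b) k"
    then obtain k where k: "k ` B \<subseteq> S" "\<forall>i. i \<notin> B \<longrightarrow> k i = 0" "finite {i. k i \<noteq> 0}"
      "x = lin_comb ?R (\<lambda>b. b) k" by (auto simp: coeff_families_def sel)
    then have "x = (\<Sum>b\<in>{i. k i \<noteq> 0}. k b * b)" by (simp add: lin_comb_def sel finsum_type_ring)
    also have "\<dots> \<in> smod S B" using k by (intro smod_sum smod_gen) auto
    finally show "x \<in> smod S B" .
  next
    assume "x \<in> smod S B"
    from smod_finite_support[OF this]
    obtain K where K: "finite K" "K \<subseteq> B" "x \<in> smod S K" by (elim exE conjE) (rule that)
    have "\<exists>k. (\<forall>b\<in>K. k b \<in> S) \<and> x = (\<Sum>b\<in>K. k b * b)"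
      by (rule iffD1[OF smod_explicit K(3)]) (use K(1) S in auto)
    then obtain k where k: "\<forall>b\<in>K. k b \<in> S" "x = (\<Sum>b\<in>K. k b * b)"
      by (elim exE conjE) (rule that)
    define k' where "k' b = (if b \<in> K then k b else 0)" for b
    have fin: "finite {i. k' i \<noteq> 0}" using K(1) by (rule finite_subset[rotated]) (auto simp: k'_def)
    have "x = (\<Sum>b\<in>{i. k' i \<noteq> 0}. k' b * b)"
      unfolding k(2) by (rule sum.mono_neutral_cong_right) (use K in \<open>auto simp: k'_def\<close>)
    then have "x = lin_comb ?R (\<lambda>b. b) k'" by (simp add: lin_comb_def sel finsum_type_ring fin)
    moreover have "k' \<in> coeff_families ?R S B"
      using fin k K S by (auto simp: coeff_families_def sel k'_def)
    ultimately show "\<exists>k\<in>coeff_families ?R S B. x = lin_comb ?R (\<lambda>b. b) k" by blast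
  qed
  then show ?thesis by (auto simp: module_generators_def)
qed

section \<open>Orthogonal projections\<close>

lemma orth_proj_unique:
  fixes W :: "'v::euclidean_space set"
  assumes W: "subspace W" and u: "u \<in> W" "v - u \<in> W\<^sup>\<bottom>"
  shows "orth_proj W v = u"
  unfolding orth_proj_def
proof (rule the_equality)
  show "u \<in> W \<and> v - u \<in> W\<^sup>\<bottom>" using u by simp
  fix u' assume u': "u' \<in> W \<and> v - u' \<in> W\<^sup>\<bottom>"
  then have "(v - u) - (v - u') \<in> W\<^sup>\<bottom>" using u subspace_diff[OF subspace_orthogonal_comp] by blast
  moreover have "u' - u \<in> W" using u u' W subspace_diff by blast
  ultimately have "(u' - u) \<bullet> (u' - u) = 0" by (simp add: orthogonal_comp_def orthogonal_def)
  then show "u' = u" by simp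
qed

lemma orth_proj:
  fixes W :: "'v::euclidean_space set"
  assumes W: "subspace W"
  shows "orth_proj W v \<in> W" "v - orth_proj W v \<in> W\<^sup>\<bottom>"
proof -
  obtain u w where uw: "u \<in> span W" "\<And>x. x \<in> span W \<Longrightarrow> orthogonal w x" "v = u + w"
    using orthogonal_subspace_decomp_exists by blast
  have W_eq: "span W = W" using W by (simp add: span_eq_iff)
  have "u \<in> W" "v - u \<in> W\<^sup>\<bottom>"
    using uw(1,3) uw(2)[unfolded W_eq] unfolding W_eq
    by (auto simp: orthogonal_comp_def orthogonal_commute)
  then show "orth_proj W v \<in> W" "v - orth_proj W v \<in> W\<^sup>\<bottom>" using orth_proj_unique[OF W] by metis+
qed

lemma linear_orth_proj:
  fixes W :: "'v::euclidean_space set"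
  assumes W: "subspace W"
  shows "linear (orth_proj W)"
proof (rule linearI)
  fix v w :: 'v and r :: real
  have "(v - orth_proj W v) + (w - orth_proj W w) \<in> W\<^sup>\<bottom>"
    using orth_proj[OF W] by (intro subspace_add[OF subspace_orthogonal_comp])
  then show "orth_proj W (v + w) = orth_proj W v + orth_proj W w"
    using orth_proj[OF W] by (intro orth_proj_unique[OF W] subspace_add[OF W]) (simp_all add: algebra_simps)
  have "r *\<^sub>R (v - orth_proj W v) \<in> W\<^sup>\<bottom>"
    using orth_proj[OF W] by (intro subspace_scale[OF subspace_orthogonal_comp])
  then show "orth_proj W (r *\<^sub>R v) = r *\<^sub>R orth_proj W v"
    using orth_proj[OF W] by (intro orth_proj_unique[OF W] subspace_scale[OF W]) (simp_all add: algebra_simps)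
qed

context young_setting
begin

lemma resX_add: "resX \<gamma> z (f + g) = resX \<gamma> z f + resX \<gamma> z g"
  by (simp add: resX_def vec_eq_iff eval_add)

lemma resX_sum: "resX \<gamma> z (\<Sum>i\<in>I. f i) = (\<Sum>i\<in>I. resX \<gamma> z (f i))"
proof (induction I rule: infinite_finite_induct)
  case (insert x F)
  then show ?case by (simp add: resX_add)
qed (simp_all add: resX_def vec_eq_iff)

lemma resX_scale: "resX \<gamma> z (single 0 a * f) = a *\<^sub>R resX \<gamma> z f"
  by (simp add: resX_def vec_eq_iff eval_mult eval_const)

lemma point_eq: "point_act (inv_into UNIV (\<gamma> i)) z j = (z \<circ> \<gamma> i) j"
  using Sig_bij[OF \<gamma>_Sig] by (simp add: point_act_def inv_inv_eq)

lemma resX_coeff_of_int: "resX \<gamma> z (coeff_of_int f) = resZ f"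
  unfolding resX_def resZ_def point_eq eval_coeff_of_int ..

lemma invariants_type: "invariants ring_of_type_algebra H = fixed H"
  by (simp add: invariants_def fixed_def ring_of_type_algebra_def)

lemma Mlat_eq: "Mlat G \<gamma> z d = res_lattice d"
  by (simp add: Mlat_def res_lattice_def resX_coeff_of_int invariants_deg_def invariants_type)

text \<open>
  A real invariant \<open>f\<close> is $|G|^{-1}$ times its sum over \<open>G\<close>, so it is a real
  combination of the sums over \<open>G\<close> of its monomials, which have integer coefficients.
\<close>

lemma RL_eq: "RL G \<gamma> z d = span (res_lattice d)"
proof
  show "RL G \<gamma> z d \<subseteq> span (res_lattice d)"
  proof
    fix v assume "v \<in> RL G \<gamma> z d"
    then obtain f where f: "v = resX \<gamma> z f" "f \<in> fixed G" "homogeneous d f"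
      by (auto simp: RL_def invariants_deg_def invariants_type)
    have orbit_sum_single: "orbit_sum (single m a) = single 0 a * coeff_of_int (orbit_sum (single m 1))" for m and a :: real
      by (simp add: orbit_sum_def coeff_of_int_sum act_coeff_of_int[symmetric] G.bij coeff_of_int_single
          sum_distrib_left act_single mult_single)
    have "of_nat (card G) * f = orbit_sum (\<Sum>m\<in>keys f. single m (lookup f m))"
      using orbit_sum_of_fixed[OF f(2)] sum_of_monomials[of f] by simp
    then have "real (card G) *\<^sub>R resX \<gamma> z f = (\<Sum>m\<in>keys f. lookup f m *\<^sub>R resZ (orbit_sum (single m 1)))"
      using resX_scale[of "of_nat (card G)" f]
      by (simp add: orbit_sum_sum orbit_sum_single resX_sum resX_scale resX_coeff_of_int)
    moreover have "\<dots> \<in> span (res_lattice d)"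
    proof (rule span_sum, rule span_scale, rule span_base)
      fix m assume "m \<in> keys f"
      then have "homogeneous d (single m (1::int))" using f(3) by (auto simp: homogeneous_def)
      then show "resZ (orbit_sum (single m 1)) \<in> res_lattice d"
        using orbit_sum_fixed orbit_sum_homogeneous by (auto simp: res_lattice_def)
    qed
    ultimately have "(1 / real (card G)) *\<^sub>R (real (card G) *\<^sub>R resX \<gamma> z f) \<in> span (res_lattice d)"
      by (simp add: span_scale)
    then show "v \<in> span (res_lattice d)" using card_G_pos f by (simp add: card_gt_0_iff)
  qed
  show "span (res_lattice d) \<subseteq> RL G \<gamma> z d"
  proof (rule span_minimal)
    show "res_lattice d \<subseteq> RL G \<gamma> z d"
    proof
      fix v assume "v \<in> res_lattice d"
      then obtain f where f: "v = resZ f" "f \<in> fixed G" "homogeneous d f" by (auto simp: res_lattice_def)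
      then show "v \<in> RL G \<gamma> z d"
        unfolding RL_def invariants_deg_def invariants_type
        by (intro image_eqI[of _ _ "coeff_of_int f"])
           (simp_all add: resX_coeff_of_int G.fixed_coeff_of_int_iff homogeneous_coeff_of_int)
    qed
    show "subspace (RL G \<gamma> z d)"
    proof (rule subspaceI)
      have "resX \<gamma> z 0 = 0" by (simp add: resX_def vec_eq_iff)
      then show "0 \<in> RL G \<gamma> z d"
        unfolding RL_def invariants_deg_def invariants_type
        by (intro image_eqI[of _ _ 0]) (simp_all add: G.fixed_0)
    next
      fix x y assume "x \<in> RL G \<gamma> z d" "y \<in> RL G \<gamma> z d"
      then obtain f g where "x = resX \<gamma> z f" "f \<in> fixed G" "homogeneous d f"
        "y = resX \<gamma> z g" "g \<in> fixed G" "homogeneous d g"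
        by (auto simp: RL_def invariants_deg_def invariants_type)
      then show "x + y \<in> RL G \<gamma> z d"
        unfolding RL_def invariants_deg_def invariants_type
        by (intro image_eqI[of _ _ "f + g"]) (simp_all add: resX_add G.fixed_add homogeneous_add)
    next
      fix a x assume "x \<in> RL G \<gamma> z d"
      then obtain f where f: "x = resX \<gamma> z f" "f \<in> fixed G" "homogeneous d f"
        by (auto simp: RL_def invariants_deg_def invariants_type)
      have "homogeneous d (single 0 a * f)" using homogeneous_mult[OF homogeneous_const f(3), of a] by simp
      moreover have "single 0 a * f \<in> fixed G" using f by (intro G.fixed_mult G.fixed_const)
      ultimately show "a *\<^sub>R x \<in> RL G \<gamma> z d"
        unfolding RL_def invariants_deg_def invariants_type
        by (intro image_eqI[of _ _ "single 0 a * f"]) (simp_all add: resX_scale f)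
    qed
  qed
qed

lemma RL_pred_eq: "RL_pred G \<gamma> z d = res_lower d"
  by (simp add: RL_pred_def res_lower_def RL_eq)

abbreviation ep :: "nat \<Rightarrow> real ^ 'l \<Rightarrow> real ^ 'l" where
  "ep \<equiv> eps G \<gamma> z"

lemma ep_def: "ep d = orth_proj (span (res_lattice d) \<inter> (res_lower d)\<^sup>\<bottom>)"
  by (simp add: eps_def RL_eq RL_pred_eq)

lemma subspace_ep: "subspace (span (res_lattice d) \<inter> (res_lower d)\<^sup>\<bottom>)"
  by (intro subspace_inter subspace_orthogonal_comp) simp

lemma linear_ep: "linear (ep d)"
  unfolding ep_def by (rule linear_orth_proj[OF subspace_ep])

lemma ep_res_lower: "v \<in> res_lower d \<Longrightarrow> ep d v = 0"
  unfolding ep_def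
  by (rule orth_proj_unique[OF subspace_ep])
     (auto simp: orthogonal_comp_def orthogonal_commute orthogonal_clauses span_0)

text \<open>
  The part of \<open>v\<close> orthogonal to $\mathbb{R}L_{d-1}$ lies in the space onto which \<open>ep d\<close>
  projects; so $\varepsilon_d$ is the quotient map modulo $\mathbb{R}L_{d-1}$.
\<close>

lemma diff_ep_res_lower:
  assumes v: "v \<in> span (res_lattice d)"
  shows "v - ep d v \<in> res_lower d"
proof -
  let ?W = "span (res_lattice d) \<inter> (res_lower d)\<^sup>\<bottom>"
  let ?u = "v - ep d v"
  have u: "?u \<in> ?W\<^sup>\<bottom>" "ep d v \<in> ?W"
    unfolding ep_def using orth_proj[OF subspace_ep] by blast+
  obtain a b where ab: "a \<in> span (res_lower d)" "\<And>x. x \<in> span (res_lower d) \<Longrightarrow> orthogonal b x" "?u = a + b"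
    using orthogonal_subspace_decomp_exists by blast
  have a: "a \<in> res_lower d" using ab(1) subspace_res_lower span_eq_iff by blast
  have bL: "b \<in> (res_lower d)\<^sup>\<bottom>"
    using ab(2) span_base by (auto simp: orthogonal_comp_def orthogonal_commute)
  have "b = ?u - a" using ab(3) by simp
  moreover have "?u \<in> span (res_lattice d)" using v u(2) by (simp add: span_diff)
  ultimately have "b \<in> ?W" using a res_lower_subset[of d] bL by (simp add: span_diff subset_iff)
  then have "orthogonal b ?u" using u(1) by (simp add: orthogonal_comp_def)
  moreover have "orthogonal b a" using ab by blast
  ultimately have "b \<bullet> b = 0" unfolding ab(3) by (simp add: orthogonal_def inner_add_right)
  then show ?thesis using ab(3) a by simp
qed

section \<open>Rational invariants\<close>

definition resQ :: "('n, rat) mpoly \<Rightarrow> real ^ 'l" where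
  "resQ f = (\<chi> i. of_rat (eval f (\<lambda>j. of_int ((z \<circ> \<gamma> i) j))))"

lemma resQ_coeff_of_int: "resQ (coeff_of_int f) = resZ f"
  unfolding resQ_def resZ_def eval_coeff_of_int of_rat_of_int_eq ..

lemma resQ_0: "resQ 0 = 0" by (simp add: resQ_def vec_eq_iff)
lemma resQ_add: "resQ (f + g) = resQ f + resQ g"
  by (simp add: resQ_def vec_eq_iff eval_add of_rat_add)

lemma resQ_mult:
  assumes s: "s \<in> fixed (Sig c)"
  shows "resQ (s * f) = of_rat (eval s (\<lambda>j. of_int (z j))) *\<^sub>R resQ f"
proof -
  have "eval s (\<lambda>j. of_int ((z \<circ> \<gamma> i) j)) = eval s (\<lambda>j. of_int (z j))" for i
    using eval_Sig[OF s \<gamma>_Sig, of "\<lambda>j. of_int (z j)" i] by (simp add: o_def)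
  then show ?thesis by (simp add: resQ_def vec_eq_iff eval_mult of_rat_mult)
qed

lemma clear_denominators_fixed:
  fixes f :: "('n, rat) mpoly"
  assumes f: "f \<in> fixed G"
  obtains N F where "N > 0" "single 0 (of_int N) * f = coeff_of_int F" "F \<in> fixed G"
    "\<And>d. homogeneous d f \<Longrightarrow> homogeneous d F"
proof -
  obtain N F where NF: "N > 0" "single 0 (of_int N) * f = coeff_of_int F"
    using clear_denominators[of f] by (elim exE conjE)
  have "(coeff_of_int F :: ('n, rat) mpoly) \<in> fixed G"
    unfolding NF(2)[symmetric] using f by (intro G.fixed_mult G.fixed_const)
  then have "F \<in> fixed G" by (simp add: G.fixed_coeff_of_int_iff)
  moreover have "homogeneous d F" if "homogeneous d f" for d
  proof -
    have "homogeneous d (coeff_of_int F :: ('n, rat) mpoly)"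
      using homogeneous_mult[OF homogeneous_const that, of "of_int N"] NF(2) by simp
    then show ?thesis by (simp add: homogeneous_coeff_of_int)
  qed
  ultimately show thesis using NF that by blast
qed

lemma resQ_in_span:
  assumes "f \<in> fixed G" "homogeneous d f"
  shows "resQ f \<in> span (res_lattice d)"
proof -
  obtain N F where NF: "N > 0" "single 0 (of_int N) * f = coeff_of_int F" "F \<in> fixed G" "homogeneous d F"
    using clear_denominators_fixed[OF assms(1)] assms(2) by metis
  have "of_int N *\<^sub>R resQ f = resZ F"
    using resQ_mult[OF Sig.fixed_const, of "of_int N" f] NF(2)
    by (simp add: eval_const resQ_coeff_of_int del: single_of_int)
  then have "resQ f = (1 / of_int N) *\<^sub>R resZ F" using NF(1) by (simp flip: \<open>_ = resZ F\<close>)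
  moreover have "resZ F \<in> res_lattice d" using NF by (auto simp: res_lattice_def)
  ultimately show ?thesis by (simp add: span_scale span_base)
qed

definition genQ :: "('n, rat) mpoly set \<Rightarrow> bool" where
  "genQ B \<longleftrightarrow> B \<subseteq> fixed G \<and> fixed G \<subseteq> smod (fixed (Sig c)) B"

lemma genQI:
  "(\<And>b. b \<in> B \<Longrightarrow> b \<in> fixed G) \<Longrightarrow> (\<And>x. x \<in> fixed G \<Longrightarrow> x \<in> smod (fixed (Sig c)) B) \<Longrightarrow> genQ B"
  by (auto simp: genQ_def)

lemma genQD:
  assumes "genQ B"
  shows genQ_fixed: "b \<in> B \<Longrightarrow> b \<in> fixed G"
    and genQ_smod: "x \<in> fixed G \<Longrightarrow> x \<in> smod (fixed (Sig c)) B"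
  using assms by (auto simp: genQ_def)

lemma module_generators_iff_genQ:
  "module_generators QV (invariants QV (Sig c)) (invariants QV G) B \<longleftrightarrow> genQ B"
  unfolding invariants_type genQ_def
  by (rule module_generators_iff_smod) (auto intro: Sig.fixed_0 Sig.fixed_add)

text \<open>
  Taking the component of degree \<open>d\<close> of an expression for \<open>f\<close> leaves only generators of degree
  at most \<open>d\<close>, and the coefficients become constants on \<open>X\<close>.
\<close>

lemma resZ_span_generators:
  assumes gen: "genQ B" and hom: "\<forall>b\<in>B. \<exists>d. homogeneous d b"
    and f: "f \<in> fixed G" "homogeneous d f"
  shows "resZ f \<in> span (resQ ` {b \<in> B. \<exists>e\<le>d. homogeneous e b})"
proof -
  let ?V = "span (resQ ` {b \<in> B. \<exists>e\<le>d. homogeneous e b})"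
  have "resQ (hcomp d x) \<in> ?V" if "x \<in> smod (fixed (Sig c)) B" for x
    using that
  proof induction
    case zero
    show ?case by (simp add: resQ_0 span_0)
  next
    case (step x s b)
    obtain e where e: "homogeneous e b" using hom step by blast
    have "resQ (hcomp d (s * b)) \<in> ?V"
    proof (cases "e \<le> d")
      case True
      have "resQ (hcomp (d - e) s * b) \<in> ?V"
        unfolding resQ_mult[OF Sig.fixed_hcomp[OF step.hyps(2)]]
        by (rule span_scale, rule span_base) (use True e step in auto)
      then show ?thesis using True by (simp add: hcomp_mult_homogeneous[OF e])
    qed (simp add: hcomp_mult_homogeneous[OF e] resQ_0 span_0)
    then show ?case using step by (simp add: restrict_monos_add resQ_add span_add)
  qed
  moreover have "(coeff_of_int f :: ('n, rat) mpoly) \<in> smod (fixed (Sig c)) B"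
    using f(1) by (intro genQ_smod[OF gen]) (simp add: G.fixed_coeff_of_int_iff)
  ultimately have "resQ (hcomp d (coeff_of_int f)) \<in> ?V" by blast
  moreover have "hcomp d (coeff_of_int f :: ('n, rat) mpoly) = coeff_of_int f"
    using f(2) by (simp add: hcomp_of_homogeneous[where e = d] homogeneous_coeff_of_int)
  ultimately show ?thesis by (simp only: resQ_coeff_of_int)
qed

text \<open>
  Membership in the module generated by \<open>B\<close> over $\mathbb{Q}[V]^\Sigma$, for integral
  polynomials and without leaving $\mathbb{Z}[V]$.
\<close>

definition rationally_spanned :: "('n, int) mpoly set \<Rightarrow> ('n, int) mpoly \<Rightarrow> bool" where
  "rationally_spanned B f \<longleftrightarrow> (\<exists>N>0. of_int N * f \<in> smod (fixed (Sig c)) B)"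

lemma rationally_spanned_smod: "f \<in> smod (fixed (Sig c)) B \<Longrightarrow> rationally_spanned B f"
  unfolding rationally_spanned_def by (intro exI[of _ 1]) simp

lemma smod_of_int_mult:
  fixes f :: "('n, int) mpoly"
  shows "f \<in> smod (fixed (Sig c)) B \<Longrightarrow> of_int N * f \<in> smod (fixed (Sig c)) B"
  using smod_mult[of "fixed (Sig c)" "of_int N" f B] Sig.fixed_const[of N c]
  by (simp add: Sig.fixed_mult flip: single_of_int)

lemma rationally_spanned_add:
  assumes "rationally_spanned B f" "rationally_spanned B g"
  shows "rationally_spanned B (f + g)"
proof -
  obtain N M where NM: "N > 0" "of_int N * f \<in> smod (fixed (Sig c)) B"
    "M > 0" "of_int M * g \<in> smod (fixed (Sig c)) B"
    using assms by (auto simp: rationally_spanned_def)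
  have "of_int M * (of_int N * f) + of_int N * (of_int M * g) \<in> smod (fixed (Sig c)) B"
    by (rule smod_add) (use NM in \<open>simp_all only: smod_of_int_mult\<close>)
  then have "of_int (N * M) * (f + g) \<in> smod (fixed (Sig c)) B" by (simp add: algebra_simps)
  moreover have "N * M > 0" using NM by simp
  ultimately show ?thesis by (auto simp: rationally_spanned_def)
qed

lemma rationally_spanned_sum:
  "(\<And>i. i \<in> I \<Longrightarrow> rationally_spanned B (f i)) \<Longrightarrow> rationally_spanned B (\<Sum>i\<in>I. f i)"
  by (induction I rule: infinite_finite_induct)
     (auto intro: rationally_spanned_add rationally_spanned_smod smod.zero)

lemma rationally_spanned_mult:
  assumes "s \<in> fixed (Sig c)" "rationally_spanned B f"
  shows "rationally_spanned B (s * f)"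
proof -
  obtain N where N: "N > 0" "of_int N * f \<in> smod (fixed (Sig c)) B"
    using assms by (auto simp: rationally_spanned_def)
  have "s * (of_int N * f) \<in> smod (fixed (Sig c)) B"
    by (rule smod_mult[OF Sig.fixed_mult assms(1) N(2)])
  then have "of_int N * (s * f) \<in> smod (fixed (Sig c)) B" by (simp add: mult_ac)
  then show ?thesis using N by (auto simp: rationally_spanned_def)
qed

lemma rationally_spanned_divide:
  assumes "M > 0" "rationally_spanned B (of_int M * f)"
  shows "rationally_spanned B f"
proof -
  obtain N where N: "N > 0" "of_int N * (of_int M * f) \<in> smod (fixed (Sig c)) B"
    using assms by (auto simp: rationally_spanned_def)
  then have "of_int (N * M) * f \<in> smod (fixed (Sig c)) B" by (simp add: mult_ac)
  then show ?thesis using N assms unfolding rationally_spanned_def by (intro exI[of _ "N * M"]) simp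
qed

lemma rationally_spanned_aug:
  assumes "x \<in> aug c (fixed G) d"
    and "\<And>e f. e < d \<Longrightarrow> f \<in> fixed G \<Longrightarrow> homogeneous e f \<Longrightarrow> rationally_spanned B f"
  shows "rationally_spanned B x"
  using assms(1)
proof induction
  case zero
  show ?case by (intro rationally_spanned_smod smod.zero)
next
  case (step x s e f e')
  then show ?case
    by (intro rationally_spanned_add rationally_spanned_mult assms(2)[of e' f]) auto
qed

lemma genQ_if_rationally_spanned:
  assumes B: "B \<subseteq> fixed G"
    and span: "\<And>d f. f \<in> fixed G \<Longrightarrow> homogeneous d f \<Longrightarrow> rationally_spanned B f"
  shows "genQ (coeff_of_int ` B)"
proof (rule genQI)
  fix b :: "('n, rat) mpoly" assume "b \<in> coeff_of_int ` B"
  then show "b \<in> fixed G" using B by (auto simp: G.fixed_coeff_of_int_iff)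
next
  fix f :: "('n, rat) mpoly" assume f: "f \<in> fixed G"
  obtain N F where NF: "N > 0" "single 0 (of_int N) * f = coeff_of_int F" "F \<in> fixed G"
    using clear_denominators_fixed[OF f] by metis
  obtain D where D: "\<forall>m\<in>keys F. mono_degree m \<le> D" using ex_degree_bound by blast
  have "rationally_spanned B (\<Sum>d\<le>D. hcomp d F)"
    using span[OF G.fixed_hcomp[OF NF(3)] hcomp_homogeneous] by (rule rationally_spanned_sum)
  then obtain M where M: "M > 0" "of_int M * F \<in> smod (fixed (Sig c)) B"
    using sum_hcomp[OF D] by (auto simp: rationally_spanned_def)
  have lift: "(coeff_of_int x :: ('n, rat) mpoly) \<in> smod (fixed (Sig c)) (coeff_of_int ` B)"
    if "x \<in> smod (fixed (Sig c)) B" for x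
    using that
    by induction (auto simp: coeff_of_int_add coeff_of_int_mult Sig.fixed_coeff_of_int_iff
        intro!: smod.intros)
  have "(coeff_of_int (of_int M * F) :: ('n, rat) mpoly) = single 0 (of_int M) * coeff_of_int F"
    using coeff_of_int_mult[of "single 0 M" F] by (simp add: coeff_of_int_single flip: single_of_int)
  then have "single 0 (of_int M) * (single 0 (of_int N) * f) \<in> smod (fixed (Sig c)) (coeff_of_int ` B)"
    using lift[OF M(2)] NF(2) by simp
  then have "single 0 (1 / of_int (M * N)) * (single 0 (of_int M) * (single 0 (of_int N) * f))
      \<in> smod (fixed (Sig c)) (coeff_of_int ` B)"
    by (rule smod_mult[rotated 2]) (rule Sig.fixed_mult, assumption+, rule Sig.fixed_const)
  moreover have "single 0 (1 / of_int (M * N)) * (single 0 (of_int M) * (single 0 (of_int N) * f)) = f"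
    using M(1) NF(1) by (simp add: mult.assoc[symmetric] mult_single del: single_of_int)
  ultimately show "f \<in> smod (fixed (Sig c)) (coeff_of_int ` B)" by simp
qed

section \<open>Sets of secondaries\<close>

text \<open>
  The sums over \<open>G\<close> of Artin's monomials generate: apply \<open>orbit_sum\<close> to a reduction of an
  invariant and use induction on the degree for the part in the augmentation submodule.
\<close>

lemma finite_homogeneous_generators:
  "\<exists>B. finite B \<and> genQ B \<and> (\<forall>b\<in>B. \<exists>d. homogeneous d b)"
proof -
  let ?B = "(\<lambda>a. orbit_sum (single a (1::int))) ` artin_set"
  have "rationally_spanned ?B f" if "f \<in> fixed G" "homogeneous d f" for d f
    using that
  proof (induction d arbitrary: f rule: less_induct)
    case (less d)
    let ?D = "{a \<in> artin_set. mono_degree a = d}"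
    obtain k where k: "f - (\<Sum>a\<in>?D. single a (k a)) \<in> aug c UNIV d"
      using artin_set(3)[OF less.prems(2)] by (auto simp: reducible_def)
    have "rationally_spanned ?B (orbit_sum (f - (\<Sum>a\<in>?D. single a (k a))))"
      using less.IH by (intro rationally_spanned_aug[OF orbit_sum_aug[OF k]])
    moreover have "rationally_spanned ?B (\<Sum>a\<in>?D. orbit_sum (single a (k a)))"
    proof (rule rationally_spanned_sum, rule rationally_spanned_smod)
      fix a assume "a \<in> ?D"
      have "orbit_sum (single a (k a)) = single 0 (k a) * orbit_sum (single a 1)"
        using orbit_sum_mult[OF Sig.fixed_const, of "k a" "single a 1"] by (simp add: mult_single del: single_of_int)
      also have "\<dots> \<in> smod (fixed (Sig c)) ?B"
        using \<open>a \<in> ?D\<close> by (intro smod_gen Sig.fixed_const) auto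
      finally show "orbit_sum (single a (k a)) \<in> smod (fixed (Sig c)) ?B" .
    qed
    ultimately have "rationally_spanned ?B
        (orbit_sum (f - (\<Sum>a\<in>?D. single a (k a))) + orbit_sum (\<Sum>a\<in>?D. single a (k a)))"
      unfolding orbit_sum_sum by (rule rationally_spanned_add)
    then have "rationally_spanned ?B (of_int (int (card G)) * f)"
      unfolding orbit_sum_add[symmetric] using orbit_sum_of_fixed[OF less.prems(1)] by simp
    then show ?case by (rule rationally_spanned_divide[rotated]) (use card_G_pos in simp)
  qed
  then have "genQ (coeff_of_int ` ?B)"
    using orbit_sum_fixed by (intro genQ_if_rationally_spanned) auto
  moreover have "\<exists>d. homogeneous d b" if "b \<in> coeff_of_int ` ?B" for b :: "('n, rat) mpoly"
  proof -
    from that obtain a where "b = coeff_of_int (orbit_sum (single a (1::int)))" by blast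
    then have "homogeneous (mono_degree a) b"
      using orbit_sum_homogeneous[OF homogeneous_single, of a "1::int"] by (simp add: homogeneous_coeff_of_int)
    then show ?thesis ..
  qed
  ultimately show ?thesis using artin_set(1) by (intro exI[of _ "coeff_of_int ` ?B"]) simp
qed

lemma secondaries_iff:
  "secondaries c G \<Theta> \<longleftrightarrow>
    (\<forall>\<theta>\<in>\<Theta>. \<exists>d. homogeneous d \<theta>) \<and> genQ \<Theta> \<and> (\<forall>\<Theta>'. \<Theta>' \<subset> \<Theta> \<longrightarrow> \<not> genQ \<Theta>')"
  by (simp add: secondaries_def Let_def module_generators_iff_genQ)

lemma secondariesD:
  assumes "secondaries c G \<Theta>"
  shows secondaries_homogeneous: "\<forall>\<theta>\<in>\<Theta>. \<exists>d. homogeneous d \<theta>"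
    and secondaries_genQ: "genQ \<Theta>"
    and secondaries_minimal: "\<Theta>' \<subseteq> \<Theta> \<Longrightarrow> genQ \<Theta>' \<Longrightarrow> \<Theta>' = \<Theta>"
  using assms unfolding secondaries_iff by auto

lemma ex_secondaries: "\<exists>\<Theta>. secondaries c G \<Theta>"
proof -
  obtain B where B: "finite B" "genQ B" "\<forall>b\<in>B. \<exists>d. homogeneous d b"
    using finite_homogeneous_generators by (elim exE conjE)
  have "\<exists>\<Theta>\<subseteq>B. genQ \<Theta> \<and> (\<forall>\<Theta>'. \<Theta>' \<subset> \<Theta> \<longrightarrow> \<not> genQ \<Theta>')"
    using B(1,2)
  proof (induction B rule: finite_psubset_induct)
    case (psubset B)
    show ?case
    proof (cases "\<exists>\<Theta>'. \<Theta>' \<subset> B \<and> genQ \<Theta>'")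
      case True
      then obtain C where C: "C \<subset> B" "genQ C" by (elim exE conjE)
      from psubset.IH[OF C] obtain \<Theta> where
        "\<Theta> \<subseteq> C" "genQ \<Theta>" "\<forall>\<Theta>'. \<Theta>' \<subset> \<Theta> \<longrightarrow> \<not> genQ \<Theta>'" by (elim exE conjE)
      moreover have "\<Theta> \<subseteq> B" using \<open>\<Theta> \<subseteq> C\<close> C(1) by (rule order_trans[OF _ psubset_imp_subset])
      ultimately show ?thesis by (intro exI[of _ \<Theta>] conjI)
    next
      case False
      then show ?thesis using psubset.prems by (intro exI[of _ B] conjI) simp_all
    qed
  qed
  then obtain \<Theta> where \<Theta>: "\<Theta> \<subseteq> B" "genQ \<Theta>" "\<forall>\<Theta>'. \<Theta>' \<subset> \<Theta> \<longrightarrow> \<not> genQ \<Theta>'" by (elim exE conjE)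
  then have "secondaries c G \<Theta>" unfolding secondaries_iff using B(3) by (intro conjI) auto
  then show ?thesis by blast
qed

text \<open>
  Finitely many generators involve only finitely many elements of any other generating set.
\<close>

lemma secondaries_finite:
  assumes S: "secondaries c G \<Theta>"
  shows "finite \<Theta>"
proof -
  obtain B where B: "finite B" "genQ B" using finite_homogeneous_generators by (elim exE conjE)
  have "\<exists>K. finite K \<and> K \<subseteq> \<Theta> \<and> b \<in> smod (fixed (Sig c)) K" if "b \<in> B" for b
    using smod_finite_support[OF genQ_smod[OF secondaries_genQ[OF S] genQ_fixed[OF B(2) that]]] .
  then obtain K where K: "\<And>b. b \<in> B \<Longrightarrow> finite (K b) \<and> K b \<subseteq> \<Theta> \<and> b \<in> smod (fixed (Sig c)) (K b)"
    by metis
  let ?T = "\<Union>b\<in>B. K b"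
  have BT: "B \<subseteq> smod (fixed (Sig c)) ?T"
  proof
    fix b assume b: "b \<in> B"
    show "b \<in> smod (fixed (Sig c)) ?T"
      by (rule smod_mono[of _ _ "K b"]) (use K[OF b] b in auto)
  qed
  have sub: "?T \<subseteq> \<Theta>" using K by blast
  have "genQ ?T"
  proof (rule genQI)
    show "b \<in> fixed G" if "b \<in> ?T" for b using that sub genQ_fixed[OF secondaries_genQ[OF S]] by blast
    show "x \<in> smod (fixed (Sig c)) ?T" if "x \<in> fixed G" for x
      by (rule smod_trans[OF Sig.fixed_mult genQ_smod[OF B(2) that] BT])
  qed
  then have "?T = \<Theta>" by (rule secondaries_minimal[OF S sub])
  moreover have "finite ?T" using K B(1) by blast
  ultimately show ?thesis by simp
qed

lemma secondaries_nonzero: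
  assumes S: "secondaries c G \<Theta>"
  shows "0 \<notin> \<Theta>"
proof
  assume 0: "0 \<in> \<Theta>"
  have "x \<in> smod (fixed (Sig c)) (\<Theta> - {0})" if "x \<in> smod (fixed (Sig c)) \<Theta>" for x
    using that
  proof induction
    case (step x s b)
    then show ?case by (cases "b = 0") (auto intro: smod.intros)
  qed (rule smod.zero)
  then have "genQ (\<Theta> - {0})"
    using genQ_fixed[OF secondaries_genQ[OF S]] genQ_smod[OF secondaries_genQ[OF S]]
    by (intro genQI) simp_all
  then have "\<Theta> - {0} = \<Theta>" by (intro secondaries_minimal[OF S]) simp_all
  then show False using 0 by blast
qed

text \<open>
  If no secondary had degree \<open>d\<close>, then $\mathbb{R}L_d$ would be spanned by restrictions of secondaries of
  smaller degree.  The bound by \<open>top_degree\<close> needs that only finitely many degrees occur, since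
  \<open>top_degree\<close> is a maximum.
\<close>

lemma tau_nonzero:
  assumes "span (res_lattice d) \<noteq> res_lower d"
  shows "tau c G d \<noteq> 0" "d \<le> top_degree c G"
proof -
  define \<Theta> where "\<Theta> = (SOME \<Theta>. secondaries c G \<Theta>)"
  have S: "secondaries c G \<Theta>" unfolding \<Theta>_def using ex_secondaries by (rule someI_ex)
  have fin: "finite \<Theta>" using S by (rule secondaries_finite)
  have tau: "tau c G d = card {\<theta> \<in> \<Theta>. homogeneous d \<theta>}" for d by (simp add: tau_def \<Theta>_def)
  have gen: "genQ \<Theta>" "\<forall>\<theta>\<in>\<Theta>. \<exists>d. homogeneous d \<theta>"
    using secondaries_genQ[OF S] secondaries_homogeneous[OF S] by simp_all
  show pos: "tau c G d \<noteq> 0"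
  proof
    assume "tau c G d = 0"
    then have none: "\<not> homogeneous d \<theta>" if "\<theta> \<in> \<Theta>" for \<theta> using that fin by (auto simp: tau)
    have "resQ ` {b \<in> \<Theta>. \<exists>e\<le>d. homogeneous e b} \<subseteq> res_lower d"
    proof (clarify)
      fix b e assume b: "b \<in> \<Theta>" "e \<le> d" "homogeneous e b"
      then have "e < d" using none by (metis le_neq_implies_less)
      moreover have "resQ b \<in> span (res_lattice e)" using b genQ_fixed[OF gen(1)] by (intro resQ_in_span)
      ultimately show "resQ b \<in> res_lower d" using res_lattice_in_lower by blast
    qed
    then have "span (resQ ` {b \<in> \<Theta>. \<exists>e\<le>d. homogeneous e b}) \<subseteq> res_lower d"
      by (rule span_minimal[OF _ subspace_res_lower])
    then have "res_lattice d \<subseteq> res_lower d" using resZ_span_generators[OF gen] by (auto simp: res_lattice_def)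
    then have "span (res_lattice d) \<subseteq> res_lower d" by (rule span_minimal[OF _ subspace_res_lower])
    then show False using assms res_lower_subset by blast
  qed
  have "finite {d. homogeneous d \<theta>}" if "\<theta> \<in> \<Theta>" for \<theta>
  proof -
    from bspec[OF gen(2) that] obtain e where "homogeneous e \<theta>" by (elim exE)
    moreover have "\<theta> \<noteq> 0" using that secondaries_nonzero[OF S] by blast
    ultimately have "{d. homogeneous d \<theta>} \<subseteq> {e}" using homogeneous_degree_unique by blast
    then show ?thesis using finite_subset by blast
  qed
  then have "finite (\<Union>\<theta>\<in>\<Theta>. {d. homogeneous d \<theta>})" using fin by blast
  moreover have "{d. tau c G d \<noteq> 0} \<subseteq> (\<Union>\<theta>\<in>\<Theta>. {d. homogeneous d \<theta>})"
    using fin by (auto simp: tau)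
  ultimately have "finite {d. tau c G d \<noteq> 0}" by (rule finite_subset[rotated])
  then show "d \<le> top_degree c G" unfolding top_degree_def using pos by (intro Max_ge) auto
qed

section \<open>The output of the algorithm\<close>

lemma ep_resZ_0: "ep d (resZ 0) = 0"
  by (simp add: linear_0[OF linear_ep])

lemma distinct_concat_disjoint:
  assumes "distinct ds" "\<And>d. d \<in> set ds \<Longrightarrow> distinct (fs d)"
    and "\<And>d e. d \<in> set ds \<Longrightarrow> e \<in> set ds \<Longrightarrow> d \<noteq> e \<Longrightarrow> set (fs d) \<inter> set (fs e) = {}"
  shows "distinct (concat (map fs ds))"
  using assms by (induction ds) auto

text \<open>
  Everything that is used about the output: in each degree \<open>d\<close>, also in those which the algorithm
  skips, the images under $\varepsilon_d$ of its elements of degree \<open>d\<close> form a basis of the lattice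
  $\varepsilon_d(M_d)$.  In a skipped degree \<open>tau_nonzero\<close> shows that this lattice is zero.
\<close>

lemma algorithm_output_graded_basis:
  assumes out: "algorithm_output c G \<gamma> z \<theta>s"
  shows "distinct \<theta>s" and "set \<theta>s \<subseteq> fixed G" and "\<And>\<theta>. \<theta> \<in> set \<theta>s \<Longrightarrow> \<exists>d. homogeneous d \<theta>"
    and "\<And>f d. f \<in> fixed G \<Longrightarrow> homogeneous d f \<Longrightarrow>
      \<exists>k :: _ \<Rightarrow> int. ep d (resZ f) =
        (\<Sum>\<theta>\<in>{\<theta> \<in> set \<theta>s. homogeneous d \<theta>}. real_of_int (k \<theta>) *\<^sub>R ep d (resZ \<theta>))"
    and "\<And>d r \<theta>. (\<Sum>\<theta>\<in>{\<theta> \<in> set \<theta>s. homogeneous d \<theta>}. r \<theta> *\<^sub>R ep d (resZ \<theta>)) = 0 \<Longrightarrow>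
      \<theta> \<in> set \<theta>s \<Longrightarrow> homogeneous d \<theta> \<Longrightarrow> r \<theta> = 0"
proof -
  define ds where "ds = filter (\<lambda>d. tau c G d \<noteq> 0) [0..<Suc (top_degree c G)]"
  obtain bs fs where
    lat: "\<And>d. d \<in> set ds \<Longrightarrow> lattice_basis (ep d ` res_lattice d) (bs d)" and
    lift: "\<And>d. d \<in> set ds \<Longrightarrow> set (fs d) \<subseteq> invariants_deg ZV G d" and
    bs: "\<And>d. d \<in> set ds \<Longrightarrow> map (\<lambda>f. ep d (resZ f)) (fs d) = bs d" and
    \<theta>s: "\<theta>s = concat (map fs ds)"
    using out unfolding algorithm_output_def Let_def ds_def[symmetric] Mlat_eq resX_coeff_of_int by blast
  have fs: "f \<in> fixed G" "homogeneous d f" if "d \<in> set ds" "f \<in> set (fs d)" for d f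
    using lift that by (auto simp: invariants_deg_def invariants_type)
  have dist_map: "distinct (map (\<lambda>f. ep d (resZ f)) (fs d))" if "d \<in> set ds" for d
    using lat[OF that] bs[OF that] by (simp add: lattice_basis_def)
  have ind: "independent ((\<lambda>f. ep d (resZ f)) ` set (fs d))" if "d \<in> set ds" for d
    using lat[OF that] bs[OF that, symmetric] by (simp add: lattice_basis_def)
  have dist: "distinct (fs d)" and inj: "inj_on (\<lambda>f. ep d (resZ f)) (set (fs d))"
    if "d \<in> set ds" for d
    using dist_map[OF that] by (auto simp: distinct_map)
  have nz: "f \<noteq> 0" if "d \<in> set ds" "f \<in> set (fs d)" for d f
  proof
    assume "f = 0"
    then have "0 \<in> (\<lambda>f. ep d (resZ f)) ` set (fs d)"
      using that(2) by (intro image_eqI[of _ _ 0]) (simp_all add: ep_resZ_0[unfolded resZ_0])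
    from ind[OF that(1)] dependent_zero[OF this] show False by (rule notE)
  qed
  \<comment> \<open>Elements of a lattice basis are nonzero, so the degree of each element of the output is
     unique and recovers the step at which the element was added.\<close>
  have part: "{\<theta> \<in> set \<theta>s. homogeneous d \<theta>} = (if d \<in> set ds then set (fs d) else {})" for d
  proof -
    have "\<theta> \<in> set (fs d) \<and> d \<in> set ds" if "\<theta> \<in> set \<theta>s" "homogeneous d \<theta>" for \<theta>
    proof -
      from that(1) \<theta>s obtain e where e: "e \<in> set ds" "\<theta> \<in> set (fs e)" by auto
      then have "e = d" using homogeneous_degree_unique[OF fs(2)[OF e] that(2) nz[OF e]] by simp
      then show ?thesis using e by simp
    qed
    then show ?thesis using fs \<theta>s by auto
  qed
  show "distinct \<theta>s"
    unfolding \<theta>s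
  proof (rule distinct_concat_disjoint)
    show "distinct ds" by (simp add: ds_def)
    show "set (fs d) \<inter> set (fs e) = {}" if "d \<in> set ds" "e \<in> set ds" "d \<noteq> e" for d e
      using that fs(2) nz homogeneous_degree_unique by (metis disjoint_iff)
  qed (rule dist)
  show "set \<theta>s \<subseteq> fixed G" using fs(1) \<theta>s by auto
  show "\<exists>d. homogeneous d \<theta>" if "\<theta> \<in> set \<theta>s" for \<theta> using that fs(2) \<theta>s by auto
  show "\<exists>k :: _ \<Rightarrow> int. ep d (resZ f) =
        (\<Sum>\<theta>\<in>{\<theta> \<in> set \<theta>s. homogeneous d \<theta>}. real_of_int (k \<theta>) *\<^sub>R ep d (resZ \<theta>))"
    if f: "f \<in> fixed G" "homogeneous d f" for f d
  proof (cases "d \<in> set ds")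
    case True
    have len: "length (bs d) = length (fs d)" using bs[OF True] by (metis length_map)
    have "ep d (resZ f) \<in> ep d ` res_lattice d" using f by (auto simp: res_lattice_def)
    then obtain k :: "nat \<Rightarrow> int" where
      "ep d (resZ f) = (\<Sum>i<length (bs d). real_of_int (k i) *\<^sub>R bs d ! i)"
      using lat[OF True] by (auto simp: lattice_basis_def)
    also have "\<dots> = (\<Sum>i<length (fs d). real_of_int (k i) *\<^sub>R ep d (resZ (fs d ! i)))"
      unfolding len by (rule sum.cong) (simp_all add: bs[OF True, symmetric])
    also have "\<dots> = (\<Sum>i<length (fs d). (\<lambda>\<theta>. real_of_int (k (inv_into {..<length (fs d)} ((!) (fs d)) \<theta>))
        *\<^sub>R ep d (resZ \<theta>)) (fs d ! i))"
      using dist[OF True] by (intro sum.cong) (simp_all add: inv_into_f_f inj_on_nth)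
    also have "\<dots> = (\<Sum>\<theta>\<in>set (fs d). real_of_int (k (inv_into {..<length (fs d)} ((!) (fs d)) \<theta>))
        *\<^sub>R ep d (resZ \<theta>))"
      by (rule sum.reindex_bij_betw[OF bij_betw_nth[OF dist[OF True]]]) simp_all
    finally show ?thesis unfolding part using True
      by (intro exI[of _ "\<lambda>\<theta>. k (inv_into {..<length (fs d)} ((!) (fs d)) \<theta>)"]) simp
  next
    case False
    then have "tau c G d = 0 \<or> d > top_degree c G" by (auto simp: ds_def simp del: upt_Suc)
    then have "span (res_lattice d) = res_lower d" using tau_nonzero[of d] by force
    then have "ep d (resZ f) = 0"
      using f span_base[of "resZ f" "res_lattice d"] by (intro ep_res_lower) (auto simp: res_lattice_def)
    then show ?thesis unfolding part using False by simp
  qed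
  show "r \<theta> = 0" if sum0: "(\<Sum>\<theta>\<in>{\<theta> \<in> set \<theta>s. homogeneous d \<theta>}. r \<theta> *\<^sub>R ep d (resZ \<theta>)) = 0"
    and \<theta>: "\<theta> \<in> set \<theta>s" "homogeneous d \<theta>" for d r \<theta>
  proof -
    let ?e = "\<lambda>f. ep d (resZ f)"
    have d: "d \<in> set ds" "\<theta> \<in> set (fs d)" using \<theta> part[of d] by (auto split: if_splits)
    have "(\<Sum>b\<in>?e ` set (fs d). r (inv_into (set (fs d)) ?e b) *\<^sub>R b) = 0"
      using sum0 d(1) unfolding part
      by (subst sum.reindex[OF inj[OF d(1)]]) (simp add: inv_into_f_f[OF inj[OF d(1)]])
    then have "r (inv_into (set (fs d)) ?e (?e \<theta>)) = 0"
      using d by (intro independentD[OF ind[OF d(1)], of "?e ` set (fs d)"]) auto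
    then show ?thesis using d by (simp add: inv_into_f_f[OF inj[OF d(1)]])
  qed
qed

end

section \<open>Reduction modulo a prime\<close>

lemma red_add_mult: "red p (f + of_int (int p) * h) = red p f"
  by (rule poly_mapping_eqI) (simp add: lookup_red lookup_add lookup_of_int_mult del: of_int_of_nat_eq)

lemma red_red [simp]: "red p (red p f) = red p f"
  by (rule poly_mapping_eqI) (simp add: lookup_red)

lemma red_0 [simp]: "red p 0 = 0"
  by (rule poly_mapping_eqI) (simp add: lookup_red)

text \<open>
  Coefficientwise division by \<open>p\<close>.
\<close>

lemma red_eqE:
  assumes "red p f = red p g"
  obtains h where "f = g + of_int (int p) * h"
proof
  have dvd: "int p dvd lookup f m - lookup g m" for m
    using arg_cong[OF assms, of "\<lambda>q. lookup q m"] by (simp add: lookup_red mod_eq_dvd_iff)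
  show "f = g + of_int (int p) * Poly_Mapping.map (\<lambda>a. a div int p) (f - g)"
    by (rule poly_mapping_eqI)
       (use dvd in \<open>simp add: lookup_add lookup_of_int_mult Poly_Mapping.map.rep_eq when_def lookup_minus
         del: of_int_of_nat_eq\<close>)
qed

lemma red_eq_iff: "red p f = red p g \<longleftrightarrow> (\<forall>m. lookup f m mod int p = lookup g m mod int p)"
proof
  assume "red p f = red p g"
  then have "lookup (red p f) m = lookup (red p g) m" for m by simp
  then show "\<forall>m. lookup f m mod int p = lookup g m mod int p" by (simp add: lookup_red)
qed (auto intro!: poly_mapping_eqI simp: lookup_red)

lemma red_cong_add: "red p f = red p f' \<Longrightarrow> red p g = red p g' \<Longrightarrow> red p (f + g) = red p (f' + g')"
  unfolding red_eq_iff lookup_add by (intro allI mod_add_cong) simp_all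

lemma red_cong_diff: "red p f = red p f' \<Longrightarrow> red p g = red p g' \<Longrightarrow> red p (f - g) = red p (f' - g')"
  unfolding red_eq_iff lookup_minus by (intro allI mod_diff_cong) simp_all

lemma red_cong_sum:
  "(\<And>i. i \<in> I \<Longrightarrow> red p (f i) = red p (g i)) \<Longrightarrow> red p (\<Sum>i\<in>I. f i) = red p (\<Sum>i\<in>I. g i)"
  by (induction I rule: infinite_finite_induct) (auto intro: red_cong_add)

lemma red_cong_mult:
  assumes "red p f = red p f'" "red p g = red p g'"
  shows "red p (f * g) = red p (f' * g')"
proof -
  obtain h h' where "f = f' + of_int (int p) * h" "g = g' + of_int (int p) * h'"
    using assms by (elim red_eqE)
  then have "f * g = f' * g' + of_int (int p) * (h * g' + f' * h' + of_int (int p) * h * h')"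
    by (simp add: algebra_simps)
  then show ?thesis using red_add_mult by metis
qed

lemma act_red: "bij g \<Longrightarrow> act g (red p f) = red p (act g f)"
  by (rule poly_mapping_eqI) (simp add: lookup_act lookup_red)

lemma restrict_monos_red: "restrict_monos P (red p f) = red p (restrict_monos P f)"
  by (rule poly_mapping_eqI) (simp add: lookup_restrict_monos lookup_red when_def)

lemma (in perms) fixed_red: "f \<in> fixed H \<Longrightarrow> red p f \<in> fixed H"
  by (simp add: fixed_def act_red bij)

lemma (in perms) red_eq_fixedE:
  fixes f g :: "('n, int) mpoly"
  assumes "red p f = red p g" "f \<in> fixed H" "g \<in> fixed H" "p > 0"
  obtains h where "h \<in> fixed H" "f = g + of_int (int p) * h"
proof -
  obtain h where h: "f = g + of_int (int p) * h" using red_eqE[OF assms(1)] .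
  have "act s h = h" if s: "s \<in> H" for s
  proof (rule poly_mapping_eqI)
    fix m
    have "of_int (int p) * h \<in> fixed H" using fixed_diff[OF assms(2,3)] h by simp
    then have "lookup (of_int (int p) * h) (mkey s m) = lookup (of_int (int p) * h) m"
      using lookup_act[OF bij[OF s], of "of_int (int p) * h" m] s by (simp add: fixed_def)
    then show "lookup (act s h) m = lookup h m"
      using bij[OF s] \<open>p > 0\<close> by (simp add: lookup_act lookup_of_int_mult del: of_int_of_nat_eq)
  qed
  then have "h \<in> fixed H" by (simp add: fixed_def)
  then show thesis using h by (rule that)
qed

lemma invariants_FV:
  "invariants (FV p) H = {f \<in> fixed H. \<forall>m. lookup f m \<in> {0..<int p}}"
  by (auto simp: invariants_def fixed_def FV_def)

lemma red_id_FV: "f \<in> invariants (FV p) H \<Longrightarrow> red p f = f"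
  by (rule poly_mapping_eqI) (simp add: invariants_FV lookup_red)

lemma (in perms) red_in_invariants:
  "p > 0 \<Longrightarrow> f \<in> fixed H \<Longrightarrow> red p f \<in> invariants (FV p) H"
  by (simp add: invariants_FV fixed_red lookup_red)

lemma ex1_unique: "\<exists>!x. P x \<Longrightarrow> P a \<Longrightarrow> P b \<Longrightarrow> a = b"
  by blast

lemma finsum_FV:
  assumes p: "Factorial_Ring.prime p" and "finite I"
  shows "finsum (FV p) (\<lambda>i. red p (f i)) I = red p (\<Sum>i\<in>I. f i)"
proof -
  interpret R: cring "FV p :: ('b, int) mpoly ring" using FV_cring[OF p] .
  have carr: "red p g \<in> carrier (FV p)" for g :: "('b, int) mpoly"
    using p prime_gt_0_nat by (auto simp: FV_def lookup_red)
  have add: "f \<oplus>\<^bsub>FV p\<^esub> g = red p (f + g)" and zero: "\<zero>\<^bsub>FV p\<^esub> = 0" for f g :: "('b, int) mpoly"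
    by (simp_all add: FV_def)
  show ?thesis using assms(2)
  proof (induction I rule: finite_induct)
    case (insert x I)
    have "finsum (FV p) (\<lambda>i. red p (f i)) (insert x I) = red p (f x) \<oplus>\<^bsub>FV p\<^esub> red p (\<Sum>i\<in>I. f i)"
      using insert carr by (subst R.finsum_insert) auto
    also have "\<dots> = red p (\<Sum>i\<in>insert x I. f i)"
      using insert by (simp add: add) (rule red_cong_add, simp_all)
    finally show ?case .
  qed (simp add: zero)
qed

lemma lin_comb_FV:
  assumes p: "Factorial_Ring.prime p" and K: "finite K" "{i. k i \<noteq> 0} \<subseteq> K"
  shows "lin_comb (FV p) b k = red p (\<Sum>i\<in>K. k i * b i)"
proof -
  have sel: "f \<otimes>\<^bsub>FV p\<^esub> g = red p (f * g)" "\<zero>\<^bsub>FV p\<^esub> = 0" for f g :: "('b, int) mpoly"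
    by (simp_all add: FV_def)
  have "lin_comb (FV p) b k = red p (\<Sum>i\<in>{i. k i \<noteq> 0}. k i * b i)"
    unfolding lin_comb_def sel using finite_subset[OF K(2,1)] by (rule finsum_FV[OF p])
  also have "(\<Sum>i\<in>{i. k i \<noteq> 0}. k i * b i) = (\<Sum>i\<in>K. k i * b i)"
    using K by (intro sum.mono_neutral_left) auto
  finally show ?thesis .
qed

section \<open>Bounded degree\<close>

definition deg_le :: "nat \<Rightarrow> ('n::finite, 'a::zero) mpoly \<Rightarrow> bool" where
  "deg_le N f \<longleftrightarrow> (\<forall>m\<in>keys f. mono_degree m \<le> N)"

lemma deg_le_mult: "deg_le M f \<Longrightarrow> deg_le N g \<Longrightarrow> deg_le (M + N) (f * g)"
  for f g :: "('n::finite, int) mpoly"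
  using keys_mult[of f g] by (fastforce simp: deg_le_def mono_degree_add intro: add_mono)

lemma deg_le_sum: "(\<And>i. i \<in> I \<Longrightarrow> deg_le N (f i)) \<Longrightarrow> deg_le N (\<Sum>i\<in>I. f i)"
  for f :: "_ \<Rightarrow> ('n::finite, int) mpoly"
  using keys_sum[of f I] by (fastforce simp: deg_le_def)

lemma deg_le_red: "deg_le N f \<Longrightarrow> deg_le N (red p f)"
  by (auto simp: deg_le_def in_keys_iff lookup_red)

abbreviation trunc :: "nat \<Rightarrow> ('n::finite, 'a::zero) mpoly \<Rightarrow> ('n, 'a) mpoly" where
  "trunc N \<equiv> restrict_monos (\<lambda>m. mono_degree m \<le> N)"

lemma deg_le_trunc: "deg_le N (trunc N f)"
  by (auto simp: deg_le_def in_keys_iff lookup_restrict_monos)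

lemma trunc_id: "deg_le N f \<Longrightarrow> trunc N f = f"
  by (rule poly_mapping_eqI) (auto simp: deg_le_def in_keys_iff lookup_restrict_monos when_def)

lemma trunc_mult_eq_0:
  fixes f g :: "('n::finite, int) mpoly"
  assumes "trunc N f = 0"
  shows "trunc N (f * g) = 0"
proof (rule poly_mapping_eqI)
  fix m
  have f: "mono_degree k > N" if "k \<in> keys f" for k
    using arg_cong[OF assms, of "\<lambda>q. lookup q k"] that
    by (auto simp: lookup_restrict_monos when_def in_keys_iff split: if_splits)
  have "mono_degree m > N" if m: "m \<in> keys (f * g)"
  proof -
    obtain a b where "m = a + b" "a \<in> keys f" using keys_mult[of f g] m by blast
    then show ?thesis using f[of a] by (simp add: mono_degree_add)
  qed
  then have "m \<notin> keys (f * g)" if "mono_degree m \<le> N" using that by auto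
  then show "lookup (trunc N (f * g)) m = lookup 0 m"
    by (simp add: lookup_restrict_monos when_def in_keys_iff)
qed

lemma trunc_diff_trunc: "trunc N (f - trunc N f) = 0"
  for f :: "('n::finite, int) mpoly"
  by (rule poly_mapping_eqI) (simp add: lookup_restrict_monos lookup_minus when_def)

definition inv_le :: "nat \<Rightarrow> ('n::finite \<Rightarrow> 'n) set \<Rightarrow> nat \<Rightarrow> ('n, int) mpoly set" where
  "inv_le p H N = {f \<in> invariants (FV p) H. deg_le N f}"

lemma
  fixes H :: "('n::finite \<Rightarrow> 'n) set"
  assumes p: "p > 0"
  shows finite_inv_le: "finite (inv_le p H N)"
    and card_inv_le: "card (inv_le p H N) \<le> p ^ ((N + 1) ^ CARD('n))"
proof -
  let ?M = "{m :: 'n \<Rightarrow>\<^sub>0 nat. mono_degree m \<le> N}"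
  let ?P = "Pi\<^sub>E ?M (\<lambda>_. {0..<int p})"
  have finM: "finite ?M" by (rule finite_mono_degree_le)
  have inj: "inj_on (\<lambda>f. restrict (lookup f) ?M) (inv_le p H N)"
  proof (rule inj_onI, rule poly_mapping_eqI)
    fix f g m assume f: "f \<in> inv_le p H N" and g: "g \<in> inv_le p H N"
      and e: "restrict (lookup f) ?M = restrict (lookup g) ?M"
    show "lookup f m = lookup g m"
    proof (cases "mono_degree m \<le> N")
      case True
      then show ?thesis using fun_cong[OF e, of m] by simp
    next
      case False
      then have "m \<notin> keys f" "m \<notin> keys g" using f g by (auto simp: inv_le_def deg_le_def)
      then show ?thesis by (simp add: in_keys_iff)
    qed
  qed
  have sub: "(\<lambda>f. restrict (lookup f) ?M) ` inv_le p H N \<subseteq> ?P"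
    by (auto simp: inv_le_def invariants_FV PiE_def)
  have finP: "finite ?P" using finM by (intro finite_PiE) auto
  show "finite (inv_le p H N)" using inj finite_subset[OF sub finP] by (rule inj_on_finite[OF _ order_refl])
  have "card (inv_le p H N) \<le> card ?P" using inj sub finP by (rule card_inj_on_le)
  also have "\<dots> = p ^ card ?M" using finM by (simp add: card_PiE)
  also have "\<dots> \<le> p ^ ((N + 1) ^ CARD('n))"
    using p card_mono_degree_le by (intro power_increasing) auto
  finally show "card (inv_le p H N) \<le> p ^ ((N + 1) ^ CARD('n))" .
qed

lemma (in perms) card_inv_le_ge_2: "p > 1 \<Longrightarrow> card (inv_le p H N) \<ge> 2"
proof -
  assume p: "p > 1"
  have "{0, 1} \<subseteq> inv_le p H N"
    using p by (auto simp: inv_le_def invariants_FV fixed_0 fixed_1 lookup_one when_def deg_le_def)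
  then have "card {0, 1 :: ('n, int) mpoly} \<le> card (inv_le p H N)"
    using p by (intro card_mono finite_inv_le) auto
  then show ?thesis by simp
qed

text \<open>
  Taking logarithms, \<open>step\<close> says that $\ln q$ grows at least by the factor $1+1/l$ over every \<open>D\<close>
  steps, whereas \<open>bound\<close> is polynomial in \<open>d\<close>.
\<close>

lemma super_polynomial_growth:
  fixes q :: "nat \<Rightarrow> nat"
  assumes q: "\<And>d. q d \<ge> 2" and bound: "\<And>d. q d \<le> p ^ ((d + 1) ^ n)"
    and step: "\<And>d. q d ^ (l + 1) \<le> q (d + D) ^ l" and l: "l > 0"
  shows False
proof -
  define a where "a = 1 + 1 / real l"
  have a: "a > 1" using l by (simp add: a_def)
  have q0: "real (q d) > 0" for d using q[of d] by simp
  have p0: "p > 0" using q[of 0] bound[of 0] by (cases "p = 0") auto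
  have grow: "a * ln (q d) \<le> ln (q (d + D))" for d
  proof -
    have "real (q d) ^ (l + 1) \<le> real (q (d + D)) ^ l" using step[of d] by (metis of_nat_le_iff of_nat_power)
    then have "ln (real (q d) ^ (l + 1)) \<le> ln (real (q (d + D)) ^ l)"
      using q0 by (subst ln_le_cancel_iff) auto
    then have "(real l + 1) * ln (q d) \<le> real l * ln (q (d + D))"
      unfolding ln_realpow by (simp add: add.commute)
    then have "(real l + 1) * ln (q d) / real l \<le> real l * ln (q (d + D)) / real l"
      by (intro divide_right_mono) simp_all
    moreover have "(real l + 1) * x / real l = a * x" for x :: real
      using l by (simp add: a_def distrib_right add_divide_distrib)
    moreover have "real l * x / real l = x" for x using l by simp
    ultimately show ?thesis by (simp only:)
  qed
  have lower: "a ^ k * ln 2 \<le> ln (q (k * D))" for k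
  proof (induction k)
    case 0
    show ?case using q[of 0] by simp
  next
    case (Suc k)
    have "a ^ Suc k * ln 2 = a * (a ^ k * ln 2)" by simp
    also have "\<dots> \<le> a * ln (q (k * D))" using Suc a by (intro mult_left_mono) auto
    also have "\<dots> \<le> ln (q (Suc k * D))" using grow[of "k * D"] by (simp add: add.commute)
    finally show ?case .
  qed
  have upper: "ln (q (k * D)) \<le> real ((k * D + 1) ^ n) * ln p" for k
  proof -
    have "real (q (k * D)) \<le> real p ^ ((k * D + 1) ^ n)" using bound[of "k * D"] by (metis of_nat_le_iff of_nat_power)
    then have "ln (q (k * D)) \<le> ln (real p ^ ((k * D + 1) ^ n))" using q0 p0 by (subst ln_le_cancel_iff) auto
    then show ?thesis using p0 by (simp add: ln_realpow)
  qed
  have "(\<lambda>k. real k ^ n * (1 / a) ^ k) \<longlonglongrightarrow> 0"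
    using a by real_asymp
  then have "(\<lambda>k. real ((D + 1) ^ n) * ln p * a * (real (Suc k) ^ n * (1 / a) ^ Suc k)) \<longlonglongrightarrow>
      real ((D + 1) ^ n) * ln p * a * 0"
    by (intro tendsto_mult tendsto_const LIMSEQ_Suc)
  then have "eventually (\<lambda>k. real ((D + 1) ^ n) * ln p * a * (real (Suc k) ^ n * (1 / a) ^ Suc k) < ln 2) sequentially"
    by (rule order_tendstoD) simp
  then obtain k where k: "real ((D + 1) ^ n) * ln p * a * (real (Suc k) ^ n * (1 / a) ^ Suc k) < ln 2"
    by (auto simp: eventually_sequentially)
  have "k * D + 1 \<le> (D + 1) * Suc k" by (simp add: algebra_simps)
  then have "real ((k * D + 1) ^ n) \<le> real (((D + 1) * Suc k) ^ n)" by (metis of_nat_le_iff power_mono zero_le)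
  then have "real ((k * D + 1) ^ n) * ln p \<le> real ((D + 1) ^ n) * real (Suc k) ^ n * ln p"
    using p0 by (intro mult_right_mono) (simp_all only: power_mult_distrib of_nat_mult of_nat_power, simp)
  then have "a ^ k * ln 2 \<le> real ((D + 1) ^ n) * real (Suc k) ^ n * ln p" using lower[of k] upper[of k] by linarith
  also have "\<dots> = a ^ k * (real ((D + 1) ^ n) * ln p * a * (real (Suc k) ^ n * (1 / a) ^ Suc k))"
    using a by (simp add: field_simps power_one_over)
  also have "\<dots> < a ^ k * ln 2" using k a by (intro mult_strict_left_mono) auto
  finally show False by simp
qed

section \<open>The rank of a free module of invariants\<close>

context young_setting
begin

text \<open>
  A \<open>G\<close>-invariant polynomial is determined by $\ell$ polynomials that are $\Sigma$-invariant: on every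
  $\Sigma$-orbit of monomials choose a representative \<open>r\<close>; every monomial of this orbit is in the
  \<open>G\<close>-orbit of some $\gamma_i$-translate of \<open>r\<close>, and the \<open>i\<close>-th polynomial records the
  coefficient of this translate on the whole orbit.
\<close>

lemma card_inv_le_G:
  assumes p: "p > 0"
  shows "card (inv_le p G N) \<le> card (inv_le p (Sig c) N) ^ CARD('l)"
proof -
  define orb where "orb m = {m'. \<exists>\<sigma>\<in>Sig c. m' = mkey \<sigma> m}" for m :: "'n \<Rightarrow>\<^sub>0 nat"
  define rep where "rep m = (SOME m'. m' \<in> orb m)" for m
  have orb_mkey: "orb (mkey \<sigma> m) = orb m" if \<sigma>: "\<sigma> \<in> Sig c" for \<sigma> m
  proof (intro equalityI subsetI)
    fix m' assume "m' \<in> orb (mkey \<sigma> m)"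
    then obtain \<tau> where "\<tau> \<in> Sig c" "m' = mkey \<tau> (mkey \<sigma> m)" by (auto simp: orb_def)
    then have "m' = mkey (\<sigma> \<circ> \<tau>) m"
      using mkey_comp[OF Sig_bij Sig_bij, OF _ \<sigma>] by metis
    then show "m' \<in> orb m" using \<sigma> \<open>\<tau> \<in> Sig c\<close> Sig_comp by (auto simp: orb_def)
  next
    fix m' assume "m' \<in> orb m"
    then obtain \<tau> where t: "\<tau> \<in> Sig c" "m' = mkey \<tau> m" by (auto simp: orb_def)
    have "mkey (inv_into UNIV \<sigma> \<circ> \<tau>) (mkey \<sigma> m) = mkey (\<sigma> \<circ> (inv_into UNIV \<sigma> \<circ> \<tau>)) m"
      using \<sigma> t by (intro mkey_comp) (auto intro: Sig_bij bij_comp bij_imp_bij_inv)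
    also have "\<sigma> \<circ> (inv_into UNIV \<sigma> \<circ> \<tau>) = \<tau>"
      using Sig_bij[OF \<sigma>] by (metis bij_is_surj comp_assoc id_comp surj_iff)
    finally have "m' = mkey (inv_into UNIV \<sigma> \<circ> \<tau>) (mkey \<sigma> m)" using t(2) by (simp only:)
    moreover have "inv_into UNIV \<sigma> \<circ> \<tau> \<in> Sig c" using \<sigma> t by (intro Sig_comp Sig_inv)
    ultimately show "m' \<in> orb (mkey \<sigma> m)" unfolding orb_def by blast
  qed
  have rep_mkey: "rep (mkey \<sigma> m) = rep m" if "\<sigma> \<in> Sig c" for \<sigma> m
    using orb_mkey[OF that] by (simp add: rep_def)
  have "m \<in> orb m" for m
    unfolding orb_def mem_Collect_eq by (rule bexI[OF _ Sig_id]) simp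
  then have rep_orb: "rep m \<in> orb m" for m unfolding rep_def by (rule someI)
  have deg_rep: "mono_degree (rep m) = mono_degree m" for m
    using rep_orb[of m] mono_degree_mkey[OF Sig_bij] by (auto simp: orb_def)
  have ex_rep: "\<exists>\<sigma>\<in>Sig c. m = mkey \<sigma> (rep m)" for m
  proof -
    obtain \<sigma> where "\<sigma> \<in> Sig c" "rep m = mkey \<sigma> m" using rep_orb[of m] by (auto simp: orb_def)
    then have "orb (rep m) = orb m" using orb_mkey by simp
    then have "m \<in> orb (rep m)" using \<open>m \<in> orb m\<close> by simp
    then show ?thesis by (auto simp: orb_def)
  qed
  define comp where "comp f i = Abs_poly_mapping (\<lambda>m. lookup f (mkey (\<gamma> i) (rep m)))"
    for f :: "('n, int) mpoly" and i
  have look: "lookup (comp f i) m = lookup f (mkey (\<gamma> i) (rep m))" if f: "f \<in> inv_le p G N" for f i m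
  proof -
    have "{m. lookup f (mkey (\<gamma> i) (rep m)) \<noteq> 0} \<subseteq> {m. mono_degree m \<le> N}"
    proof clarify
      fix m assume "lookup f (mkey (\<gamma> i) (rep m)) \<noteq> 0"
      then have "mono_degree (mkey (\<gamma> i) (rep m)) \<le> N"
        using f by (auto simp: inv_le_def deg_le_def in_keys_iff)
      then show "mono_degree m \<le> N" using Sig_bij[OF \<gamma>_Sig] by (simp add: mono_degree_mkey deg_rep)
    qed
    then have "finite {m. lookup f (mkey (\<gamma> i) (rep m)) \<noteq> 0}"
      using finite_mono_degree_le finite_subset by blast
    then show ?thesis by (simp add: comp_def)
  qed
  have comp_in: "comp f i \<in> inv_le p (Sig c) N" if f: "f \<in> inv_le p G N" for f i
  proof -
    have "act \<sigma> (comp f i) = comp f i" if "\<sigma> \<in> Sig c" for \<sigma>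
      by (rule poly_mapping_eqI) (use that f in \<open>simp add: lookup_act Sig_bij look rep_mkey\<close>)
    then have "comp f i \<in> fixed (Sig c)" by (simp add: fixed_def)
    moreover have "deg_le N (comp f i)"
      unfolding deg_le_def
    proof
      fix m assume "m \<in> keys (comp f i)"
      then have "mkey (\<gamma> i) (rep m) \<in> keys f" using f by (simp add: in_keys_iff look)
      then have "mono_degree (mkey (\<gamma> i) (rep m)) \<le> N" using f by (auto simp: inv_le_def deg_le_def)
      then show "mono_degree m \<le> N" using Sig_bij[OF \<gamma>_Sig] by (simp add: mono_degree_mkey deg_rep)
    qed
    ultimately show ?thesis using f by (simp add: inv_le_def invariants_FV look)
  qed
  have inj: "inj_on (\<lambda>f. restrict (comp f) UNIV) (inv_le p G N)"
  proof (rule inj_onI, rule poly_mapping_eqI)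
    fix f f' m
    assume f: "f \<in> inv_le p G N" and f': "f' \<in> inv_le p G N"
      and e: "restrict (comp f) UNIV = restrict (comp f') UNIV"
    obtain \<sigma> where \<sigma>: "\<sigma> \<in> Sig c" "m = mkey \<sigma> (rep m)" using ex_rep by blast
    obtain i g where ig: "g \<in> G" "\<sigma> = \<gamma> i \<circ> g" using coset_exists[OF \<sigma>(1)] by blast
    have m: "m = mkey g (mkey (\<gamma> i) (rep m))"
      using \<sigma>(2) ig G.bij Sig_bij[OF \<gamma>_Sig] by (simp add: mkey_comp)
    have val: "lookup h m = lookup (comp h i) m" if h: "h \<in> inv_le p G N" for h
    proof -
      have "act g h = h" using h ig(1) by (simp add: inv_le_def invariants_FV fixed_def)
      then have "lookup h (mkey g (mkey (\<gamma> i) (rep m))) = lookup h (mkey (\<gamma> i) (rep m))"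
        using lookup_act[OF G.bij[OF ig(1)], of h "mkey (\<gamma> i) (rep m)"] by simp
      then show ?thesis using m by (simp add: look[OF h])
    qed
    show "lookup f m = lookup f' m"
      using val[OF f] val[OF f'] fun_cong[OF e, of i] by simp
  qed
  have sub: "(\<lambda>f. restrict (comp f) UNIV) ` inv_le p G N \<subseteq> Pi\<^sub>E UNIV (\<lambda>_::'l. inv_le p (Sig c) N)"
    using comp_in by auto
  have "card (inv_le p G N) \<le> card (Pi\<^sub>E UNIV (\<lambda>_::'l. inv_le p (Sig c) N))"
    using inj sub by (rule card_inj_on_le) (simp add: finite_PiE finite_inv_le p)
  then show ?thesis by (simp add: card_PiE)
qed

text \<open>
  With $q(d)$ the number of $\Sigma$-invariants modulo \<open>p\<close> of degree at most \<open>d\<close>, any \<open>b\<close> basis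
  elements of degree at most \<open>D\<close> yield $q(d)^b$ distinct \<open>G\<close>-invariants of degree at most
  $d+D$, of which there are at most $q(d+D)^\ell$ (\<open>card_inv_le_G\<close>).  Because \<open>B\<close> may be
  inhomogeneous, degrees are only compared up to the bounded shift \<open>D\<close>.
\<close>

lemma basis_finite_rank:
  assumes p: "Factorial_Ring.prime p"
    and basis: "module_basis (FV p) (invariants (FV p) (Sig c)) (invariants (FV p) G) B (\<lambda>b. b)"
  shows "finite B \<and> card B \<le> CARD('l)"
proof -
  have p0: "p > 0" "p > 1" using p prime_gt_1_nat prime_gt_0_nat by auto
  have BM: "B \<subseteq> invariants (FV p) G" and uniq: "\<And>x. x \<in> invariants (FV p) G \<Longrightarrow>
    \<exists>!k. k \<in> coeff_families (FV p) (invariants (FV p) (Sig c)) B \<and> x = lin_comb (FV p) (\<lambda>b. b) k"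
    using basis by (auto simp: module_basis_def)
  have "card B' \<le> CARD('l)" if B': "B' \<subseteq> B" "finite B'" for B'
  proof (rule ccontr)
    assume large: "\<not> card B' \<le> CARD('l)"
    have "\<exists>D. \<forall>b\<in>B'. deg_le D b"
      using B'(2)
    proof (induction B' rule: finite_induct)
      case (insert x F)
      then obtain D where "\<forall>b\<in>F. deg_le D b" by blast
      moreover obtain E where "deg_le E x" using ex_degree_bound[of x] by (auto simp: deg_le_def)
      ultimately have "\<forall>b\<in>insert x F. deg_le (max D E) b" by (fastforce simp: deg_le_def)
      then show ?case by blast
    qed simp
    then obtain D where D: "\<forall>b\<in>B'. deg_le D b" by blast
    let ?q = "\<lambda>d. card (inv_le p (Sig c) d)"
    let ?f = "\<lambda>k. red p (\<Sum>b\<in>B'. k b * b)"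
    have step: "?q d ^ card B' \<le> ?q (d + D) ^ CARD('l)" for d
    proof -
      let ?P = "Pi\<^sub>E B' (\<lambda>_. inv_le p (Sig c) d)"
      have img: "?f k \<in> inv_le p G (d + D)" if k: "k \<in> ?P" for k
      proof -
        have "(\<Sum>b\<in>B'. k b * b) \<in> fixed G"
          using k B'(1) BM fixed_Sig_subset
          by (intro G.fixed_sum G.fixed_mult) (auto simp: inv_le_def invariants_FV PiE_def Pi_def)
        moreover have "deg_le (d + D) (\<Sum>b\<in>B'. k b * b)"
          using k D by (intro deg_le_sum deg_le_mult) (auto simp: inv_le_def PiE_def Pi_def)
        ultimately show ?thesis using p0 by (simp add: inv_le_def G.red_in_invariants deg_le_red)
      qed
      have "inj_on ?f ?P"
      proof (rule inj_onI)
        fix k k' assume k: "k \<in> ?P" and k': "k' \<in> ?P" and e: "?f k = ?f k'"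
        let ?e = "\<lambda>k b. if b \<in> B' then k b else 0"
        have fam: "?e k \<in> coeff_families (FV p) (invariants (FV p) (Sig c)) B"
          and lin: "?f k = lin_comb (FV p) (\<lambda>b. b) (?e k)" if k: "k \<in> ?P" for k
        proof -
          have sub: "{i. ?e k i \<noteq> 0} \<subseteq> B'" by auto
          have "0 \<in> invariants (FV p) (Sig c)" using p0 by (simp add: invariants_FV Sig.fixed_0)
          then show "?e k \<in> coeff_families (FV p) (invariants (FV p) (Sig c)) B"
            using k B' finite_subset[OF sub B'(2)]
            by (auto simp: coeff_families_def FV_def inv_le_def PiE_def Pi_def)
          show "?f k = lin_comb (FV p) (\<lambda>b. b) (?e k)"
            unfolding lin_comb_FV[OF p B'(2) sub] by (intro arg_cong[of _ _ "red p"] sum.cong) auto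
        qed
        have "?f k \<in> invariants (FV p) G" using img[OF k] by (simp add: inv_le_def)
        from ex1_unique[OF uniq[OF this]] have "?e k = ?e k'"
          using fam[OF k] fam[OF k'] lin[OF k] lin[OF k', folded e] by blast
        then have "k b = k' b" if "b \<in> B'" for b using fun_cong[of "?e k" "?e k'" b] that by simp
        then show "k = k'" using k k' by (intro PiE_ext)
      qed
      moreover have "?f ` ?P \<subseteq> inv_le p G (d + D)" using img by blast
      ultimately have "card ?P \<le> card (inv_le p G (d + D))"
        using finite_inv_le[OF p0(1)] by (rule card_inj_on_le)
      also have "\<dots> \<le> ?q (d + D) ^ CARD('l)" by (rule card_inv_le_G[OF p0(1)])
      finally show ?thesis using B'(2) by (simp add: card_PiE)
    qed
    show False
    proof (rule super_polynomial_growth)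
      show "?q d \<ge> 2" for d using p0(2) by (rule Sig.card_inv_le_ge_2)
      show "?q d \<le> p ^ ((d + 1) ^ CARD('n))" for d using p0(1) by (rule card_inv_le)
      show "?q d ^ (CARD('l) + 1) \<le> ?q (d + D) ^ CARD('l)" for d
      proof -
        have "?q d ^ (CARD('l) + 1) \<le> ?q d ^ card B'"
          using large Sig.card_inv_le_ge_2[OF p0(2), where N = d and c = c] by (intro power_increasing) auto
        then show ?thesis using step[of d] by linarith
      qed
    qed simp
  qed
  then show ?thesis using finite_if_finite_subsets_card_bdd[of B "CARD('l)"] by blast
qed

end

lemma span_image_coeffs:
  fixes e :: "'b \<Rightarrow> 'v::real_vector"
  assumes T: "finite T" and v: "v \<in> span (e ` T)"
  obtains r where "v = (\<Sum>t\<in>T. r t *\<^sub>R e t)"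
proof -
  let ?V = "range (\<lambda>r. \<Sum>t\<in>T. r t *\<^sub>R e t)"
  have "e ` T \<subseteq> ?V"
  proof (rule image_subsetI)
    fix t assume t: "t \<in> T"
    have "e t = (\<Sum>s\<in>T. (if s = t then 1 else 0) *\<^sub>R e s)"
      using T t by (simp add: if_distrib[of "\<lambda>x. x *\<^sub>R _"] cong: if_cong)
    then show "e t \<in> ?V" by (rule image_eqI[where x = "\<lambda>s. if s = t then 1 else 0"]) simp
  qed
  moreover have "subspace ?V"
  proof (rule subspaceI)
    show "0 \<in> ?V" by (rule image_eqI[where x = "\<lambda>_. 0"]) simp_all
  next
    fix x y assume "x \<in> ?V" "y \<in> ?V"
    then obtain r r' where "x = (\<Sum>t\<in>T. r t *\<^sub>R e t)" "y = (\<Sum>t\<in>T. r' t *\<^sub>R e t)" by blast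
    then have "x + y = (\<Sum>t\<in>T. (r t + r' t) *\<^sub>R e t)" by (simp add: scaleR_left_distrib sum.distrib)
    then show "x + y \<in> ?V" by (rule image_eqI[where x = "\<lambda>t. r t + r' t"]) simp
  next
    fix a x assume "x \<in> ?V"
    then obtain r where "x = (\<Sum>t\<in>T. r t *\<^sub>R e t)" by blast
    then have "a *\<^sub>R x = (\<Sum>t\<in>T. (a * r t) *\<^sub>R e t)" by (simp add: scaleR_sum_right)
    then show "a *\<^sub>R x \<in> ?V" by (rule image_eqI[where x = "\<lambda>t. a * r t"]) simp
  qed
  ultimately have "span (e ` T) \<subseteq> ?V" by (rule span_minimal)
  then show thesis using v that by blast
qed

lemma aug_sum: "(\<And>i. i \<in> I \<Longrightarrow> f i \<in> aug c M d) \<Longrightarrow> (\<Sum>i\<in>I. f i) \<in> aug c M d"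
  by (induction I rule: infinite_finite_induct) (auto intro: aug_add aug.zero)

text \<open>
  The properties of the output collected in \<open>algorithm_output_graded_basis\<close>.
\<close>

locale graded_basis = young_setting c G \<gamma> \<omega> z
  for c :: "'n::finite \<Rightarrow> nat"
    and G :: "('n \<Rightarrow> 'n) set"
    and \<gamma> :: "'l::finite \<Rightarrow> 'n \<Rightarrow> 'n"
    and \<omega> :: "('n, int) mpoly"
    and z :: "'n \<Rightarrow> int" +
  fixes \<Theta> :: "('n, int) mpoly set"
  assumes finite_\<Theta>: "finite \<Theta>" and \<Theta>_fixed: "\<Theta> \<subseteq> fixed G"
    and \<Theta>_homogeneous: "\<And>\<theta>. \<theta> \<in> \<Theta> \<Longrightarrow> \<exists>d. homogeneous d \<theta>"
    and \<Theta>_combination: "\<And>f d. f \<in> fixed G \<Longrightarrow> homogeneous d f \<Longrightarrow>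
      \<exists>k :: _ \<Rightarrow> int. ep d (resZ f) =
        (\<Sum>\<theta>\<in>{\<theta> \<in> \<Theta>. homogeneous d \<theta>}. real_of_int (k \<theta>) *\<^sub>R ep d (resZ \<theta>))"
    and \<Theta>_independent: "\<And>d r \<theta>. (\<Sum>\<theta>\<in>{\<theta> \<in> \<Theta>. homogeneous d \<theta>}. r \<theta> *\<^sub>R ep d (resZ \<theta>)) = 0 \<Longrightarrow>
      \<theta> \<in> \<Theta> \<Longrightarrow> homogeneous d \<theta> \<Longrightarrow> r \<theta> = 0"
begin

abbreviation part :: "nat \<Rightarrow> ('n, int) mpoly set" where
  "part d \<equiv> {\<theta> \<in> \<Theta>. homogeneous d \<theta>}"

lemma const_mult_part:
  assumes "\<theta> \<in> \<Theta>"
  shows "hcomp d (single 0 a * \<theta>) = (if homogeneous d \<theta> then single 0 a * \<theta> else 0)"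
proof -
  obtain e where e: "homogeneous e \<theta>" using \<Theta>_homogeneous[OF assms] by blast
  have "homogeneous e (single 0 a * \<theta>)" using homogeneous_mult[OF homogeneous_const e, of a] by simp
  then have "hcomp d (single 0 a * \<theta>) = (if d = e then single 0 a * \<theta> else 0)"
    by (rule hcomp_of_homogeneous)
  moreover have "\<theta> = 0" if "homogeneous d \<theta>" "d \<noteq> e"
    using homogeneous_degree_unique[OF that(1) e] that(2) by blast
  ultimately show ?thesis using e by auto
qed

lemma resZ_const_mult: "resZ (single 0 a * f) = real_of_int a *\<^sub>R resZ f"
  using resZ_mult[OF Sig.fixed_const, of a f] by (simp add: eval_const del: single_of_int)

section \<open>Generation over the rationals\<close>

text \<open>
  Subtracting the combination of elements of \<open>\<Theta>\<close> that has the same image under $\varepsilon_d$.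
\<close>

lemma subtract_leading_part:
  assumes f: "f \<in> fixed G" "homogeneous d f"
  obtains k where "f - (\<Sum>\<theta>\<in>part d. single 0 (k \<theta>) * \<theta>) \<in> fixed G"
    "homogeneous d (f - (\<Sum>\<theta>\<in>part d. single 0 (k \<theta>) * \<theta>))"
    "resZ (f - (\<Sum>\<theta>\<in>part d. single 0 (k \<theta>) * \<theta>)) \<in> res_lower d"
proof -
  obtain k :: "_ \<Rightarrow> int" where
    k: "ep d (resZ f) = (\<Sum>\<theta>\<in>part d. real_of_int (k \<theta>) *\<^sub>R ep d (resZ \<theta>))"
    using \<Theta>_combination[OF f] by blast
  let ?g = "\<Sum>\<theta>\<in>part d. single 0 (k \<theta>) * \<theta>"
  have fixd: "f - ?g \<in> fixed G"
    using \<Theta>_fixed f by (intro G.fixed_diff G.fixed_sum G.fixed_mult G.fixed_const) auto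
  have "homogeneous (0 + d) (single 0 (k \<theta>) * \<theta>)" if "\<theta> \<in> part d" for \<theta>
    using that by (intro homogeneous_mult homogeneous_const) simp
  then have hom: "homogeneous d (f - ?g)"
    using f by (intro homogeneous_diff homogeneous_sum) auto
  have "ep d (resZ (f - ?g)) = 0"
    unfolding resZ_diff resZ_sum resZ_const_mult
    by (simp add: linear_diff[OF linear_ep] linear_sum[OF linear_ep] linear_scale[OF linear_ep] k)
  moreover have "resZ (f - ?g) \<in> span (res_lattice d)"
    using fixd hom by (intro span_base) (simp add: res_lattice_def)
  ultimately have "resZ (f - ?g) \<in> res_lower d" using diff_ep_res_lower by fastforce
  then show thesis using that[of k] fixd hom by blast
qed

lemma rationally_spanned_\<Theta>:
  "f \<in> fixed G \<Longrightarrow> homogeneous d f \<Longrightarrow> rationally_spanned \<Theta> f"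
proof (induction d arbitrary: f rule: less_induct)
  case (less d)
  obtain k where k: "f - (\<Sum>\<theta>\<in>part d. single 0 (k \<theta>) * \<theta>) \<in> fixed G"
    "homogeneous d (f - (\<Sum>\<theta>\<in>part d. single 0 (k \<theta>) * \<theta>))"
    "resZ (f - (\<Sum>\<theta>\<in>part d. single 0 (k \<theta>) * \<theta>)) \<in> res_lower d"
    using subtract_leading_part[OF less.prems] .
  let ?g = "\<Sum>\<theta>\<in>part d. single 0 (k \<theta>) * \<theta>"
  have "of_nat (card G) * (f - ?g) \<in> aug c (fixed G) d"
    using k by (rule kernel_of_graded_restriction)
  then have "rationally_spanned \<Theta> (of_nat (card G) * (f - ?g))"
    using less.IH by (rule rationally_spanned_aug)
  then have "rationally_spanned \<Theta> (of_int (int (card G)) * (f - ?g))" by simp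
  then have "rationally_spanned \<Theta> (f - ?g)"
    by (rule rationally_spanned_divide[rotated]) (use card_G_pos in simp)
  moreover have "rationally_spanned \<Theta> ?g"
    by (intro rationally_spanned_smod smod_sum smod_gen Sig.fixed_const) simp
  ultimately have "rationally_spanned \<Theta> ((f - ?g) + ?g)" by (rule rationally_spanned_add)
  then show ?case by simp
qed

lemma genQ_\<Theta>: "genQ (coeff_of_int ` \<Theta>)"
  using \<Theta>_fixed rationally_spanned_\<Theta> by (rule genQ_if_rationally_spanned)

text \<open>
  Minimality: if $\theta\in\Theta$ of degree \<open>d\<close> were a combination of other elements, then
  $\varepsilon_d$, which kills everything of smaller degree, would give a linear relation between the
  images of the elements of degree \<open>d\<close>.
\<close>

lemma secondaries_\<Theta>: "secondaries c G (coeff_of_int ` \<Theta>)"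
proof -
  have hom: "\<exists>d. homogeneous d \<theta>" if "\<theta> \<in> coeff_of_int ` \<Theta>" for \<theta> :: "('n, rat) mpoly"
    using that \<Theta>_homogeneous by (auto simp: homogeneous_coeff_of_int)
  have "\<not> genQ \<Theta>'" if \<Theta>': "\<Theta>' \<subset> coeff_of_int ` \<Theta>" for \<Theta>'
  proof
    assume gen: "genQ \<Theta>'"
    obtain \<theta> where \<theta>: "\<theta> \<in> \<Theta>" "coeff_of_int \<theta> \<notin> \<Theta>'" using \<Theta>' by blast
    obtain d where d: "homogeneous d \<theta>" using \<Theta>_homogeneous[OF \<theta>(1)] by blast
    let ?e = "\<lambda>\<theta>. ep d (resZ \<theta>)" and ?T = "part d - {\<theta>}"
    let ?V = "{v. ep d v \<in> span (?e ` ?T)}"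
    have sub: "subspace ?V"
      by (rule subspaceI)
         (simp_all add: linear_0[OF linear_ep] linear_add[OF linear_ep] linear_scale[OF linear_ep]
           span_0 span_add span_scale)
    have "resQ ` {b \<in> \<Theta>'. \<exists>e\<le>d. homogeneous e b} \<subseteq> ?V"
    proof clarify
      fix b e assume b: "b \<in> \<Theta>'" "e \<le> d" "homogeneous e b"
      obtain \<theta>' where \<theta>': "\<theta>' \<in> \<Theta>" "b = coeff_of_int \<theta>'" using b(1) \<Theta>' by blast
      have hom': "homogeneous e \<theta>'" using b(3) \<theta>'(2) by (simp add: homogeneous_coeff_of_int)
      show "ep d (resQ b) \<in> span (?e ` ?T)"
      proof (cases "e = d")
        case True
        then have "\<theta>' \<in> ?T" using \<theta>' \<theta>(2) b(1) hom' by auto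
        then show ?thesis unfolding \<theta>'(2) resQ_coeff_of_int by (intro span_base imageI)
      next
        case False
        then have "resZ \<theta>' \<in> res_lower d"
          using res_lattice_in_lower[of e d] b(2) \<theta>'(1) hom' \<Theta>_fixed span_base[of "resZ \<theta>'" "res_lattice e"]
          by (auto simp: res_lattice_def)
        then show ?thesis unfolding \<theta>'(2) resQ_coeff_of_int by (simp add: ep_res_lower span_0)
      qed
    qed
    then have "span (resQ ` {b \<in> \<Theta>'. \<exists>e\<le>d. homogeneous e b}) \<subseteq> ?V" using sub by (rule span_minimal)
    moreover have "\<forall>b\<in>\<Theta>'. \<exists>d. homogeneous d b" using hom \<Theta>' by blast
    ultimately have "resZ \<theta> \<in> ?V"
      using resZ_span_generators[OF gen _ _ d] \<theta>(1) \<Theta>_fixed by blast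
    then have "?e \<theta> \<in> span (?e ` ?T)" by simp
    then obtain r where r: "?e \<theta> = (\<Sum>t\<in>?T. r t *\<^sub>R ?e t)"
      using span_image_coeffs[of ?T] finite_\<Theta> by auto
    let ?r = "\<lambda>t. if t = \<theta> then -1 else r t"
    have "(\<Sum>t\<in>part d. ?r t *\<^sub>R ?e t) = - ?e \<theta> + (\<Sum>t\<in>?T. r t *\<^sub>R ?e t)"
      using finite_\<Theta> \<theta>(1) d by (subst sum.remove[of _ \<theta>]) auto
    then have "(\<Sum>t\<in>part d. ?r t *\<^sub>R ?e t) = 0" using r by simp
    then have "?r \<theta> = 0" using \<theta>(1) d by (rule \<Theta>_independent)
    then show False by simp
  qed
  then show ?thesis unfolding secondaries_iff using hom genQ_\<Theta> by blast
qed

text \<open>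
  Restrictions of generators span all functions on the $\ell$ points of \<open>X\<close>.
\<close>

lemma card_\<Theta>_ge: "CARD('l) \<le> card \<Theta>"
proof -
  have smod: "resZ x \<in> span (resZ ` \<Theta>)" if "x \<in> smod (fixed (Sig c)) \<Theta>" for x
    using that
  proof induction
    case (step x s b)
    then show ?case by (simp add: resZ_add resZ_mult span_add span_scale span_base)
  qed (simp add: span_0)
  have "res_lattice d \<subseteq> span (resZ ` \<Theta>)" for d
  proof
    fix v assume "v \<in> res_lattice d"
    then obtain f where f: "v = resZ f" "f \<in> fixed G" "homogeneous d f" by (auto simp: res_lattice_def)
    obtain N where N: "N > 0" "of_int N * f \<in> smod (fixed (Sig c)) \<Theta>"
      using rationally_spanned_\<Theta>[OF f(2,3)] by (auto simp: rationally_spanned_def)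
    have "resZ (of_int N * f) = real_of_int N *\<^sub>R v"
      using resZ_const_mult[of N f] f(1) by (simp flip: single_of_int)
    then have "(1 / real_of_int N) *\<^sub>R (real_of_int N *\<^sub>R v) \<in> span (resZ ` \<Theta>)"
      using smod[OF N(2)] by (simp only: span_scale)
    then show "v \<in> span (resZ ` \<Theta>)" using N(1) by simp
  qed
  then have "span (\<Union>d. res_lattice d) \<subseteq> span (resZ ` \<Theta>)" by (intro span_minimal) auto
  then have "(UNIV :: (real ^ 'l) set) \<subseteq> span (resZ ` \<Theta>)" using res_lattice_span_all by blast
  then have "dim (UNIV :: (real ^ 'l) set) \<le> card (resZ ` \<Theta>)"
    using finite_\<Theta> by (intro dim_le_card) auto
  also have "\<dots> \<le> card \<Theta>" using finite_\<Theta> by (rule card_image_le)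
  finally show ?thesis by simp
qed

section \<open>Independence modulo a prime\<close>

text \<open>
  The ideal $S_+$ of \<open>S\<close>; its elements are those with vanishing constant term.
\<close>

definition Splus :: "('n, int) mpoly set" where
  "Splus = {s \<in> fixed (Sig c). lookup s 0 = 0}"

lemma hcomp_Splus:
  assumes "x \<in> smod Splus (fixed G)"
  shows "hcomp d x \<in> aug c (fixed G) d"
  using assms
proof induction
  case zero
  show ?case by (simp add: aug.zero)
next
  case (step x s h)
  have s: "s \<in> fixed (Sig c)" "lookup s 0 = 0" using step by (auto simp: Splus_def)
  obtain D where D: "\<forall>m\<in>keys h. mono_degree m \<le> D" using ex_degree_bound by blast
  have "hcomp d (s * hcomp k h) \<in> aug c (fixed G) d" for k
  proof (cases "k < d")
    case True
    have "0 + hcomp (d - k) s * hcomp k h \<in> aug c (fixed G) d"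
      using True step s
      by (intro aug.step[where e = "d - k" and e' = k] aug.zero Sig.fixed_hcomp G.fixed_hcomp
          hcomp_homogeneous) auto
    then show ?thesis using True by (simp add: hcomp_mult_homogeneous[OF hcomp_homogeneous])
  next
    case False
    have "hcomp 0 s = 0"
      by (rule poly_mapping_eqI) (simp add: lookup_restrict_monos when_def s)
    then show ?thesis using False
      by (cases "k = d") (simp_all add: hcomp_mult_homogeneous[OF hcomp_homogeneous] aug.zero)
  qed
  then have "(\<Sum>k\<le>D. hcomp d (s * hcomp k h)) \<in> aug c (fixed G) d" by (rule aug_sum)
  moreover have "hcomp d (s * h) = (\<Sum>k\<le>D. hcomp d (s * hcomp k h))"
    by (subst sum_hcomp[OF D]) (simp add: sum_distrib_left restrict_monos_sum)
  ultimately show ?case using step by (simp add: restrict_monos_add aug_add)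
qed

text \<open>
  This is where lattice bases matter: in degree \<open>d\<close> the map $\varepsilon_d$ kills \<open>x\<close> and sends
  $h$ to an integral combination of the images of the $\theta$; comparing coefficients shows that the
  coefficients $a_\theta$ are multiples of \<open>p\<close>.
\<close>

lemma independent_mod:
  assumes eq: "(\<Sum>\<theta>\<in>\<Theta>. single 0 (a \<theta>) * \<theta>) = x + of_int p * h"
    and x: "x \<in> smod Splus (fixed G)" and h: "h \<in> fixed G" and \<theta>: "\<theta> \<in> \<Theta>"
  shows "p dvd a \<theta>"
proof -
  obtain d where d: "homogeneous d \<theta>" using \<Theta>_homogeneous[OF \<theta>] by blast
  obtain k :: "_ \<Rightarrow> int" where
    k: "ep d (resZ (hcomp d h)) = (\<Sum>\<theta>\<in>part d. real_of_int (k \<theta>) *\<^sub>R ep d (resZ \<theta>))"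
    using \<Theta>_combination[OF G.fixed_hcomp[OF h] hcomp_homogeneous] by blast
  have "hcomp d (\<Sum>\<theta>\<in>\<Theta>. single 0 (a \<theta>) * \<theta>) = (\<Sum>\<theta>\<in>part d. single 0 (a \<theta>) * \<theta>)"
    using finite_\<Theta> by (simp add: restrict_monos_sum const_mult_part sum.inter_filter cong: sum.cong)
  moreover have "hcomp d (of_int p * h) = single 0 p * hcomp d h"
    by (rule poly_mapping_eqI) (simp add: lookup_restrict_monos lookup_of_int_mult lookup_const_mult when_def del: single_of_int)
  ultimately have "(\<Sum>\<theta>\<in>part d. single 0 (a \<theta>) * \<theta>) = hcomp d x + single 0 p * hcomp d h"
    using arg_cong[OF eq, of "hcomp d"] by (simp add: restrict_monos_add)
  then have "ep d (resZ (\<Sum>\<theta>\<in>part d. single 0 (a \<theta>) * \<theta>)) = ep d (resZ (hcomp d x + single 0 p * hcomp d h))"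
    by (simp only:)
  then have "(\<Sum>\<theta>\<in>part d. real_of_int (a \<theta>) *\<^sub>R ep d (resZ \<theta>)) =
      ep d (resZ (hcomp d x)) + real_of_int p *\<^sub>R ep d (resZ (hcomp d h))"
    unfolding resZ_add resZ_sum resZ_const_mult
    by (simp add: linear_add[OF linear_ep] linear_sum[OF linear_ep] linear_scale[OF linear_ep])
  also have "ep d (resZ (hcomp d x)) = 0"
    using x by (intro ep_res_lower resZ_aug hcomp_Splus)
  finally have "(\<Sum>\<theta>\<in>part d. (real_of_int (a \<theta>) - real_of_int p * real_of_int (k \<theta>)) *\<^sub>R ep d (resZ \<theta>)) = 0"
    unfolding k by (simp add: scaleR_diff_left sum_subtractf scaleR_sum_right)
  then have "real_of_int (a \<theta>) - real_of_int p * real_of_int (k \<theta>) = 0"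
    using \<theta> d by (rule \<Theta>_independent)
  then have "real_of_int (a \<theta>) = real_of_int (p * k \<theta>)" by simp
  then show ?thesis by (metis dvd_triv_left of_int_eq_iff)
qed

end

section \<open>Cohen-Macaulay reductions\<close>

locale cm_reduction = graded_basis c G \<gamma> \<omega> z \<Theta>
  for c :: "'n::finite \<Rightarrow> nat"
    and G :: "('n \<Rightarrow> 'n) set"
    and \<gamma> :: "'l::finite \<Rightarrow> 'n \<Rightarrow> 'n"
    and \<omega> :: "('n, int) mpoly"
    and z :: "'n \<Rightarrow> int"
    and \<Theta> :: "('n, int) mpoly set" +
  fixes p :: nat and B :: "('n, int) mpoly set"
  assumes p: "Factorial_Ring.prime p"
    and basis: "module_basis (FV p) (invariants (FV p) (Sig c)) (invariants (FV p) G) B (\<lambda>b. b)"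
begin

lemma p0: "p > 0" "p > 1"
  using p prime_gt_1_nat prime_gt_0_nat by auto

lemma finite_B: "finite B" and card_B: "card B \<le> CARD('l)"
  using basis_finite_rank[OF p basis] by auto

lemma B_fixed: "b \<in> B \<Longrightarrow> b \<in> fixed G"
  using basis by (auto simp: module_basis_def invariants_FV)

text \<open>
  Coordinates with respect to \<open>B\<close>, kept as integer polynomials which matter only modulo \<open>p\<close>.
\<close>

definition represents :: "('n, int) mpoly \<Rightarrow> (('n, int) mpoly \<Rightarrow> ('n, int) mpoly) \<Rightarrow> bool" where
  "represents f k \<longleftrightarrow> (\<forall>b\<in>B. k b \<in> fixed (Sig c)) \<and> red p f = red p (\<Sum>b\<in>B. k b * b)"

lemma represents_exists:
  assumes f: "f \<in> fixed G"
  shows "\<exists>k. represents f k"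
proof -
  have "red p f \<in> invariants (FV p) G" using f by (rule G.red_in_invariants[OF p0(1)])
  then obtain k where k: "k \<in> coeff_families (FV p) (invariants (FV p) (Sig c)) B"
    "red p f = lin_comb (FV p) (\<lambda>b. b) k"
    using basis by (auto simp: module_basis_def)
  have supp: "{i. k i \<noteq> 0} \<subseteq> B" using k(1) by (auto simp: coeff_families_def FV_def)
  have "k b \<in> fixed (Sig c)" if "b \<in> B" for b
    using k(1) that by (auto simp: coeff_families_def invariants_FV)
  then show ?thesis using k(2) lin_comb_FV[OF p finite_B supp] by (auto simp: represents_def)
qed

lemma represents_unique:
  assumes f: "f \<in> fixed G" and k: "represents f k" and k': "represents f k'" and b: "b \<in> B"
  shows "red p (k b) = red p (k' b)"
proof -
  let ?e = "\<lambda>k b. if b \<in> B then red p (k b) else 0"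
  have e: "?e k \<in> coeff_families (FV p) (invariants (FV p) (Sig c)) B \<and>
      red p f = lin_comb (FV p) (\<lambda>b. b) (?e k)" if k: "represents f k" for k
  proof
    have supp: "{i. ?e k i \<noteq> 0} \<subseteq> B" by auto
    then show "?e k \<in> coeff_families (FV p) (invariants (FV p) (Sig c)) B"
      using k finite_subset[OF supp finite_B] Sig.red_in_invariants[OF p0(1)]
      by (auto simp: coeff_families_def FV_def represents_def)
    have "lin_comb (FV p) (\<lambda>b. b) (?e k) = red p (\<Sum>b\<in>B. ?e k b * b)"
      by (rule lin_comb_FV[OF p finite_B supp])
    also have "\<dots> = red p (\<Sum>b\<in>B. k b * b)"
      by (intro red_cong_sum red_cong_mult) simp_all
    finally show "red p f = lin_comb (FV p) (\<lambda>b. b) (?e k)" using k by (simp add: represents_def)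
  qed
  have "red p f \<in> invariants (FV p) G" using f by (rule G.red_in_invariants[OF p0(1)])
  then have "\<exists>!k. k \<in> coeff_families (FV p) (invariants (FV p) (Sig c)) B \<and>
      red p f = lin_comb (FV p) (\<lambda>b. b) k"
    using basis by (simp add: module_basis_def)
  from ex1_unique[OF this] have "?e k = ?e k'" using e[OF k] e[OF k'] by blast
  then have "?e k b = ?e k' b" by (rule fun_cong)
  then show ?thesis using b by simp
qed

definition coord :: "('n, int) mpoly \<Rightarrow> ('n, int) mpoly \<Rightarrow> ('n, int) mpoly" where
  "coord f = (SOME k. represents f k)"

lemma represents_coord: "f \<in> fixed G \<Longrightarrow> represents f (coord f)"
  unfolding coord_def using represents_exists by (rule someI_ex)

lemma coord_fixed: "f \<in> fixed G \<Longrightarrow> b \<in> B \<Longrightarrow> coord f b \<in> fixed (Sig c)"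
  using represents_coord by (auto simp: represents_def)

lemma red_coord:
  "f \<in> fixed G \<Longrightarrow> represents f k \<Longrightarrow> b \<in> B \<Longrightarrow> red p (coord f b) = red p (k b)"
  using represents_unique represents_coord by blast

abbreviation comb :: "(('n, int) mpoly \<Rightarrow> ('n, int) mpoly) \<Rightarrow> ('n, int) mpoly" where
  "comb s \<equiv> \<Sum>\<theta>\<in>\<Theta>. s \<theta> * \<theta>"

lemma comb_fixed: "(\<And>\<theta>. \<theta> \<in> \<Theta> \<Longrightarrow> s \<theta> \<in> fixed (Sig c)) \<Longrightarrow> comb s \<in> fixed G"
  using \<Theta>_fixed fixed_Sig_subset by (intro G.fixed_sum G.fixed_mult) auto

text \<open>
  The coordinates of \<open>f\<close> with respect to \<open>B\<close>, modulo \<open>p\<close> and modulo terms of degree above \<open>N\<close>.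
  They take values in a finite set, so that injectivity and surjectivity can be compared by counting.
  For $N=0$ only the constant terms are left, and the kernel is $S_+A+pA$.
\<close>

definition low_coord :: "nat \<Rightarrow> ('n, int) mpoly \<Rightarrow> ('n, int) mpoly \<Rightarrow> ('n, int) mpoly" where
  "low_coord N f = restrict (\<lambda>b. red p (trunc N (coord f b))) B"

lemma trunc_cong: "red p f = red p g \<Longrightarrow> red p (trunc N f) = red p (trunc N g)"
  by (simp flip: restrict_monos_red)

lemma low_coord_eqI:
  assumes "f \<in> fixed G" "represents f k" "\<And>b. b \<in> B \<Longrightarrow> red p (trunc N (k b)) = u b"
  shows "low_coord N f = restrict u B"
  unfolding low_coord_def
proof (rule restrict_ext)
  fix b assume b: "b \<in> B"
  show "red p (trunc N (coord f b)) = u b"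
    using trunc_cong[OF red_coord[OF assms(1,2) b]] assms(3)[OF b] by simp
qed

lemma low_coord_apply: "b \<in> B \<Longrightarrow> low_coord N f b = red p (trunc N (coord f b))"
  by (simp add: low_coord_def)

abbreviation box :: "'i set \<Rightarrow> nat \<Rightarrow> ('i \<Rightarrow> ('n, int) mpoly) set" where
  "box A N \<equiv> Pi\<^sub>E A (\<lambda>_. inv_le p (Sig c) N)"

lemma low_coord_in:
  assumes "f \<in> fixed G"
  shows "low_coord N f \<in> box B N"
  unfolding low_coord_def
  using assms
  by (auto simp: inv_le_def coord_fixed Sig.fixed_restrict_degree intro!: Sig.red_in_invariants p0 deg_le_red deg_le_trunc)

lemma represents_diff:
  assumes "represents f k" "represents g k'"
  shows "represents (f - g) (\<lambda>b. k b - k' b)"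
proof -
  have "red p (f - g) = red p ((\<Sum>b\<in>B. k b * b) - (\<Sum>b\<in>B. k' b * b))"
    using assms by (intro red_cong_diff) (auto simp: represents_def)
  then show ?thesis
    using assms by (auto simp: represents_def left_diff_distrib sum_subtractf intro: Sig.fixed_diff)
qed

lemma low_coord_diff_eq_0:
  assumes "f \<in> fixed G" "g \<in> fixed G" and e: "low_coord N f = low_coord N g"
  shows "low_coord N (f - g) = restrict (\<lambda>_. 0) B"
proof (rule low_coord_eqI)
  show "f - g \<in> fixed G" using assms by (intro G.fixed_diff)
  show "represents (f - g) (\<lambda>b. coord f b - coord g b)"
    using assms by (intro represents_diff represents_coord)
  fix b assume b: "b \<in> B"
  have "red p (trunc N (coord f b)) = red p (trunc N (coord g b))"
    using fun_cong[OF e, of b] b by (simp add: low_coord_apply)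
  then have "red p (trunc N (coord f b) - trunc N (coord g b)) =
      red p (trunc N (coord g b) - trunc N (coord g b))"
    by (intro red_cong_diff) simp_all
  then show "red p (trunc N (coord f b - coord g b)) = 0" by (simp add: restrict_monos_diff)
qed

lemma eq_if_low_coord_diff_eq_0:
  assumes "f \<in> fixed G" "g \<in> fixed G" and e: "low_coord N (f - g) = restrict (\<lambda>_. 0) B"
  shows "low_coord N f = low_coord N g"
proof -
  have "represents f (\<lambda>b. coord (f - g) b + coord g b)"
  proof -
    have fg: "represents (f - g) (coord (f - g))" using assms by (intro represents_coord G.fixed_diff)
    have g: "represents g (coord g)" using assms by (intro represents_coord)
    have "red p ((f - g) + g) = red p ((\<Sum>b\<in>B. coord (f - g) b * b) + (\<Sum>b\<in>B. coord g b * b))"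
      using fg g by (intro red_cong_add) (auto simp: represents_def)
    then show ?thesis
      using fg g by (auto simp: represents_def distrib_right sum.distrib intro: Sig.fixed_add)
  qed
  then have "low_coord N f = restrict (\<lambda>b. red p (trunc N (coord g b))) B"
  proof (rule low_coord_eqI[OF assms(1)])
    fix b assume b: "b \<in> B"
    have "red p (trunc N (coord (f - g) b)) = red p 0"
      using fun_cong[OF e, of b] b by (simp add: low_coord_apply)
    then have "red p (trunc N (coord (f - g) b) + trunc N (coord g b)) = red p (0 + trunc N (coord g b))"
      by (intro red_cong_add) simp_all
    then show "red p (trunc N (coord (f - g) b + coord g b)) = red p (trunc N (coord g b))"
      by (simp add: restrict_monos_add)
  qed
  then show ?thesis by (simp add: low_coord_def)
qed

text \<open>
  Terms of degree above \<open>N\<close> form an ideal, so they are invisible in the truncated coordinates even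
  after multiplication by the coordinates of the $\theta$.
\<close>

lemma low_coord_comb_eq_0:
  assumes s: "\<And>\<theta>. \<theta> \<in> \<Theta> \<Longrightarrow> s \<theta> \<in> fixed (Sig c)"
    and low: "\<And>\<theta>. \<theta> \<in> \<Theta> \<Longrightarrow> red p (trunc N (s \<theta>)) = 0"
  shows "low_coord N (comb s) = restrict (\<lambda>_. 0) B"
proof (rule low_coord_eqI)
  let ?k = "\<lambda>b. \<Sum>\<theta>\<in>\<Theta>. (s \<theta> - trunc N (s \<theta>)) * coord \<theta> b"
  show "comb s \<in> fixed G" using s by (rule comb_fixed)
  have \<Theta>G: "\<theta> \<in> fixed G" if "\<theta> \<in> \<Theta>" for \<theta> using that \<Theta>_fixed by blast
  have "red p (comb s) = red p (\<Sum>\<theta>\<in>\<Theta>. (s \<theta> - trunc N (s \<theta>)) * (\<Sum>b\<in>B. coord \<theta> b * b))"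
  proof (intro red_cong_sum red_cong_mult)
    fix \<theta> assume \<theta>: "\<theta> \<in> \<Theta>"
    have "red p (s \<theta> - 0) = red p (s \<theta> - trunc N (s \<theta>))"
      by (rule red_cong_diff) (simp_all add: low[OF \<theta>])
    then show "red p (s \<theta>) = red p (s \<theta> - trunc N (s \<theta>))" by simp
    show "red p \<theta> = red p (\<Sum>b\<in>B. coord \<theta> b * b)"
      using represents_coord[OF \<Theta>G[OF \<theta>]] by (simp add: represents_def)
  qed
  also have "(\<Sum>\<theta>\<in>\<Theta>. (s \<theta> - trunc N (s \<theta>)) * (\<Sum>b\<in>B. coord \<theta> b * b)) = (\<Sum>b\<in>B. ?k b * b)"
    by (simp only: sum_distrib_left sum_distrib_right mult.assoc) (rule sum.swap)
  finally show "represents (comb s) ?k"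
    unfolding represents_def
    using s \<Theta>G by (auto intro!: Sig.fixed_sum Sig.fixed_mult Sig.fixed_diff Sig.fixed_restrict_degree coord_fixed)
  show "red p (trunc N (?k b)) = 0" if "b \<in> B" for b
    by (simp add: restrict_monos_sum trunc_mult_eq_0[OF trunc_diff_trunc])
qed

lemma congruent_Splus_if_low_coord_eq_0:
  assumes f: "f \<in> fixed G" and e: "low_coord 0 f = restrict (\<lambda>_. 0) B"
  obtains x h where "x \<in> smod Splus (fixed G)" "h \<in> fixed G" "f = x + of_int (int p) * h"
proof -
  let ?x = "\<Sum>b\<in>B. (coord f b - trunc 0 (coord f b)) * b"
  have S: "coord f b - trunc 0 (coord f b) \<in> Splus" if "b \<in> B" for b
  proof -
    have "coord f b - trunc 0 (coord f b) \<in> fixed (Sig c)"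
      by (intro Sig.fixed_diff Sig.fixed_restrict_degree coord_fixed f that)
    then show ?thesis by (simp add: Splus_def lookup_minus lookup_restrict_monos)
  qed
  have x: "?x \<in> smod Splus (fixed G)" using S B_fixed by (intro smod_sum smod_gen)
  have xG: "?x \<in> fixed G"
  proof (rule G.fixed_sum, rule G.fixed_mult)
    fix b assume b: "b \<in> B"
    then show "coord f b - trunc 0 (coord f b) \<in> fixed G"
      using S fixed_Sig_subset unfolding Splus_def by blast
    show "b \<in> fixed G" using b by (rule B_fixed)
  qed
  have "red p f = red p (\<Sum>b\<in>B. coord f b * b)"
    using represents_coord[OF f] by (simp add: represents_def)
  also have "\<dots> = red p ?x"
  proof (intro red_cong_sum red_cong_mult)
    fix b assume b: "b \<in> B"
    have "red p (trunc 0 (coord f b)) = red p 0" using fun_cong[OF e, of b] b by (simp add: low_coord_apply)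
    then have "red p (coord f b - trunc 0 (coord f b)) = red p (coord f b - 0)"
      by (intro red_cong_diff) simp_all
    then show "red p (coord f b) = red p (coord f b - trunc 0 (coord f b))" by simp
  qed simp
  finally obtain h where "h \<in> fixed G" "f = ?x + of_int (int p) * h"
    using G.red_eq_fixedE[OF _ f xG p0(1)] by blast
  then show thesis using that x by blast
qed

lemma inv_le_fixed: "f \<in> inv_le p H N \<Longrightarrow> f \<in> fixed H"
  by (simp add: inv_le_def invariants_FV)

lemma card_box: "finite A \<Longrightarrow> card (box A N) = card (inv_le p (Sig c) N) ^ card A"
  by (simp add: card_PiE)

lemma finite_box: "finite A \<Longrightarrow> finite (box A N)"
  by (simp add: finite_PiE finite_inv_le p0)

lemma comb_fixed_box: "s \<in> box \<Theta> N \<Longrightarrow> comb s \<in> fixed G"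
  by (intro comb_fixed) (auto dest: PiE_mem inv_le_fixed)

lemma box_0_const: "s \<in> box \<Theta> 0 \<Longrightarrow> \<theta> \<in> \<Theta> \<Longrightarrow> s \<theta> = single 0 (lookup (s \<theta>) 0)"
  by (intro poly_mapping_eqI)
     (auto simp: lookup_single when_def inv_le_def deg_le_def in_keys_iff dest!: PiE_mem)

text \<open>
  The elements of \<open>box \<Theta> 0\<close> are the families of constants modulo \<open>p\<close>; a difference in the kernel is
  trivial by \<open>independent_mod\<close>.
\<close>

lemma low_coord_comb_inj_0: "inj_on (\<lambda>s. low_coord 0 (comb s)) (box \<Theta> 0)"
proof (rule inj_onI)
  fix s s' assume s: "s \<in> box \<Theta> 0" and s': "s' \<in> box \<Theta> 0" and e: "low_coord 0 (comb s) = low_coord 0 (comb s')"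
  note fixd = comb_fixed_box[OF s] comb_fixed_box[OF s']
  have "low_coord 0 (comb s - comb s') = restrict (\<lambda>_. 0) B" using fixd e by (rule low_coord_diff_eq_0)
  then obtain x h where xh: "x \<in> smod Splus (fixed G)" "h \<in> fixed G"
    "comb s - comb s' = x + of_int (int p) * h"
    using congruent_Splus_if_low_coord_eq_0[OF G.fixed_diff[OF fixd]] by blast
  have "comb s - comb s' = (\<Sum>\<theta>\<in>\<Theta>. single 0 (lookup (s \<theta>) 0 - lookup (s' \<theta>) 0) * \<theta>)"
    unfolding sum_subtractf[symmetric] left_diff_distrib[symmetric] single_diff
    using box_0_const[OF s] box_0_const[OF s'] by (intro sum.cong) auto
  then have "int p dvd lookup (s \<theta>) 0 - lookup (s' \<theta>) 0" if "\<theta> \<in> \<Theta>" for \<theta>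
    using xh that by (intro independent_mod[of "\<lambda>\<theta>. lookup (s \<theta>) 0 - lookup (s' \<theta>) 0"]) auto
  moreover have "lookup (t \<theta>) 0 \<in> {0..<int p}" if "t \<in> box \<Theta> 0" "\<theta> \<in> \<Theta>" for t \<theta>
    using PiE_mem[OF that] by (auto simp: inv_le_def invariants_FV)
  ultimately have "lookup (s \<theta>) 0 = lookup (s' \<theta>) 0" if "\<theta> \<in> \<Theta>" for \<theta>
    using that s s' by (metis atLeastLessThan_iff mod_eq_dvd_iff mod_pos_pos_trivial)
  then show "s = s'" using box_0_const[OF s] box_0_const[OF s'] by (intro PiE_ext[OF s s']) metis
qed

text \<open>
  Injectivity gives $|\Theta|\le|B|$, while $|B|\le\ell\le|\Theta|$ by \<open>basis_finite_rank\<close> and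
  \<open>card_\<Theta>_ge\<close>.
\<close>

lemma card_B_eq: "card B = card \<Theta>"
proof -
  have "card (box \<Theta> 0) \<le> card (box B 0)"
    using low_coord_comb_inj_0
  proof (rule card_inj_on_le)
    show "(\<lambda>s. low_coord 0 (comb s)) ` box \<Theta> 0 \<subseteq> box B 0"
      using low_coord_in comb_fixed_box by blast
  qed (rule finite_box[OF finite_B])
  then have "card (inv_le p (Sig c) 0) ^ card \<Theta> \<le> card (inv_le p (Sig c) 0) ^ card B"
    using finite_\<Theta> finite_B by (simp add: card_box)
  then have "card \<Theta> \<le> card B"
    using Sig.card_inv_le_ge_2[OF p0(2), of c 0] by (simp add: power_le_imp_le_exp)
  then show ?thesis using card_B card_\<Theta>_ge by simp
qed

lemma low_coord_comb_surj_0: "(\<lambda>s. low_coord 0 (comb s)) ` box \<Theta> 0 = box B 0"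
proof (rule card_subset_eq)
  show "finite (box B 0)" by (rule finite_box[OF finite_B])
  show "(\<lambda>s. low_coord 0 (comb s)) ` box \<Theta> 0 \<subseteq> box B 0"
    using low_coord_in comb_fixed_box by blast
  show "card ((\<lambda>s. low_coord 0 (comb s)) ` box \<Theta> 0) = card (box B 0)"
    using card_image[OF low_coord_comb_inj_0] finite_\<Theta> finite_B by (simp add: card_box card_B_eq)
qed

text \<open>
  Membership, modulo \<open>p\<close>, in the module generated by \<open>\<Theta>\<close>.
\<close>

definition spanned_mod :: "('n, int) mpoly \<Rightarrow> bool" where
  "spanned_mod f \<longleftrightarrow> (\<exists>y\<in>smod (fixed (Sig c)) \<Theta>. \<exists>h\<in>fixed G. f = y + of_int (int p) * h)"

lemma spanned_mod_add: "spanned_mod f \<Longrightarrow> spanned_mod g \<Longrightarrow> spanned_mod (f + g)"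
proof -
  assume "spanned_mod f" "spanned_mod g"
  then obtain y h y' h' where "y \<in> smod (fixed (Sig c)) \<Theta>" "h \<in> fixed G" "f = y + of_int (int p) * h"
    "y' \<in> smod (fixed (Sig c)) \<Theta>" "h' \<in> fixed G" "g = y' + of_int (int p) * h'"
    unfolding spanned_mod_def by blast
  then show ?thesis unfolding spanned_mod_def
    by (intro bexI[of _ "y + y'"] bexI[of _ "h + h'"]) (auto simp: distrib_left intro: smod_add G.fixed_add)
qed

lemma spanned_mod_mult: "s \<in> fixed (Sig c) \<Longrightarrow> spanned_mod f \<Longrightarrow> spanned_mod (s * f)"
proof -
  assume s: "s \<in> fixed (Sig c)" and "spanned_mod f"
  then obtain y h where yh: "y \<in> smod (fixed (Sig c)) \<Theta>" "h \<in> fixed G" "f = y + of_int (int p) * h"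
    unfolding spanned_mod_def by blast
  have "s * y \<in> smod (fixed (Sig c)) \<Theta>" by (rule smod_mult[OF Sig.fixed_mult s yh(1)])
  moreover have "s * h \<in> fixed G" using s yh fixed_Sig_subset by (intro G.fixed_mult) auto
  moreover have "s * f = s * y + of_int (int p) * (s * h)" unfolding yh(3) by (simp add: algebra_simps)
  ultimately show ?thesis unfolding spanned_mod_def by blast
qed

lemma spanned_mod_smod: "f \<in> smod (fixed (Sig c)) \<Theta> \<Longrightarrow> spanned_mod f"
  unfolding spanned_mod_def by (intro bexI[of _ f] bexI[of _ 0]) (simp_all add: G.fixed_0)

lemma spanned_mod_sum: "(\<And>i. i \<in> I \<Longrightarrow> spanned_mod (f i)) \<Longrightarrow> spanned_mod (\<Sum>i\<in>I. f i)"
  by (induction I rule: infinite_finite_induct) (auto intro: spanned_mod_add spanned_mod_smod smod.zero)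

lemma spanned_mod_multiple: "h \<in> fixed G \<Longrightarrow> spanned_mod (of_int (int p) * h)"
  unfolding spanned_mod_def by (intro bexI[of _ 0] bexI[of _ h]) (simp_all add: smod.zero)

lemma spanned_mod_aug:
  assumes "x \<in> aug c (fixed G) d"
    and "\<And>e f. e < d \<Longrightarrow> f \<in> fixed G \<Longrightarrow> homogeneous e f \<Longrightarrow> spanned_mod f"
  shows "spanned_mod x"
  using assms(1)
proof induction
  case zero
  show ?case by (intro spanned_mod_smod smod.zero)
next
  case (step x s e f e')
  have "spanned_mod f" using step by (intro assms(2)[of e']) auto
  then show ?case using step spanned_mod_add spanned_mod_mult by blast
qed

text \<open>
  Surjectivity on constant terms says that $\Theta$ spans $A/(S_+A+pA)$.
\<close>

lemma decompose_mod:
  assumes f: "f \<in> fixed G"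
  obtains a x h where "f = (\<Sum>\<theta>\<in>\<Theta>. single 0 (a \<theta>) * \<theta>) + x + of_int (int p) * h"
    "x \<in> smod Splus (fixed G)" "h \<in> fixed G"
proof -
  have "low_coord 0 f \<in> (\<lambda>s. low_coord 0 (comb s)) ` box \<Theta> 0"
    unfolding low_coord_comb_surj_0 using f by (rule low_coord_in)
  then obtain s where s: "s \<in> box \<Theta> 0" "low_coord 0 f = low_coord 0 (comb s)" by blast
  have "low_coord 0 (f - comb s) = restrict (\<lambda>_. 0) B"
    using f comb_fixed_box[OF s(1)] s(2) by (rule low_coord_diff_eq_0)
  then obtain x h where xh: "x \<in> smod Splus (fixed G)" "h \<in> fixed G" "f - comb s = x + of_int (int p) * h"
    using congruent_Splus_if_low_coord_eq_0[OF G.fixed_diff[OF f comb_fixed_box[OF s(1)]]] by blast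
  have "comb s = (\<Sum>\<theta>\<in>\<Theta>. single 0 (lookup (s \<theta>) 0) * \<theta>)"
    using box_0_const[OF s(1)] by (intro sum.cong) auto
  then have "f = (\<Sum>\<theta>\<in>\<Theta>. single 0 (lookup (s \<theta>) 0) * \<theta>) + x + of_int (int p) * h"
    using xh(3) by (simp add: algebra_simps)
  then show thesis by (rule that[OF _ xh(1,2)])
qed

text \<open>
  The graded Nakayama lemma: the component of degree \<open>d\<close> of an element of $S_+A$ only involves
  invariants of smaller degree, to which induction applies.
\<close>

lemma spanned_mod_homogeneous: "f \<in> fixed G \<Longrightarrow> homogeneous d f \<Longrightarrow> spanned_mod f"
proof (induction d arbitrary: f rule: less_induct)
  case (less d)
  obtain a x h where axh: "f = (\<Sum>\<theta>\<in>\<Theta>. single 0 (a \<theta>) * \<theta>) + x + of_int (int p) * h"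
    "x \<in> smod Splus (fixed G)" "h \<in> fixed G"
    using decompose_mod[OF less.prems(1)] .
  have mult: "hcomp d (of_int (int p) * h) = of_int (int p) * hcomp d h"
    by (rule poly_mapping_eqI) (simp add: lookup_restrict_monos lookup_of_int_mult when_def del: of_int_of_nat_eq)
  have "f = hcomp d f" using hcomp_of_homogeneous[OF less.prems(2)] by simp
  also have "\<dots> = (\<Sum>\<theta>\<in>\<Theta>. hcomp d (single 0 (a \<theta>) * \<theta>)) + hcomp d x + of_int (int p) * hcomp d h"
    by (subst axh(1)) (simp only: restrict_monos_add restrict_monos_sum mult)
  also have "spanned_mod \<dots>"
  proof (intro spanned_mod_add)
    show "spanned_mod (\<Sum>\<theta>\<in>\<Theta>. hcomp d (single 0 (a \<theta>) * \<theta>))"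
      by (intro spanned_mod_sum spanned_mod_smod)
         (auto simp: const_mult_part intro: smod.zero smod_gen Sig.fixed_const)
    show "spanned_mod (hcomp d x)"
      using hcomp_Splus[OF axh(2)] less.IH by (rule spanned_mod_aug)
    show "spanned_mod (of_int (int p) * hcomp d h)"
      using axh(3) by (intro spanned_mod_multiple G.fixed_hcomp)
  qed
  finally show ?case .
qed

lemma generates_mod:
  assumes f: "f \<in> fixed G"
  obtains s where "\<And>\<theta>. \<theta> \<in> \<Theta> \<Longrightarrow> s \<theta> \<in> fixed (Sig c)" "red p f = red p (comb s)"
proof -
  obtain D where D: "\<forall>m\<in>keys f. mono_degree m \<le> D" using ex_degree_bound by blast
  have "spanned_mod (\<Sum>d\<le>D. hcomp d f)"
    using spanned_mod_homogeneous[OF G.fixed_hcomp[OF f] hcomp_homogeneous] by (rule spanned_mod_sum)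
  then have "spanned_mod f" using sum_hcomp[OF D] by simp
  then obtain y h where yh: "y \<in> smod (fixed (Sig c)) \<Theta>" "f = y + of_int (int p) * h"
    unfolding spanned_mod_def by blast
  have "\<exists>s. (\<forall>\<theta>\<in>\<Theta>. s \<theta> \<in> fixed (Sig c)) \<and> y = comb s"
    by (rule iffD1[OF smod_explicit yh(1)]) (use finite_\<Theta> Sig.fixed_0 Sig.fixed_add in auto)
  then obtain s where s: "\<forall>\<theta>\<in>\<Theta>. s \<theta> \<in> fixed (Sig c)" "y = comb s" by (elim exE conjE) (rule that)
  have "red p f = red p (comb s)" unfolding yh(2) s(2) red_add_mult ..
  then show thesis using that s(1) by blast
qed

lemma low_coord_comb_trunc:
  fixes N :: nat and t :: "('n, int) mpoly \<Rightarrow> ('n, int) mpoly"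
  assumes t: "\<And>\<theta>. \<theta> \<in> \<Theta> \<Longrightarrow> t \<theta> \<in> fixed (Sig c)"
  defines "s \<equiv> restrict (\<lambda>\<theta>. red p (trunc N (t \<theta>))) \<Theta>"
  shows "s \<in> box \<Theta> N" and "low_coord N (comb t) = low_coord N (comb s)"
proof -
  show s: "s \<in> box \<Theta> N"
    unfolding s_def using t
    by (auto simp: inv_le_def intro!: Sig.red_in_invariants p0 deg_le_red deg_le_trunc Sig.fixed_restrict_degree)
  have sS: "s \<theta> \<in> fixed (Sig c)" if "\<theta> \<in> \<Theta>" for \<theta>
    using PiE_mem[OF s that] by (rule inv_le_fixed)
  have "low_coord N (comb (\<lambda>\<theta>. t \<theta> - s \<theta>)) = restrict (\<lambda>_. 0) B"
  proof (rule low_coord_comb_eq_0)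
    fix \<theta> assume \<theta>: "\<theta> \<in> \<Theta>"
    show "t \<theta> - s \<theta> \<in> fixed (Sig c)" using t[OF \<theta>] sS[OF \<theta>] by (rule Sig.fixed_diff)
    have "trunc N (s \<theta>) = s \<theta>"
      using PiE_mem[OF s \<theta>] by (intro trunc_id) (simp add: inv_le_def)
    moreover have "red p (trunc N (t \<theta>) - s \<theta>) = red p (trunc N (t \<theta>) - trunc N (t \<theta>))"
      using \<theta> by (intro red_cong_diff) (simp_all add: s_def)
    ultimately show "red p (trunc N (t \<theta> - s \<theta>)) = 0" by (simp add: restrict_monos_diff)
  qed
  then have "low_coord N (comb t - comb s) = restrict (\<lambda>_. 0) B"
    by (simp add: left_diff_distrib sum_subtractf)
  then show "low_coord N (comb t) = low_coord N (comb s)"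
    using comb_fixed[OF t] comb_fixed[OF sS] by (intro eq_if_low_coord_diff_eq_0)
qed

text \<open>
  Since $\Theta$ generates, every truncated family of coordinates is attained, already by coefficients of
  degree at most \<open>N\<close>.  Both sides are finite with the same number of elements, so the surjection is
  injective.
\<close>

lemma low_coord_comb_inj: "inj_on (\<lambda>s. low_coord N (comb s)) (box \<Theta> N)"
proof (rule eq_card_imp_inj_on)
  show "finite (box \<Theta> N)" by (rule finite_box[OF finite_\<Theta>])
  have "box B N \<subseteq> (\<lambda>s. low_coord N (comb s)) ` box \<Theta> N"
  proof
    fix u assume u: "u \<in> box B N"
    let ?x = "\<Sum>b\<in>B. u b * b"
    have uS: "u b \<in> fixed (Sig c)" if "b \<in> B" for b using PiE_mem[OF u that] by (rule inv_le_fixed)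
    have x: "?x \<in> fixed G"
      using uS fixed_Sig_subset B_fixed by (intro G.fixed_sum G.fixed_mult) auto
    obtain t where t: "\<And>\<theta>. \<theta> \<in> \<Theta> \<Longrightarrow> t \<theta> \<in> fixed (Sig c)" "red p ?x = red p (comb t)"
      using generates_mod[OF x] by blast
    have "low_coord N (comb t) = restrict u B"
    proof (rule low_coord_eqI[OF comb_fixed[OF t(1)]])
      show "represents (comb t) u" using t(2) uS by (simp add: represents_def)
      fix b assume b: "b \<in> B"
      have "u b \<in> inv_le p (Sig c) N" using PiE_mem[OF u b] .
      then show "red p (trunc N (u b)) = u b"
        using red_id_FV[of "u b" p "Sig c"] by (simp add: inv_le_def trunc_id)
    qed
    also have "restrict u B = u" using u by (rule PiE_restrict)
    finally show "u \<in> (\<lambda>s. low_coord N (comb s)) ` box \<Theta> N"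
      by (intro image_eqI[OF _ low_coord_comb_trunc(1)[where t = t and N = N, OF t(1)]])
         (simp add: low_coord_comb_trunc(2)[where t = t and N = N, OF t(1)])
  qed
  moreover have "(\<lambda>s. low_coord N (comb s)) ` box \<Theta> N \<subseteq> box B N" using low_coord_in comb_fixed_box by blast
  ultimately have "(\<lambda>s. low_coord N (comb s)) ` box \<Theta> N = box B N" by blast
  then show "card ((\<lambda>s. low_coord N (comb s)) ` box \<Theta> N) = card (box \<Theta> N)"
    using finite_\<Theta> finite_B by (simp add: card_box card_B_eq)
qed

text \<open>
  Apply \<open>low_coord_comb_inj\<close> with \<open>N\<close> at least the degree of the coefficient in question.
\<close>

lemma relations_trivial_mod:
  assumes r: "\<And>\<theta>. \<theta> \<in> \<Theta> \<Longrightarrow> r \<theta> \<in> fixed (Sig c)" and rel: "red p (comb r) = 0" and \<theta>: "\<theta> \<in> \<Theta>"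
  shows "red p (r \<theta>) = 0"
proof -
  obtain N where N: "deg_le N (r \<theta>)" using ex_degree_bound[of "r \<theta>"] by (auto simp: deg_le_def)
  let ?t = "\<lambda>r. restrict (\<lambda>\<theta>. red p (trunc N (r \<theta>))) \<Theta>"
  have zero: "low_coord N f = restrict (\<lambda>_. 0) B" if "f \<in> fixed G" "red p f = 0" for f
    using that by (intro low_coord_eqI[where k = "\<lambda>_. 0"]) (simp_all add: represents_def Sig.fixed_0)
  have "low_coord N (comb r) = low_coord N (comb (\<lambda>_. 0))"
    using zero[OF comb_fixed[OF r] rel] zero[OF comb_fixed[OF Sig.fixed_0]] by simp
  then have "low_coord N (comb (?t r)) = low_coord N (comb (?t (\<lambda>_. 0)))"
    using low_coord_comb_trunc(2)[where t = r and N = N, OF r]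
      low_coord_comb_trunc(2)[where t = "\<lambda>_. 0" and N = N, OF Sig.fixed_0] by simp
  then have "?t r = ?t (\<lambda>_. 0)"
    using low_coord_comb_trunc(1)[where t = r and N = N, OF r]
      low_coord_comb_trunc(1)[where t = "\<lambda>_. 0" and N = N, OF Sig.fixed_0]
    by (rule inj_onD[OF low_coord_comb_inj])
  then have "?t r \<theta> = ?t (\<lambda>_. 0) \<theta>" by (rule fun_cong)
  then show ?thesis using \<theta> N by (simp add: trunc_id)
qed

text \<open>
  Existence is \<open>generates_mod\<close> and uniqueness is \<open>relations_trivial_mod\<close>; what remains is to pass from
  the set \<open>\<Theta>\<close> to positions in the list.
\<close>

lemma module_basis_list:
  assumes dist: "distinct \<theta>s" and set: "set \<theta>s = \<Theta>"
  shows "module_basis (FV p) (invariants (FV p) (Sig c)) (invariants (FV p) G)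
    {..<length \<theta>s} (\<lambda>i. red p (\<theta>s ! i))"
proof -
  let ?I = "{..<length \<theta>s}" and ?S = "invariants (FV p) (Sig c)"
  have bij: "bij_betw ((!) \<theta>s) ?I \<Theta>" using bij_betw_nth[OF dist] set by auto
  have lin: "lin_comb (FV p) (\<lambda>i. red p (\<theta>s ! i)) k =
      red p (comb (\<lambda>\<theta>. k (inv_into ?I ((!) \<theta>s) \<theta>)))" if k: "k \<in> coeff_families (FV p) ?S ?I" for k
  proof -
    have supp: "{i. k i \<noteq> 0} \<subseteq> ?I" using k by (auto simp: coeff_families_def FV_def)
    have "lin_comb (FV p) (\<lambda>i. red p (\<theta>s ! i)) k = red p (\<Sum>i\<in>?I. k i * red p (\<theta>s ! i))"
      by (rule lin_comb_FV[OF p _ supp]) simp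
    also have "\<dots> = red p (\<Sum>i\<in>?I. k i * \<theta>s ! i)"
      by (intro red_cong_sum red_cong_mult) simp_all
    also have "(\<Sum>i\<in>?I. k i * \<theta>s ! i) = (\<Sum>i\<in>?I. (\<lambda>\<theta>. k (inv_into ?I ((!) \<theta>s) \<theta>) * \<theta>) (\<theta>s ! i))"
      using bij by (intro sum.cong) (auto simp: bij_betw_def inv_into_f_f)
    also have "\<dots> = comb (\<lambda>\<theta>. k (inv_into ?I ((!) \<theta>s) \<theta>))" by (rule sum.reindex_bij_betw[OF bij])
    finally show ?thesis .
  qed
  have inv_I: "inv_into ?I ((!) \<theta>s) \<theta> \<in> ?I" if "\<theta> \<in> \<Theta>" for \<theta>
    using bij that by (metis bij_betw_imp_surj_on inv_into_into)
  have k_fixed: "k (inv_into ?I ((!) \<theta>s) \<theta>) \<in> ?S"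
    if k: "k \<in> coeff_families (FV p) ?S ?I" and "\<theta> \<in> \<Theta>" for k \<theta>
    using k inv_I[OF that(2)] by (auto simp: coeff_families_def)
  have "\<exists>!k. k \<in> coeff_families (FV p) ?S ?I \<and> x = lin_comb (FV p) (\<lambda>i. red p (\<theta>s ! i)) k"
    if x: "x \<in> invariants (FV p) G" for x
  proof -
    have "x \<in> fixed G" using x by (simp add: invariants_FV)
    then obtain s where s: "\<And>\<theta>. \<theta> \<in> \<Theta> \<Longrightarrow> s \<theta> \<in> fixed (Sig c)" "red p x = red p (comb s)"
      using generates_mod by blast
    let ?k = "\<lambda>i. if i < length \<theta>s then red p (s (\<theta>s ! i)) else 0"
    have k: "?k \<in> coeff_families (FV p) ?S ?I"
    proof -
      have "red p (s (\<theta>s ! i)) \<in> ?S" if "i < length \<theta>s" for i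
        using that set s(1) by (intro Sig.red_in_invariants p0) auto
      moreover have "finite {i. ?k i \<noteq> 0}" by (rule finite_subset[of _ ?I]) auto
      ultimately show ?thesis by (auto simp: coeff_families_def FV_def)
    qed
    have "lin_comb (FV p) (\<lambda>i. red p (\<theta>s ! i)) ?k = red p (comb s)"
      unfolding lin[OF k]
    proof (intro red_cong_sum red_cong_mult refl)
      fix \<theta> assume \<theta>: "\<theta> \<in> \<Theta>"
      have "\<theta>s ! inv_into ?I ((!) \<theta>s) \<theta> = \<theta>" using bij \<theta> by (metis bij_betw_inv_into_right)
      then show "red p (?k (inv_into ?I ((!) \<theta>s) \<theta>)) = red p (s \<theta>)" using inv_I[OF \<theta>] by simp
    qed
    then have ex: "x = lin_comb (FV p) (\<lambda>i. red p (\<theta>s ! i)) ?k" using s(2) red_id_FV[OF x] by simp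
    show ?thesis
    proof (rule ex1I)
      show "?k \<in> coeff_families (FV p) ?S ?I \<and> x = lin_comb (FV p) (\<lambda>i. red p (\<theta>s ! i)) ?k"
        using k ex by blast
      fix k' assume k': "k' \<in> coeff_families (FV p) ?S ?I \<and> x = lin_comb (FV p) (\<lambda>i. red p (\<theta>s ! i)) k'"
      let ?J = "inv_into ?I ((!) \<theta>s)"
      let ?r = "\<lambda>\<theta>. k' (?J \<theta>) - ?k (?J \<theta>)"
      have kS: "k'' (?J \<theta>) \<in> fixed (Sig c)" if "k'' \<in> coeff_families (FV p) ?S ?I" "\<theta> \<in> \<Theta>" for k'' \<theta>
        using k_fixed[OF that] by (simp add: invariants_FV)
      have "red p (comb (\<lambda>\<theta>. k' (?J \<theta>))) = red p (comb (\<lambda>\<theta>. ?k (?J \<theta>)))"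
        using lin[OF k] lin[of k'] k' ex by metis
      then have "red p (comb (\<lambda>\<theta>. k' (?J \<theta>)) - comb (\<lambda>\<theta>. ?k (?J \<theta>))) =
          red p (comb (\<lambda>\<theta>. ?k (?J \<theta>)) - comb (\<lambda>\<theta>. ?k (?J \<theta>)))"
        by (rule red_cong_diff) (rule refl)
      then have rel: "red p (comb ?r) = 0" by (simp add: left_diff_distrib sum_subtractf)
      have "k' i = ?k i" if i: "i \<in> ?I" for i
      proof -
        have J: "?J (\<theta>s ! i) = i" "\<theta>s ! i \<in> \<Theta>" using bij i by (auto simp: bij_betw_def inv_into_f_f)
        have "red p (?r (\<theta>s ! i)) = 0"
        proof (rule relations_trivial_mod[of ?r])
          show "?r \<theta> \<in> fixed (Sig c)" if "\<theta> \<in> \<Theta>" for \<theta>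
            using kS[OF _ that, of k'] kS[OF k that] k' by (intro Sig.fixed_diff) blast+
        qed (use rel J in simp_all)
        then have "red p (k' i - ?k i + ?k i) = red p (0 + ?k i)"
          unfolding J by (intro red_cong_add) simp_all
        then have "red p (k' i) = red p (?k i)" by simp
        moreover have red_id: "red p (k'' i) = k'' i" if "k'' \<in> coeff_families (FV p) ?S ?I" for k''
          using that i by (intro red_id_FV[of _ p "Sig c"]) (auto simp: coeff_families_def)
        ultimately show ?thesis
          unfolding red_id[OF k] red_id[OF conjunct1[OF k']] by simp
      qed
      moreover have "k' i = ?k i" if "i \<notin> ?I" for i
        using that k' k by (auto simp: coeff_families_def FV_def)
      ultimately show "k' = ?k" by blast
    qed
  qed
  moreover have "red p (\<theta>s ! i) \<in> invariants (FV p) G" if "i < length \<theta>s" for i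
    using that set \<Theta>_fixed by (intro G.red_in_invariants p0) auto
  ultimately show ?thesis by (auto simp: module_basis_def)
qed

end

theorem theorem9p4:
  fixes c :: "'n::finite \<Rightarrow> nat"
    and G :: "('n \<Rightarrow> 'n) set"
    and \<gamma> :: "'l::finite \<Rightarrow> 'n \<Rightarrow> 'n"
    and \<omega> :: "('n, int) mpoly"
    and z :: "'n \<Rightarrow> int"
    and \<theta>s :: "('n, int) mpoly list"
  assumes "subgroup G (young c)"
    and "left_coset_reps c G \<gamma>"
    and "\<omega> \<in> invariants_deg ZV (carrier (young c)) 1" and "\<omega> \<noteq> 0"
    and "\<forall>\<sigma>\<in>carrier (young c). point_act \<sigma> z = z \<longrightarrow> \<sigma> = id"
    and "eval \<omega> z \<noteq> 0"
    and "algorithm_output c G \<gamma> z \<theta>s"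
  shows "universal_secondaries c G \<theta>s"
proof -
  interpret young_setting c G \<gamma> \<omega> z
    by (intro young_setting.intro assms)
  note out = algorithm_output_graded_basis[OF assms(7)]
  interpret graded_basis c G \<gamma> \<omega> z "set \<theta>s"
    by unfold_locales (use out in auto)
  have "module_basis (FV p) (invariants (FV p) (Sig c)) (invariants (FV p) G)
      {..<length \<theta>s} (\<lambda>i. red p (\<theta>s ! i))"
    if p: "Factorial_Ring.prime p" and cm: "cohen_macaulay (FV p) c G" for p
  proof -
    obtain B where B: "module_basis (FV p) (invariants (FV p) (Sig c)) (invariants (FV p) G) B (\<lambda>b. b)"
      using cm by (auto simp: cohen_macaulay_def free_module_def)
    interpret cm_reduction c G \<gamma> \<omega> z "set \<theta>s" p B
      using p B by unfold_locales
    show ?thesis using out(1) by (rule module_basis_list) simp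
  qed
  then show ?thesis
    unfolding universal_secondaries_def using out(1,2) secondaries_\<Theta> by (simp add: invariants_type)
qed

end
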